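(* Let $f:\mathbb{R}\to\mathbb{R}$ be a $1$-periodic function whose fifth derivative is square integrable over a period. Then the problem $$u_t=-u\,u_x-u_{xxx}+u_{xxxxx},\qquad u(x,0)=f(x)\ \text{ for all } x,\qquad u(x,t)=u(x+1,t)\ \text{ for all } x \text{ and } t,$$ has a unique solution for $t\in\mathbb{R}$; that is, there exists a unique real-valued function $u$, $1$-periodic in $x$, with $u(\cdot,0)=f$, such that for every $t\in\mathbb{R}$ one has $u(\cdot,t)\in H^5$, $u_t(\cdot,t)\in L^2$, and the equation $u_t=-uu_x-u_{xxx}+u_{xxxxx}$ holds at time $t$ as an equality in $L^2$.
   Context: $L^2$ denotes the space of $1$-periodic functions of $x$ that are square integrable over a period, with norm $\|g\|^2=\int_0^1|g(x)|^2\,dx$, and $H^5$ denotes the space of $1$-periodic functions whose weak derivatives up to order five belong to this $L^2$. The hypothesis on $f$ means $f\in H^5$. The time derivative $u_t(\cdot,t)$ is the derivative of the $L^2$-valued map $t\mapsto u(\cdot,t)$. *)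

theory Defs
  imports "HOL-Analysis.Analysis"
begin

text \<open>
  As usual, elements of \<open>L\<^sup>2\<close> are represented by functions, and equality in \<open>L\<^sup>2\<close>
  is equality almost everywhere.
\<close>

definition L2_per :: "(real \<Rightarrow> real) set" where
  "L2_per = {g. (\<forall>x. g (x + 1) = g x) \<and> g \<in> borel_measurable lebesgue \<and>
                set_integrable lebesgue {0..1} (\<lambda>x. \<bar>g x\<bar>\<^sup>2)}"

text \<open>The Bochner integral is 0 on non-integrable functions, so this is the norm only on
  \<open>L2_per\<close>.\<close>

definition L2_norm :: "(real \<Rightarrow> real) \<Rightarrow> real" where
  "L2_norm g = sqrt (LINT x:{0..1}|lebesgue. \<bar>g x\<bar>\<^sup>2)"

definition smooth_per :: "(real \<Rightarrow> real) \<Rightarrow> bool" where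
  "smooth_per \<phi> \<longleftrightarrow> (\<forall>x. \<phi> (x + 1) = \<phi> x) \<and> (\<forall>n. (deriv ^^ n) \<phi> differentiable_on UNIV)"

text \<open>Weak derivatives of periodic functions, that is, on the circle: the test functions are
  the smooth 1-periodic functions, so integration by parts over a period has no boundary terms.\<close>

definition has_weak_deriv :: "nat \<Rightarrow> (real \<Rightarrow> real) \<Rightarrow> (real \<Rightarrow> real) \<Rightarrow> bool" where
  "has_weak_deriv k g w \<longleftrightarrow> g \<in> L2_per \<and> w \<in> L2_per \<and>
     (\<forall>\<phi>. smooth_per \<phi> \<longrightarrow>
        (LINT x:{0..1}|lebesgue. g x * (deriv ^^ k) \<phi> x) =
        (-1) ^ k * (LINT x:{0..1}|lebesgue. w x * \<phi> x))"

definition H_per :: "nat \<Rightarrow> (real \<Rightarrow> real) set" where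
  "H_per m = {g \<in> L2_per. \<forall>k\<le>m. \<exists>w. has_weak_deriv k g w}"

definition has_L2_derivative :: "(real \<Rightarrow> real \<Rightarrow> real) \<Rightarrow> (real \<Rightarrow> real) \<Rightarrow> real \<Rightarrow> bool" where
  "has_L2_derivative U v t \<longleftrightarrow> (\<forall>s. U s \<in> L2_per) \<and> v \<in> L2_per \<and>
     ((\<lambda>h. L2_norm (\<lambda>x. (U (t + h) x - U t x) / h - v x)) \<longlongrightarrow> 0) (at 0)"

text \<open>The arguments of \<open>u\<close> are in the order \<open>u x t\<close>.  In the last clause \<open>ut\<close>, \<open>ux\<close>, \<open>uxxx\<close>,
  \<open>uxxxxx\<close> represent the derivatives of \<open>u\<close> at time \<open>t\<close>, each unique up to null sets.\<close>

definition is_solution :: "(real \<Rightarrow> real) \<Rightarrow> (real \<Rightarrow> real \<Rightarrow> real) \<Rightarrow> bool" where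
  "is_solution f u \<longleftrightarrow>
     (\<forall>x t. u x t = u (x + 1) t) \<and>
     (\<forall>x. u x 0 = f x) \<and>
     (\<forall>t. (\<lambda>x. u x t) \<in> H_per 5 \<and>
        (\<exists>ut ux uxxx uxxxxx.
           has_L2_derivative (\<lambda>s x. u x s) ut t \<and>
           has_weak_deriv 1 (\<lambda>x. u x t) ux \<and>
           has_weak_deriv 3 (\<lambda>x. u x t) uxxx \<and>
           has_weak_deriv 5 (\<lambda>x. u x t) uxxxxx \<and>
           (AE x in lebesgue. ut x = - u x t * ux x - uxxx x + uxxxxx x)))"

end

theory Submission
  imports Defs
begin

text \<open>
  Write \<open>u\<close> as a Fourier series with coefficients \<open>u k\<close>. The mean \<open>m = u 0\<close> is constant in time, and for
  \<open>k \<noteq> 0\<close> the equation becomes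
  \<open>u k' = i \<omega>(k) u k - i \<pi> k (\<Sum>j. u j u (k - j))\<close> with the sum over \<open>j \<noteq> 0, k\<close> and the real symbol
  \<open>\<omega>(k) = (2 \<pi> k)^5 + (2 \<pi> k)^3 - 2 \<pi> m k\<close>. After the rotation \<open>v k = exp (- i \<omega>(k) t) u k\<close> only the nonlinear
  term is left, and it oscillates with the frequencies \<open>\<Omega> = \<omega>(k) - \<omega>(j) - \<omega>(k - j)\<close>. This number factors as
  \<open>k j (k - j)\<close> times a quantity of size at least \<open>k\<^sup>2\<close>, so there are no resonances.

  Everything rests on one integration by parts in time (\<open>normal_form\<close>): it writes
  the increment of \<open>v k\<close> as a boundary term plus the time integral of a cubic term, and both carry the
  factor \<open>\<pi> k / \<Omega>\<close>, which is bounded by \<open>1 / (k\<^sup>2 \<bar>j\<bar> \<bar>k - j\<bar>)\<close>. The identity only needs a bound for the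
  \<open>\<ell>\<^sup>2\<close> norm. It has two consequences.

  First, a solution with bounded \<open>\<ell>\<^sup>2\<close> norm whose data decay like \<open>\<bar>k\<bar>^(-5)\<close> differs
  from its rotated data by \<open>O(\<bar>k\<bar>^(-6))\<close>, with constants depending on the \<open>\<ell>\<^sup>2\<close> norm, the data and
  the length of the time interval only (\<open>a_priori_decay\<close>); three applications of the identity give
  two, then four, then six powers of decay. Since \<open>\<bar>k\<bar>^5 \<bar>k\<bar>^(-6)\<close> is square summable, this controls the \<open>H\<^sup>5\<close> norm
  on every bounded time interval.

  Second, the difference of two such solutions with equal value at one time is at most half of itself on
  a short time interval (\<open>local_uniqueness\<close>): high frequencies are small because of the factor
  \<open>1 / k\<^sup>2\<close>, low frequencies because the interval is short. A solution in the sense of the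
  theorem is a differentiable function of time with values in \<open>L\<^sup>2\<close>, with no local bound on its \<open>H\<^sup>5\<close> norm. This is
  enough: its \<open>\<ell>\<^sup>2\<close> norm is locally bounded, and the decay follows from the first consequence. A connectedness
  argument makes the uniqueness global (\<open>meanfree_uniqueness\<close>).

  For existence, truncate to finitely many frequencies (\<open>galerkin_solution\<close>). The truncated system conserves the
  \<open>\<ell>\<^sup>2\<close> norm, so its solutions exist for all time and obey the a priori decay uniformly in the truncation.
  By Tychonoff's theorem the truncated solutions have a pointwise cluster point. The decay bounds the second time
  derivatives, hence a Taylor estimate passes to the cluster point and shows that it solves the full system
  (\<open>meanfree_existence\<close>). The uniform decay, of the form
  \<open>\<bar>u k(t)\<bar> \<le> \<bar>u k(0)\<bar> + D \<bar>k\<bar>^(-6)\<close>, also gives the dominating sequence that turns derivatives of single coefficients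
  into a derivative in \<open>L\<^sup>2\<close> (\<open>L2_derivative_of_coefficients\<close>).

  The passage between functions and coefficients needs the completeness of the trigonometric system,
  the Riesz-Fischer theorem, Parseval's identity with the product rule \<open>(g h)^(k) = \<Sum>j. g^(j) h^(k - j)\<close>, and the
  fact that a weak derivative of order \<open>n\<close> is multiplication of the coefficients by \<open>(2 \<pi> i k)^n\<close>.
\<close>

section \<open>Sums over the integers\<close>

text \<open>Estimates for sums of nonnegative terms over the integers are stated as bounds for all finite partial
  sums. Such a bound gives summability and a bound for the infinite sum at once, it can be added and
  reflected without side conditions, and it survives pointwise limits of the terms.\<close>
definition finsum_le :: "(int \<Rightarrow> real) \<Rightarrow> real \<Rightarrow> bool" where
  "finsum_le f S \<longleftrightarrow> (\<forall>F. finite F \<longrightarrow> sum f F \<le> S)"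

lemma finsum_leD: "finsum_le f S \<Longrightarrow> finite F \<Longrightarrow> sum f F \<le> S"
  by (simp add: finsum_le_def)

lemma finsum_le_mono: "finsum_le g S \<Longrightarrow> (\<And>j. f j \<le> g j) \<Longrightarrow> S \<le> S' \<Longrightarrow> finsum_le f S'"
  unfolding finsum_le_def by (meson order_trans sum_mono)

lemma finsum_le_add: "finsum_le f S \<Longrightarrow> finsum_le g T \<Longrightarrow> finsum_le (\<lambda>j. f j + g j) (S + T)"
  unfolding finsum_le_def by (simp add: sum.distrib add_mono)

lemma finsum_le_cmult: "finsum_le f S \<Longrightarrow> 0 \<le> c \<Longrightarrow> finsum_le (\<lambda>j. c * f j) (c * S)"
  unfolding finsum_le_def by (simp add: sum_distrib_left[symmetric] mult_left_mono)

lemma finsum_le_reflect: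
  assumes "finsum_le f S" shows "finsum_le (\<lambda>j. f (k - j)) S"
  unfolding finsum_le_def
proof (intro allI impI)
  fix F :: "int set" assume F: "finite F"
  have "(\<Sum>j\<in>F. f (k - j)) = sum f ((\<lambda>j. k - j) ` F)"
    by (subst sum.reindex) (auto simp: inj_on_def)
  also have "\<dots> \<le> S" using assms F by (simp add: finsum_le_def)
  finally show "(\<Sum>j\<in>F. f (k - j)) \<le> S" .
qed

lemma finsum_le_nonneg: "finsum_le f S \<Longrightarrow> 0 \<le> S"
  unfolding finsum_le_def by (metis finite.emptyI sum.empty)

lemma finsum_le_term: "finsum_le f S \<Longrightarrow> f j \<le> S"
  unfolding finsum_le_def by (metis finite.emptyI finite.insertI sum.empty sum.insert_remove
      add.right_neutral finite_Diff insert_Diff_if empty_Diff)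

lemma finsum_le_abs_summable:
  fixes f :: "int \<Rightarrow> 'a::banach"
  assumes "finsum_le (\<lambda>j. norm (f j)) S"
  shows "f abs_summable_on UNIV"
  by (rule nonneg_bdd_above_summable_on) (use assms in \<open>auto simp: finsum_le_def bdd_above_def\<close>)

lemma finsum_le_summable:
  fixes f :: "int \<Rightarrow> 'a::banach"
  assumes "finsum_le (\<lambda>j. norm (f j)) S"
  shows "f summable_on UNIV"
  using abs_summable_summable[OF finsum_le_abs_summable[OF assms]] .

lemma finsum_le_norm_infsum:
  fixes f :: "int \<Rightarrow> 'a::banach"
  assumes "finsum_le (\<lambda>j. norm (f j)) S"
  shows "norm (\<Sum>\<^sub>\<infinity>j. f j) \<le> S"
proof -
  have "norm (\<Sum>\<^sub>\<infinity>j. f j) \<le> (\<Sum>\<^sub>\<infinity>j. norm (f j))"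
    by (rule norm_infsum_bound[OF finsum_le_abs_summable[OF assms]])
  also have "\<dots> \<le> S"
    by (rule infsum_le_finite_sums[OF finsum_le_abs_summable[OF assms]]) (use assms in \<open>auto simp: finsum_le_def\<close>)
  finally show ?thesis .
qed

text \<open>The symmetric intervals exhaust the finite sets of integers, so symmetric partial sums compute
  unordered sums.\<close>
lemma has_sum_symmetric_tendsto:
  fixes f :: "int \<Rightarrow> 'a::topological_comm_monoid_add"
  assumes "(f has_sum S) UNIV"
  shows "(\<lambda>n. sum f {- int n..int n}) \<longlonglongrightarrow> S"
proof -
  have "filterlim (\<lambda>n. {- int n..int n}) (finite_subsets_at_top UNIV) sequentially"
    unfolding filterlim_finite_subsets_at_top
  proof (intro allI impI)
    fix X :: "int set" assume X: "finite X \<and> X \<subseteq> UNIV"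
    define N where "N = Max (insert 0 ((\<lambda>j. nat \<bar>j\<bar>) ` X))"
    have N: "nat \<bar>j\<bar> \<le> N" if "j \<in> X" for j
      unfolding N_def using X that by (intro Max_ge) auto
    show "\<forall>\<^sub>F n in sequentially. finite {- int n..int n} \<and> X \<subseteq> {- int n..int n} \<and> {- int n..int n} \<subseteq> UNIV"
      using eventually_ge_at_top[of N]
    proof eventually_elim
      case (elim n)
      have "j \<in> {- int n..int n}" if "j \<in> X" for j using N[OF that] elim by auto
      then show ?case by auto
    qed
  qed
  then show ?thesis
    using assms unfolding has_sum_def by (rule filterlim_compose[rotated])
qed

text \<open>Decay of coefficients is measured by powers of \<open>1 / \<bar>j\<bar>\<close>. The value 0 at \<open>j = 0\<close> makes a
  decay estimate for all integers include the vanishing of the coefficient at 0, and lets excluded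
  indices drop out of convolution sums.\<close>
definition inv_abs :: "int \<Rightarrow> real" where "inv_abs j = inverse \<bar>real_of_int j\<bar>"

lemma inv_abs_0 [simp]: "inv_abs 0 = 0" by (simp add: inv_abs_def)
lemma inv_abs_nonneg [simp]: "0 \<le> inv_abs j" by (simp add: inv_abs_def)
lemma inv_abs_le_1 [simp]: "inv_abs j \<le> 1"
  by (cases "j = 0") (auto simp: inv_abs_def divide_simps)
lemma abs_mult_inv_abs: "j \<noteq> 0 \<Longrightarrow> \<bar>real_of_int j\<bar> * inv_abs j = 1"
  by (simp add: inv_abs_def)

lemma inv_abs_power_le_2: "2 \<le> p \<Longrightarrow> inv_abs j ^ p \<le> inv_abs j ^ 2"
  by (rule power_decreasing) auto

text \<open>Telescoping, since \<open>1 / (n + 1)\<^sup>2 \<le> 1 / n - 1 / (n + 1)\<close>.\<close>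
lemma sum_inverse_squares_nat: "(\<Sum>j=1..n. inv_abs (int j) ^ 2) \<le> 2 - inv_abs (int n)" if "1 \<le> n"
  using that
proof (induction n rule: nat_induct_at_least)
  case base then show ?case by (simp add: inv_abs_def)
next
  case (Suc n)
  have "inv_abs (int (Suc n)) ^ 2 \<le> inv_abs (int n) - inv_abs (int (Suc n))"
  proof -
    have n: "0 < real n" using Suc.hyps by simp
    have "inverse (real n + 1) ^ 2 \<le> inverse (real n * (real n + 1))"
      unfolding power2_eq_square inverse_mult_distrib using n by (intro mult_right_mono le_imp_inverse_le) auto
    also have "\<dots> = inverse (real n) - inverse (real n + 1)" using n by (simp add: field_simps)
    finally show ?thesis by (simp add: inv_abs_def add.commute)
  qed
  then show ?case using Suc by simp
qed

lemma finsum_le_inverse_squares: "finsum_le (\<lambda>j. inv_abs j ^ 2) 4"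
  unfolding finsum_le_def
proof (intro allI impI)
  fix F :: "int set" assume F: "finite F"
  define n where "n = Max (insert 1 ((\<lambda>j. nat \<bar>j\<bar>) ` F))"
  have n1: "1 \<le> n" unfolding n_def using F by (intro Max_ge) auto
  have N: "nat \<bar>j\<bar> \<le> n" if "j \<in> F" for j
    unfolding n_def using F that by (intro Max_ge) auto
  have pos: "(\<Sum>j\<in>int ` {1..n}. inv_abs j ^ 2) = (\<Sum>j=1..n. inv_abs (int j) ^ 2)"
    by (subst sum.reindex) auto
  have neg: "(\<Sum>j\<in>(\<lambda>i. - int i) ` {1..n}. inv_abs j ^ 2) = (\<Sum>j=1..n. inv_abs (int j) ^ 2)"
    by (subst sum.reindex) (auto simp: inj_on_def inv_abs_def)
  have "F \<subseteq> {0} \<union> (int ` {1..n} \<union> (\<lambda>i. - int i) ` {1..n})"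
  proof
    fix j assume j: "j \<in> F"
    show "j \<in> {0} \<union> (int ` {1..n} \<union> (\<lambda>i. - int i) ` {1..n})"
    proof (cases "j = 0")
      case False
      show ?thesis
      proof (cases "j > 0")
        case True
        then have "j = int (nat \<bar>j\<bar>)" "nat \<bar>j\<bar> \<in> {1..n}" using N[OF j] by auto
        then show ?thesis by blast
      next
        case False
        then have "j = - int (nat \<bar>j\<bar>)" "nat \<bar>j\<bar> \<in> {1..n}" using N[OF j] \<open>j \<noteq> 0\<close> by auto
        then show ?thesis by blast
      qed
    qed auto
  qed
  then have "(\<Sum>j\<in>F. inv_abs j ^ 2) \<le> (\<Sum>j\<in>{0} \<union> (int ` {1..n} \<union> (\<lambda>i. - int i) ` {1..n}). inv_abs j ^ 2)"
    by (intro sum_mono2) auto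
  also have "\<dots> = (\<Sum>j\<in>int ` {1..n}. inv_abs j ^ 2) + (\<Sum>j\<in>(\<lambda>i. - int i) ` {1..n}. inv_abs j ^ 2)"
    by (subst sum.union_disjoint, auto)+
  also have "\<dots> \<le> 4" using sum_inverse_squares_nat[OF n1] inv_abs_nonneg[of "int n"] unfolding pos neg by linarith
  finally show "(\<Sum>j\<in>F. inv_abs j ^ 2) \<le> 4" .
qed

text \<open>One of \<open>j\<close>, \<open>k - j\<close> has absolute value at least \<open>\<bar>k\<bar> / 2\<close>; it supplies the decay in \<open>k\<close>, and the other
  factor is left over for summation. This is why convolution preserves decay of order at least 2.\<close>
lemma inv_abs_product_bound:
  assumes "k \<noteq> 0" "2 \<le> p"
  shows "inv_abs j ^ p * inv_abs (k - j) ^ p \<le> 2 ^ p * inv_abs k ^ p * (inv_abs j ^ 2 + inv_abs (k - j) ^ 2)"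
proof -
  have *: "inv_abs x ^ p * inv_abs y ^ p \<le> 2 ^ p * inv_abs k ^ p * (inv_abs x ^ 2 + inv_abs y ^ 2)"
    if "\<bar>x\<bar> \<ge> \<bar>y\<bar>" "x + y = k" for x y
  proof -
    have x: "x \<noteq> 0" using that assms by auto
    have "\<bar>real_of_int k\<bar> \<le> 2 * \<bar>real_of_int x\<bar>" using that by linarith
    then have "inv_abs x \<le> 2 * inv_abs k" using x assms by (simp add: inv_abs_def field_simps)
    then have "inv_abs x ^ p \<le> (2 * inv_abs k) ^ p" by (intro power_mono) auto
    moreover have "inv_abs y ^ p \<le> inv_abs x ^ 2 + inv_abs y ^ 2" using inv_abs_power_le_2[OF assms(2), of y] by (simp add: add_increasing)
    ultimately show ?thesis by (subst power_mult_distrib[symmetric]) (rule mult_mono, auto)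
  qed
  show ?thesis
  proof (cases "\<bar>j\<bar> \<ge> \<bar>k - j\<bar>")
    case True
    have "j + (k - j) = k" by simp
    then show ?thesis using *[OF True] by blast
  next
    case False
    have "(k - j) + j = k" "\<bar>j\<bar> \<le> \<bar>k - j\<bar>" using False by auto
    from *[OF this(2,1)] show ?thesis by (simp add: mult.commute add.commute)
  qed
qed

lemma finsum_le_inv_abs_convolution:
  assumes "k \<noteq> 0" "2 \<le> p"
  shows "finsum_le (\<lambda>j. inv_abs j ^ p * inv_abs (k - j) ^ p) (2 ^ p * 8 * inv_abs k ^ p)"
proof -
  have "finsum_le (\<lambda>j. 2 ^ p * inv_abs k ^ p * (inv_abs j ^ 2 + inv_abs (k - j) ^ 2)) (2 ^ p * inv_abs k ^ p * (4 + 4))"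
    by (intro finsum_le_cmult finsum_le_add finsum_le_inverse_squares finsum_le_reflect[OF finsum_le_inverse_squares]) auto
  then show ?thesis
    by (rule finsum_le_mono) (use inv_abs_product_bound[OF assms] in auto)
qed

lemma finsum_le_l2_product:
  assumes "finsum_le (\<lambda>j. (cmod (a j))\<^sup>2) R" "finsum_le (\<lambda>j. (cmod (b j))\<^sup>2) S"
  shows "finsum_le (\<lambda>j. cmod (a j) * cmod (b (k - j))) ((R + S) / 2)"
proof -
  have "finsum_le (\<lambda>j. (1/2) * ((cmod (a j))\<^sup>2 + (cmod (b (k - j)))\<^sup>2)) ((1/2) * (R + S))"
    using finsum_le_reflect[OF assms(2), of k] by (intro finsum_le_cmult finsum_le_add assms) auto
  then show ?thesis
  proof (rule finsum_le_mono)
    fix j show "cmod (a j) * cmod (b (k - j)) \<le> (1/2) * ((cmod (a j))\<^sup>2 + (cmod (b (k - j)))\<^sup>2)"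
      using sum_squares_bound[of "cmod (a j)" "cmod (b (k - j))"] by simp
  qed simp
qed

section \<open>Dispersion relation and resonance function\<close>

text \<open>The symbol of \<open>- \<partial>\<^sub>x\<^sup>3 + \<partial>\<^sub>x\<^sup>5 - m \<partial>\<^sub>x\<close> is \<open>i\<close> times this function. The transport term with
  speed \<open>m\<close> is the interaction with the mean.\<close>
definition dispersion :: "real \<Rightarrow> int \<Rightarrow> real" where
  "dispersion m k = (2 * pi * k) ^ 5 + (2 * pi * k) ^ 3 - m * (2 * pi * k)"

text \<open>The cofactor of \<open>k j (k - j)\<close> in the resonance function, with \<open>x = j\<close> and \<open>y = k - j\<close>.\<close>
definition resonance_factor :: "real \<Rightarrow> real \<Rightarrow> real" where
  "resonance_factor x y = 5 * (2 * pi) ^ 5 * (x\<^sup>2 + x * y + y\<^sup>2) + 3 * (2 * pi) ^ 3"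

definition resonance :: "int \<Rightarrow> int \<Rightarrow> real" where
  "resonance k j = k * j * (k - j) * resonance_factor j (k - j)"

text \<open>This is \<open>\<pi> k / \<Omega>\<close>, the coefficient produced by integrating the nonlinearity in time, with the factor \<open>k\<close>
  cancelled. It is 0 for \<open>j = 0\<close> and \<open>j = k\<close>.\<close>
definition nf_coeff :: "int \<Rightarrow> int \<Rightarrow> real" where
  "nf_coeff k j = pi / (real_of_int j * real_of_int (k - j) * resonance_factor j (k - j))"

text \<open>The linear term of the symbol cancels, so the mean has no influence on the resonances.\<close>
lemma dispersion_resonance: "dispersion m k - dispersion m j - dispersion m (k - j) = resonance k j"
proof -
  define x y :: real where "x = real_of_int j" and "y = real_of_int (k - j)"
  have k: "real_of_int k = x + y" by (simp add: x_def y_def)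
  have j: "real_of_int j = x" "real_of_int (k - j) = y" by (simp_all only: x_def y_def)
  show ?thesis unfolding dispersion_def resonance_def resonance_factor_def
    unfolding k of_int_mult j of_int_diff[symmetric]
    by (simp only: power_mult_distrib) (simp add: algebra_simps power2_eq_square power3_eq_cube eval_nat_numeral)
qed

text \<open>The quadratic form \<open>x\<^sup>2 + x y + y\<^sup>2\<close> is at least \<open>3/4 (x + y)\<^sup>2\<close>; with \<open>x + y = k\<close> this is the gain of \<open>k\<^sup>2\<close>.\<close>
lemma resonance_factor_ge: "pi * (x + y)\<^sup>2 \<le> resonance_factor x y" and resonance_factor_pos: "0 < resonance_factor x y"
proof -
  have q: "(x + y)\<^sup>2 * (3/4) \<le> x\<^sup>2 + x * y + y\<^sup>2"
    using zero_le_power2[of "x - y"] by (simp add: power2_eq_square algebra_simps)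
  have "1 \<le> (2 * pi) ^ 4" using pi_ge_two by (intro one_le_power) auto
  then have "(2 * pi) * 1 \<le> (2 * pi) * (2 * pi) ^ 4" by (intro mult_left_mono) auto
  then have p: "2 * pi \<le> (2 * pi) ^ 5" by (simp add: eval_nat_numeral)
  have "pi * (x + y)\<^sup>2 \<le> 5 * (2 * pi) * ((x + y)\<^sup>2 * (3/4))" by simp
  also have "\<dots> \<le> 5 * (2 * pi) ^ 5 * (x\<^sup>2 + x * y + y\<^sup>2)"
    using p q by (intro mult_mono) auto
  finally have *: "pi * (x + y)\<^sup>2 \<le> 5 * (2 * pi) ^ 5 * (x\<^sup>2 + x * y + y\<^sup>2)" .
  have "0 < 3 * (2 * pi) ^ 3" by simp
  then show "pi * (x + y)\<^sup>2 \<le> resonance_factor x y" using * unfolding resonance_factor_def by linarith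
  have "0 \<le> pi * (x + y)\<^sup>2" by simp
  then show "0 < resonance_factor x y" using * \<open>0 < 3 * (2 * pi) ^ 3\<close> unfolding resonance_factor_def by linarith
qed

lemma nf_coeff_bound: assumes "k \<noteq> 0" shows "\<bar>nf_coeff k j\<bar> \<le> inv_abs k ^ 2 * (inv_abs j * inv_abs (k - j))"
proof -
  have "real_of_int j + (real_of_int k - real_of_int j) = k" by simp
  then have r: "pi * (real_of_int k)\<^sup>2 \<le> resonance_factor j (k - j)"
    using resonance_factor_ge[of j "k - j"] by simp
  have "pi / resonance_factor j (k - j) \<le> inverse ((real_of_int k)\<^sup>2)"
    using r resonance_factor_pos[of j "k - j"] assms by (simp add: field_simps)
  then have "inv_abs j * inv_abs (k - j) * (pi / resonance_factor j (k - j)) \<le> inv_abs j * inv_abs (k - j) * inverse ((real_of_int k)\<^sup>2)"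
    by (intro mult_left_mono) auto
  then show ?thesis using resonance_factor_pos[of j "k - j"]
    by (simp add: nf_coeff_def inv_abs_def abs_mult field_simps del: of_int_diff)
qed

lemma nf_coeff_resonance: "j \<noteq> 0 \<Longrightarrow> j \<noteq> k \<Longrightarrow> nf_coeff k j * resonance k j = pi * k"
  using resonance_factor_pos[of j "k - j"] by (simp add: nf_coeff_def resonance_def field_simps)

section \<open>The normal form identity\<close>

lemma finsum_le_l2_pointwise:
  assumes "finsum_le (\<lambda>j. (f j)\<^sup>2) R" "finsum_le (\<lambda>j. (g j)\<^sup>2) S"
  shows "finsum_le (\<lambda>j. f j * g j) ((R + S) / 2)"
proof -
  have "finsum_le (\<lambda>j. (1/2) * ((f j)\<^sup>2 + (g j)\<^sup>2)) ((1/2) * (R + S))"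
    by (intro finsum_le_cmult finsum_le_add assms) auto
  then show ?thesis
  proof (rule finsum_le_mono)
    fix j show "f j * g j \<le> (1/2) * ((f j)\<^sup>2 + (g j)\<^sup>2)"
      using sum_squares_bound[of "f j" "g j"] by simp
  qed simp
qed

text \<open>The nonlinearity in the rotated unknown \<open>v k = exp (- i \<omega>(k) s) u k\<close>.\<close>
definition rotated_rhs :: "real \<Rightarrow> (int \<Rightarrow> complex) \<Rightarrow> int \<Rightarrow> complex" where
  "rotated_rhs s a k = - \<i> * (pi * k) * (\<Sum>\<^sub>\<infinity>j. cis (- (resonance k j * s)) * (a j * a (k - j)))"

text \<open>The boundary term of the integration by parts in time.\<close>
definition nf_boundary :: "real \<Rightarrow> (int \<Rightarrow> complex) \<Rightarrow> int \<Rightarrow> complex" where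
  "nf_boundary s a k = (\<Sum>\<^sub>\<infinity>j. nf_coeff k j * cis (- (resonance k j * s)) * (a j * a (k - j)))"

text \<open>The integrand left over by the integration by parts; \<open>b\<close> stands for the time derivative of \<open>a\<close>.\<close>
definition nf_remainder :: "real \<Rightarrow> (int \<Rightarrow> complex) \<Rightarrow> (int \<Rightarrow> complex) \<Rightarrow> int \<Rightarrow> complex" where
  "nf_remainder s a b k = (\<Sum>\<^sub>\<infinity>j. nf_coeff k j * cis (- (resonance k j * s)) * (b j * a (k - j) + a j * b (k - j)))"

abbreviation l2_le :: "(int \<Rightarrow> complex) \<Rightarrow> real \<Rightarrow> bool" where
  "l2_le a R \<equiv> finsum_le (\<lambda>j. (cmod (a j))\<^sup>2) R"

lemma finsum_le_rotated_rhs: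
  assumes "l2_le a R"
  shows "finsum_le (\<lambda>j. cmod (cis (- (resonance k j * s)) * (a j * a (k - j)))) R"
  using finsum_le_l2_product[OF assms assms, of k] by (simp add: norm_mult)

lemma rotated_rhs_bound:
  assumes "l2_le a R"
  shows "cmod (rotated_rhs s a k) \<le> pi * \<bar>real_of_int k\<bar> * R"
proof -
  have "cmod (rotated_rhs s a k) = pi * \<bar>real_of_int k\<bar> * cmod (\<Sum>\<^sub>\<infinity>j. cis (- (resonance k j * s)) * (a j * a (k - j)))"
    unfolding rotated_rhs_def norm_mult[of _ "infsum _ _"] by (simp add: norm_mult)
  then show ?thesis
    using finsum_le_norm_infsum[OF finsum_le_rotated_rhs[OF assms, of k s]] by (simp add: mult_left_mono)
qed

lemma nf_coeff_cis_bound: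
  assumes "k \<noteq> 0" "cmod x \<le> c"
  shows "cmod (nf_coeff k j * cis \<theta> * x) \<le> inv_abs k ^ 2 * (inv_abs j * inv_abs (k - j)) * c"
  using assms(2) nf_coeff_bound[OF assms(1), of j] by (simp add: norm_mult mult_mono)

lemma inv_abs_cancel: "j \<noteq> 0 \<Longrightarrow> inv_abs j * (c * \<bar>real_of_int j\<bar>) = c"
  by (simp add: inv_abs_def)

lemma has_vector_derivative_cis_linear:
  "((\<lambda>s. cis (c * s)) has_vector_derivative (\<i> * c) * cis (c * s)) (at s within S)"
proof -
  have "((\<lambda>z. exp (\<i> * of_real c * z)) has_field_derivative (\<i> * c) * exp (\<i> * of_real c * of_real s)) (at (of_real s))"
    by (auto intro!: derivative_eq_intros)
  from has_vector_derivative_real_field[OF this, of S] show ?thesis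
    by (simp add: cis_conv_exp mult.assoc)
qed

text \<open>The derivative loses one power of \<open>\<bar>j\<bar>\<close>, which cancels against the factor \<open>1 / \<bar>j\<bar>\<close> of the coefficient; the
  remaining factor \<open>1 / \<bar>k - j\<bar>\<close> pairs with the undifferentiated coefficient by \<open>2 x y \<le> x\<^sup>2 + y\<^sup>2\<close>. So two powers of \<open>k\<close>
  are gained from a bound in \<open>\<ell>\<^sup>2\<close> alone.\<close>
lemma finsum_le_nf_remainder_rough:
  assumes l2: "l2_le a R" and k: "k \<noteq> 0"
    and D: "\<And>j. cmod (b j) \<le> pi * \<bar>real_of_int j\<bar> * R"
  shows "finsum_le (\<lambda>j. cmod (nf_coeff k j * cis (- (resonance k j * s)) * (b j * a (k - j) + a j * b (k - j))))
    (inv_abs k ^ 2 * (pi * R * (R + 4)))"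
proof -
  have R: "0 \<le> R" by (rule finsum_le_nonneg[OF l2])
  have s: "finsum_le (\<lambda>j. inv_abs j * cmod (a j)) ((4 + R) / 2)"
    by (rule finsum_le_l2_pointwise[OF finsum_le_inverse_squares l2])
  have "finsum_le (\<lambda>j. (inv_abs k ^ 2 * (pi * R)) * (inv_abs j * cmod (a j) + inv_abs (k - j) * cmod (a (k - j))))
     ((inv_abs k ^ 2 * (pi * R)) * ((4 + R) / 2 + (4 + R) / 2))"
    by (intro finsum_le_cmult finsum_le_add s finsum_le_reflect[OF s]) (use R in auto)
  then show ?thesis
  proof (rule finsum_le_mono)
    fix j
    define l where "l = k - j"
    show "cmod (nf_coeff k j * cis (- (resonance k j * s)) * (b j * a (k - j) + a j * b (k - j)))
      \<le> (inv_abs k ^ 2 * (pi * R)) * (inv_abs j * cmod (a j) + inv_abs (k - j) * cmod (a (k - j)))"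
    proof (cases "j = 0 \<or> j = k")
      case True then show ?thesis using R by (auto simp: nf_coeff_def)
    next
      case False
      then have jl: "j \<noteq> 0" "l \<noteq> 0" by (auto simp: l_def)
      have "cmod (b j * a l + a j * b l) \<le> (pi * R) * \<bar>real_of_int j\<bar> * cmod (a l) + cmod (a j) * ((pi * R) * \<bar>real_of_int l\<bar>)"
      proof (intro order_trans[OF norm_triangle_ineq] add_mono)
        have D': "cmod (b i) \<le> (pi * R) * \<bar>real_of_int i\<bar>" for i
          using D[of i] by (simp add: mult_ac)
        show "cmod (b j * a l) \<le> (pi * R) * \<bar>real_of_int j\<bar> * cmod (a l)"
          using D'[of j] by (simp only: norm_mult) (rule mult_right_mono, auto)
        show "cmod (a j * b l) \<le> cmod (a j) * ((pi * R) * \<bar>real_of_int l\<bar>)"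
          using D'[of l] by (simp only: norm_mult) (rule mult_left_mono, auto)
      qed
      from nf_coeff_cis_bound[OF k this, of j]
      have "cmod (nf_coeff k j * cis (- (resonance k j * s)) * (b j * a l + a j * b l))
        \<le> inv_abs k ^ 2 * (inv_abs j * inv_abs l) * ((pi * R) * \<bar>real_of_int j\<bar> * cmod (a l) + cmod (a j) * ((pi * R) * \<bar>real_of_int l\<bar>))"
        by (simp add: l_def)
      also have "\<dots> = inv_abs k ^ 2 * ((inv_abs j * ((pi * R) * \<bar>real_of_int j\<bar>)) * (inv_abs l * cmod (a l))
           + (inv_abs l * ((pi * R) * \<bar>real_of_int l\<bar>)) * (inv_abs j * cmod (a j)))"
        by (simp only: algebra_simps)
      also have "\<dots> = (inv_abs k ^ 2 * (pi * R)) * (inv_abs j * cmod (a j) + inv_abs l * cmod (a l))"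
        unfolding inv_abs_cancel[OF jl(1)] inv_abs_cancel[OF jl(2)] by (simp only: algebra_simps)
      finally show ?thesis by (simp add: l_def)
    qed
  qed (simp add: algebra_simps)
qed

lemma finsum_le_nf_boundary_rough:
  assumes l2: "l2_le a R" and k: "k \<noteq> 0"
  shows "finsum_le (\<lambda>j. cmod (nf_coeff k j * cis (- (resonance k j * s)) * (a j * a (k - j)))) (inv_abs k ^ 2 * R)"
proof -
  have "finsum_le (\<lambda>j. inv_abs k ^ 2 * (cmod (a j) * cmod (a (k - j)))) (inv_abs k ^ 2 * ((R + R) / 2))"
    by (intro finsum_le_cmult finsum_le_l2_product l2) auto
  then show ?thesis
  proof (rule finsum_le_mono)
    fix j
    have "inv_abs j * inv_abs (k - j) \<le> 1 * 1" by (intro mult_mono) auto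
    then have "inv_abs k ^ 2 * (inv_abs j * inv_abs (k - j)) * (cmod (a j) * cmod (a (k - j))) \<le> inv_abs k ^ 2 * 1 * (cmod (a j) * cmod (a (k - j)))"
      by (intro mult_mono) auto
    then show "cmod (nf_coeff k j * cis (- (resonance k j * s)) * (a j * a (k - j))) \<le> inv_abs k ^ 2 * (cmod (a j) * cmod (a (k - j)))"
      using nf_coeff_cis_bound[OF k, of "a j * a (k - j)" "cmod (a j) * cmod (a (k - j))" j] by (simp add: norm_mult)
  qed simp
qed

text \<open>The product rule is applied to finitely many terms of the boundary sum, where it is elementary. The limit is taken in the
  integrated identity by dominated convergence: only pointwise convergence and a uniform bound are
  needed, and both follow from the \<open>\<ell>\<^sup>2\<close> bound. Differentiating the infinite sum would require
  uniform convergence in time, which a bound in \<open>\<ell>\<^sup>2\<close> does not give.\<close>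
lemma normal_form:
  fixes v v' :: "real \<Rightarrow> int \<Rightarrow> complex"
  assumes der: "\<And>k s. s \<in> {a..b} \<Longrightarrow> ((\<lambda>s. v s k) has_vector_derivative v' s k) (at s within {a..b})"
    and l2: "\<And>s. s \<in> {a..b} \<Longrightarrow> l2_le (v s) R"
    and z: "\<And>s. s \<in> {a..b} \<Longrightarrow> v s 0 = 0"
    and D: "\<And>j s. s \<in> {a..b} \<Longrightarrow> cmod (v' s j) \<le> pi * \<bar>real_of_int j\<bar> * R"
    and eq: "\<And>s. s \<in> {a..b} \<Longrightarrow> v' s k = rotated_rhs s (v s) k"
    and k: "k \<noteq> 0" and ab: "a \<le> b"
  shows "((\<lambda>s. - nf_remainder s (v s) (v' s) k) has_integral
     ((v b k - nf_boundary b (v b) k) - (v a k - nf_boundary a (v a) k))) {a..b}"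
proof -
  have R: "0 \<le> R" using finsum_le_nonneg[OF l2[of a]] ab by auto
  define J where "J n = {- int n..int n}" for n
  define q where "q j s = nf_coeff k j * cis (- (resonance k j * s)) * (v s j * v s (k - j))" for j s
  define p where "p j s = cis (- (resonance k j * s)) * (v s j * v s (k - j))" for j s
  define T where "T j s = nf_coeff k j * cis (- (resonance k j * s)) * (v' s j * v s (k - j) + v s j * v' s (k - j))" for j s
  \<comment> \<open>The oscillating factor turns back into \<open>\<pi> k\<close>; for \<open>j = 0\<close> and \<open>j = k\<close> both sides vanish because \<open>v s 0 = 0\<close>.\<close>
  have q': "((\<lambda>s. q j s) has_vector_derivative (- \<i> * (pi * k)) * p j s + T j s) (at s within {a..b})"
    if s: "s \<in> {a..b}" for j s
  proof -
    have c: "((\<lambda>s. cis (- (resonance k j * s))) has_vector_derivative (- \<i> * resonance k j) * cis (- (resonance k j * s))) (at s within {a..b})"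
      using has_vector_derivative_cis_linear[of "- resonance k j" s] by simp
    have "((\<lambda>s. q j s) has_vector_derivative
       of_real (nf_coeff k j) * (cis (- (resonance k j * s)) * (v s j * v' s (k - j) + v' s j * v s (k - j))
         + ((- \<i> * resonance k j) * cis (- (resonance k j * s))) * (v s j * v s (k - j)))) (at s within {a..b})"
      unfolding q_def mult.assoc[of "of_real (nf_coeff k j)"]
      by (intro has_vector_derivative_mult c der s bounded_linear.has_vector_derivative[OF bounded_linear_mult_right])
    moreover have "of_real (nf_coeff k j) * ((- \<i> * resonance k j) * cis (- (resonance k j * s)) * (v s j * v s (k - j)))
       = (- \<i> * (pi * k)) * p j s"
    proof (cases "j = 0 \<or> j = k")
      case True then show ?thesis using z[OF s] by (auto simp: p_def)
    next
      case False
      then have "nf_coeff k j * resonance k j = pi * k" using nf_coeff_resonance[of j k] by auto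
      then have "complex_of_real (nf_coeff k j) * complex_of_real (resonance k j) = of_real (pi * k)" by (metis of_real_mult)
      then show ?thesis by (simp add: p_def algebra_simps)
    qed
    ultimately show ?thesis by (simp add: T_def algebra_simps)
  qed
  have p_sum: "((\<lambda>j. p j s) has_sum (\<Sum>\<^sub>\<infinity>j. p j s)) UNIV" and p_bd: "finsum_le (\<lambda>j. cmod (p j s)) R" if "s \<in> {a..b}" for s
    using finsum_le_rotated_rhs[OF l2[OF that], of k s] finsum_le_summable[OF finsum_le_rotated_rhs[OF l2[OF that], of k s]] by (auto simp: p_def)
  have T_bd: "finsum_le (\<lambda>j. cmod (T j s)) (inv_abs k ^ 2 * (pi * R * (R + 4)))" if "s \<in> {a..b}" for s
    unfolding T_def by (rule finsum_le_nf_remainder_rough[OF l2[OF that] k D[OF that]])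
  have T_sum: "((\<lambda>j. T j s) has_sum nf_remainder s (v s) (v' s) k) UNIV" if "s \<in> {a..b}" for s
    using finsum_le_summable[OF T_bd[OF that]] by (simp add: T_def nf_remainder_def)
  have q_sum: "((\<lambda>j. q j s) has_sum nf_boundary s (v s) k) UNIV" if "s \<in> {a..b}" for s
    using finsum_le_summable[OF finsum_le_nf_boundary_rough[OF l2[OF that] k, of s]] by (simp add: q_def nf_boundary_def)
  have finsum: "cmod (\<Sum>j\<in>F. f j) \<le> S" if "finsum_le (\<lambda>j. cmod (f j)) S" "finite F" for f :: "int \<Rightarrow> complex" and S F
    using order_trans[OF norm_sum finsum_leD[OF that]] .
  define h where "h n s = v' s k - (\<Sum>j\<in>J n. (- \<i> * (pi * k)) * p j s + T j s)" for n s
  define M where "M = pi * \<bar>real_of_int k\<bar> * R + (pi * \<bar>real_of_int k\<bar> * R + inv_abs k ^ 2 * (pi * R * (R + 4)))"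
  show ?thesis
  proof (rule has_integral_dominated_convergence[where f = h and h = "\<lambda>_. M"])
    fix n
    show "(h n has_integral ((v b k - (\<Sum>j\<in>J n. q j b)) - (v a k - (\<Sum>j\<in>J n. q j a)))) {a..b}"
      unfolding h_def
      by (intro fundamental_theorem_of_calculus[OF ab] has_vector_derivative_diff der has_vector_derivative_sum q')
    show "\<forall>s\<in>{a..b}. cmod (h n s) \<le> M"
    proof
      fix s assume s: "s \<in> {a..b}"
      have "cmod (h n s) \<le> cmod (v' s k) + cmod ((- \<i> * (pi * k)) * (\<Sum>j\<in>J n. p j s) + (\<Sum>j\<in>J n. T j s))"
        unfolding h_def sum.distrib sum_distrib_left[symmetric] by (rule norm_triangle_ineq4)
      also have "\<dots> \<le> cmod (v' s k) + (cmod ((- \<i> * (pi * k)) * (\<Sum>j\<in>J n. p j s)) + cmod (\<Sum>j\<in>J n. T j s))"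
        by (intro add_left_mono norm_triangle_ineq)
      also have "\<dots> \<le> M" unfolding M_def
        using finsum[OF p_bd[OF s], of "J n"] finsum[OF T_bd[OF s], of "J n"]
        by (intro add_mono D s) (auto simp: J_def norm_mult abs_mult mult_left_mono)
      finally show "cmod (h n s) \<le> M" .
    qed
  next
    show "\<forall>s\<in>{a..b}. (\<lambda>n. h n s) \<longlonglongrightarrow> - nf_remainder s (v s) (v' s) k"
    proof
      fix s assume s: "s \<in> {a..b}"
      have "(\<lambda>n. h n s) \<longlonglongrightarrow> v' s k - ((- \<i> * (pi * k)) * (\<Sum>\<^sub>\<infinity>j. p j s) + nf_remainder s (v s) (v' s) k)"
        unfolding h_def sum.distrib sum_distrib_left[symmetric] J_def
        by (intro tendsto_intros has_sum_symmetric_tendsto p_sum T_sum s)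
      then show "(\<lambda>n. h n s) \<longlonglongrightarrow> - nf_remainder s (v s) (v' s) k"
        by (simp add: eq[OF s] rotated_rhs_def p_def)
    qed
    show "(\<lambda>n. (v b k - (\<Sum>j\<in>J n. q j b)) - (v a k - (\<Sum>j\<in>J n. q j a))) \<longlonglongrightarrow> (v b k - nf_boundary b (v b) k) - (v a k - nf_boundary a (v a) k)"
      unfolding J_def using ab by (intro tendsto_intros has_sum_symmetric_tendsto q_sum) auto
  qed auto
qed

section \<open>Rotated systems\<close>

definition rotated_field :: "int set \<Rightarrow> real \<Rightarrow> (int \<Rightarrow> complex) \<Rightarrow> int \<Rightarrow> complex" where
  "rotated_field K s a k = (if k \<in> K then rotated_rhs s a k else 0)"

text \<open>The index set \<open>K\<close> is finite for the Galerkin approximations and the set of all nonzero integers for the full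
  equation. Coefficients outside \<open>K\<close> vanish, so that sums can run over all integers in both cases.\<close>
definition rotated_system :: "int set \<Rightarrow> (real \<Rightarrow> int \<Rightarrow> complex) \<Rightarrow> real set \<Rightarrow> bool" where
  "rotated_system K v I \<longleftrightarrow> 0 \<notin> K \<and> (\<forall>s\<in>I. (\<forall>k. k \<notin> K \<longrightarrow> v s k = 0) \<and>
     (\<forall>k. ((\<lambda>s. v s k) has_vector_derivative rotated_field K s (v s) k) (at s within I)))"

lemma rotated_system_subset: "rotated_system K v I \<Longrightarrow> J \<subseteq> I \<Longrightarrow> rotated_system K v J"
  unfolding rotated_system_def by (meson has_vector_derivative_within_subset subsetD)

lemma rotated_systemD:
  assumes "rotated_system K v I" "s \<in> I"
  shows "((\<lambda>s. v s k) has_vector_derivative rotated_field K s (v s) k) (at s within I)" "v s 0 = 0" "k \<notin> K \<Longrightarrow> v s k = 0"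
  using assms unfolding rotated_system_def by auto

lemma rotated_field_bound:
  assumes "l2_le a R"
  shows "cmod (rotated_field K s a k) \<le> pi * \<bar>real_of_int k\<bar> * R"
  using rotated_rhs_bound[OF assms, of s k] finsum_le_nonneg[OF assms] by (simp add: rotated_field_def)

lemma vector_mean_value_bound:
  fixes f :: "real \<Rightarrow> 'a::real_normed_vector"
  assumes "convex S" "\<And>x. x \<in> S \<Longrightarrow> (f has_vector_derivative f' x) (at x within S)"
    "\<And>x. x \<in> S \<Longrightarrow> norm (f' x) \<le> B" "x \<in> S" "y \<in> S"
  shows "norm (f x - f y) \<le> B * \<bar>x - y\<bar>"
proof -
  have "norm (f x - f y) \<le> B * norm (x - y)"
  proof (rule differentiable_bound[where f' = "\<lambda>x h. h *\<^sub>R f' x" and S = S])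
    fix x assume x: "x \<in> S"
    show "(f has_derivative (\<lambda>h. h *\<^sub>R f' x)) (at x within S)"
      using assms(2)[OF x] by (simp add: has_vector_derivative_def)
    show "onorm (\<lambda>h. h *\<^sub>R f' x) \<le> B"
    proof (rule onorm_le)
      fix h :: real
      show "norm (h *\<^sub>R f' x) \<le> B * norm h"
        using mult_left_mono[OF assms(3)[OF x], of "\<bar>h\<bar>"] by (simp add: mult.commute)
    qed
  qed (use assms in auto)
  then show ?thesis by simp
qed

text \<open>Stating the increment bound for a difference serves both purposes: uniqueness uses two solutions, and the a
  priori estimate takes the zero solution as the second one.\<close>
lemma normal_form_difference:
  assumes v: "rotated_system K v {a..b}" and w: "rotated_system K w {a..b}"
    and l2: "\<And>s. s \<in> {a..b} \<Longrightarrow> l2_le (v s) R" "\<And>s. s \<in> {a..b} \<Longrightarrow> l2_le (w s) R"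
    and B: "\<And>s. s \<in> {a..b} \<Longrightarrow> cmod (nf_boundary s (v s) k - nf_boundary s (w s) k) \<le> \<beta>"
    and T: "\<And>s. s \<in> {a..b} \<Longrightarrow> cmod (nf_remainder s (v s) (rotated_field K s (v s)) k - nf_remainder s (w s) (rotated_field K s (w s)) k) \<le> \<tau>"
    and k: "k \<in> K" and st: "s \<in> {a..b}" "t \<in> {a..b}"
  shows "cmod ((v t k - w t k) - (v s k - w s k)) \<le> 2 * \<beta> + \<tau> * \<bar>t - s\<bar>"
proof -
  have k0: "k \<noteq> 0" using k v by (auto simp: rotated_system_def)
  have *: "cmod ((v t k - w t k) - (v s k - w s k)) \<le> 2 * \<beta> + \<tau> * (t - s)"
    if s: "s \<in> {a..b}" and t: "t \<in> {a..b}" and le: "s \<le> t" for s t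
  proof -
    have sub: "{s..t} \<subseteq> {a..b}" using s t by auto
    note v' = rotated_system_subset[OF v sub] and w' = rotated_system_subset[OF w sub]
    have nf: "((\<lambda>s. - nf_remainder s (z s) (rotated_field K s (z s)) k) has_integral
        ((z t k - nf_boundary t (z t) k) - (z s k - nf_boundary s (z s) k))) {s..t}"
      if z: "rotated_system K z {s..t}" and l: "\<And>s. s \<in> {a..b} \<Longrightarrow> l2_le (z s) R" for z
    proof (rule normal_form[where R = R, OF _ _ _ _ _ k0 le])
      fix r assume "r \<in> {s..t}"
      then show "l2_le (z r) R" "\<And>j. cmod (rotated_field K r (z r) j) \<le> pi * \<bar>real_of_int j\<bar> * R"
        "\<And>k. ((\<lambda>s. z s k) has_vector_derivative rotated_field K r (z r) k) (at r within {s..t})" "z r 0 = 0"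
        "rotated_field K r (z r) k = rotated_rhs r (z r) k"
        using l sub rotated_field_bound rotated_systemD[OF z] k by (blast, blast, blast, blast, simp add: rotated_field_def)
    qed
    have "((\<lambda>s. (- nf_remainder s (v s) (rotated_field K s (v s)) k) - (- nf_remainder s (w s) (rotated_field K s (w s)) k)) has_integral
      ((v t k - nf_boundary t (v t) k) - (v s k - nf_boundary s (v s) k) - ((w t k - nf_boundary t (w t) k) - (w s k - nf_boundary s (w s) k)))) (cbox s t)"
      using has_integral_diff[OF nf[OF v' l2(1)] nf[OF w' l2(2)]] by simp
    moreover have "0 \<le> \<tau>" using order_trans[OF norm_ge_zero T[OF s]] .
    ultimately have "cmod ((v t k - nf_boundary t (v t) k) - (v s k - nf_boundary s (v s) k) - ((w t k - nf_boundary t (w t) k) - (w s k - nf_boundary s (w s) k)))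
      \<le> \<tau> * measure lborel (cbox s t)"
      by (intro has_integral_bound) (use T sub in \<open>auto simp: norm_minus_commute\<close>)
    then have i: "cmod ((v t k - nf_boundary t (v t) k) - (v s k - nf_boundary s (v s) k) - ((w t k - nf_boundary t (w t) k) - (w s k - nf_boundary s (w s) k)))
      \<le> \<tau> * (t - s)" using le by simp
    have "(v t k - w t k) - (v s k - w s k) = ((v t k - nf_boundary t (v t) k) - (v s k - nf_boundary s (v s) k) - ((w t k - nf_boundary t (w t) k) - (w s k - nf_boundary s (w s) k)))
       + ((nf_boundary t (v t) k - nf_boundary t (w t) k) - (nf_boundary s (v s) k - nf_boundary s (w s) k))" by simp
    also have "cmod \<dots> \<le> \<tau> * (t - s) + (\<beta> + \<beta>)"
      by (intro order_trans[OF norm_triangle_ineq] add_mono i order_trans[OF norm_triangle_ineq4] B s t)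
    finally show ?thesis by simp
  qed
  show ?thesis
  proof (cases "s \<le> t")
    case True then show ?thesis using *[OF st True] by simp
  next
    case False
    then show ?thesis using *[OF st(2,1)] by (simp add: norm_minus_commute)
  qed
qed

section \<open>Multilinear estimates\<close>

text \<open>A factor that grows like its own frequency (a time derivative) is compensated by the coefficient.\<close>
lemma nf_coeff_weight:
  assumes k: "k \<noteq> 0" and x: "cmod x \<le> pi * \<bar>real_of_int j\<bar> * X \<or> cmod x \<le> pi * \<bar>real_of_int (k - j)\<bar> * X"
    and y: "cmod y \<le> Y" and X: "0 \<le> X"
  shows "cmod (nf_coeff k j * cis \<theta> * (x * y)) \<le> inv_abs k ^ 2 * (pi * (X * Y))"
proof -
  have Y: "0 \<le> Y" using y order_trans[OF norm_ge_zero] by blast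
  have iv1: "inv_abs j * \<bar>real_of_int j\<bar> \<le> 1" for j by (cases "j = 0") (auto simp: inv_abs_def)
  have "inv_abs j * inv_abs (k - j) * cmod x \<le> pi * X"
    using x
  proof
    assume "cmod x \<le> pi * \<bar>real_of_int j\<bar> * X"
    then have "inv_abs j * inv_abs (k - j) * cmod x \<le> inv_abs j * inv_abs (k - j) * (pi * \<bar>real_of_int j\<bar> * X)"
      by (intro mult_left_mono) auto
    also have "\<dots> = (inv_abs j * \<bar>real_of_int j\<bar>) * inv_abs (k - j) * (pi * X)" by (simp add: mult_ac)
    also have "\<dots> \<le> 1 * 1 * (pi * X)" by (intro mult_mono iv1 mult_nonneg_nonneg) (auto simp: X)
    finally show ?thesis by simp
  next
    assume "cmod x \<le> pi * \<bar>real_of_int (k - j)\<bar> * X"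
    then have "inv_abs j * inv_abs (k - j) * cmod x \<le> inv_abs j * inv_abs (k - j) * (pi * \<bar>real_of_int (k - j)\<bar> * X)"
      by (intro mult_left_mono) auto
    also have "\<dots> = (inv_abs (k - j) * \<bar>real_of_int (k - j)\<bar>) * inv_abs j * (pi * X)" by (simp only: mult_ac)
    also have "\<dots> \<le> 1 * 1 * (pi * X)" by (intro mult_mono iv1 mult_nonneg_nonneg) (auto simp: X)
    finally show ?thesis by simp
  qed
  then have *: "inv_abs k ^ 2 * (inv_abs j * inv_abs (k - j) * cmod x * cmod y) \<le> inv_abs k ^ 2 * (pi * X * Y)"
    using mult_mono[OF _ y, of "inv_abs j * inv_abs (k - j) * cmod x" "pi * X"] X by (intro mult_left_mono) auto
  have "cmod (nf_coeff k j * cis \<theta> * (x * y)) \<le> inv_abs k ^ 2 * (inv_abs j * inv_abs (k - j)) * (cmod x * cmod y)"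
    by (intro nf_coeff_cis_bound k) (simp add: norm_mult)
  with * show ?thesis by (simp add: mult_ac)
qed

lemma nf_coeff_weight_plain:
  assumes k: "k \<noteq> 0" and "cmod x \<le> X"
  shows "cmod (nf_coeff k j * cis \<theta> * x) \<le> inv_abs k ^ 2 * X"
proof -
  have "inv_abs j * inv_abs (k - j) \<le> 1 * 1" by (intro mult_mono) auto
  then have "inv_abs k ^ 2 * (inv_abs j * inv_abs (k - j)) * X \<le> inv_abs k ^ 2 * 1 * X"
    using order_trans[OF norm_ge_zero assms(2)] by (intro mult_mono) auto
  then show ?thesis using nf_coeff_cis_bound[OF assms, of j \<theta>] by simp
qed

lemma finsum_le_convolution_decay:
  assumes "2 \<le> p" "k \<noteq> 0" "\<And>j. cmod (a j) \<le> A * inv_abs j ^ p"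
  shows "finsum_le (\<lambda>j. cmod (a j * a (k - j))) (A\<^sup>2 * (2 ^ p * 8 * inv_abs k ^ p))"
proof -
  have A: "0 \<le> A" using assms(3)[of 1] order_trans[OF norm_ge_zero] by (auto simp: inv_abs_def)
  have "finsum_le (\<lambda>j. A\<^sup>2 * (inv_abs j ^ p * inv_abs (k - j) ^ p)) (A\<^sup>2 * (2 ^ p * 8 * inv_abs k ^ p))"
    by (intro finsum_le_cmult finsum_le_inv_abs_convolution assms) auto
  then show ?thesis
  proof (rule finsum_le_mono)
    fix j
    have "cmod (a j * a (k - j)) \<le> (A * inv_abs j ^ p) * (A * inv_abs (k - j) ^ p)"
      unfolding norm_mult by (intro mult_mono assms) (auto simp: A)
    then show "cmod (a j * a (k - j)) \<le> A\<^sup>2 * (inv_abs j ^ p * inv_abs (k - j) ^ p)"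
      by (simp add: power2_eq_square mult_ac)
  qed simp
qed

text \<open>The constant \<open>2^p * 8\<close> of the convolution estimate recurs below, as 32 for \<open>p = 2\<close> and as 256 for \<open>p = 5\<close>.\<close>
lemma rotated_field_decay:
  assumes "2 \<le> p" "\<And>j. cmod (a j) \<le> A * inv_abs j ^ p"
  shows "cmod (rotated_field K s a k) \<le> pi * \<bar>real_of_int k\<bar> * (A\<^sup>2 * (2 ^ p * 8) * inv_abs k ^ p)"
proof (cases "k = 0")
  case True then show ?thesis by (simp add: rotated_field_def rotated_rhs_def)
next
  case False
  have "cmod (\<Sum>\<^sub>\<infinity>j. cis (- (resonance k j * s)) * (a j * a (k - j))) \<le> A\<^sup>2 * (2 ^ p * 8 * inv_abs k ^ p)"
    by (rule finsum_le_norm_infsum) (use finsum_le_convolution_decay[OF assms(1) False assms(2)] in \<open>simp add: norm_mult\<close>)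
  then have "cmod (rotated_rhs s a k) \<le> pi * \<bar>real_of_int k\<bar> * (A\<^sup>2 * (2 ^ p * 8) * inv_abs k ^ p)"
    unfolding rotated_rhs_def norm_mult[of _ "infsum _ _"]
    by (simp add: norm_mult mult.assoc mult_left_mono)
  then show ?thesis by (simp add: rotated_field_def)
qed

lemma nf_boundary_decay:
  assumes "2 \<le> p" "\<And>j. cmod (a j) \<le> A * inv_abs j ^ p" "k \<noteq> 0"
  shows "cmod (nf_boundary s a k) \<le> A\<^sup>2 * (2 ^ p * 8) * inv_abs k ^ (p + 2)"
proof -
  have "finsum_le (\<lambda>j. inv_abs k ^ 2 * cmod (a j * a (k - j))) (inv_abs k ^ 2 * (A\<^sup>2 * (2 ^ p * 8 * inv_abs k ^ p)))"
    by (intro finsum_le_cmult finsum_le_convolution_decay assms) auto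
  then have "finsum_le (\<lambda>j. cmod (nf_coeff k j * cis (- (resonance k j * s)) * (a j * a (k - j)))) (inv_abs k ^ 2 * (A\<^sup>2 * (2 ^ p * 8 * inv_abs k ^ p)))"
    by (rule finsum_le_mono) (use nf_coeff_weight_plain[OF assms(3)] in auto)
  from finsum_le_norm_infsum[OF this] show ?thesis unfolding nf_boundary_def by (simp add: power_add power2_eq_square mult_ac)
qed

lemma nf_remainder_decay:
  assumes p: "2 \<le> p" and a: "\<And>j. cmod (a j) \<le> A * inv_abs j ^ p" and k: "k \<noteq> 0" and C: "0 \<le> C"
    and b: "\<And>j. cmod (b j) \<le> pi * \<bar>real_of_int j\<bar> * (C * inv_abs j ^ p)"
  shows "cmod (nf_remainder s a b k) \<le> 2 * pi * C * A * (2 ^ p * 8) * inv_abs k ^ (p + 2)"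
proof -
  have A: "0 \<le> A" using a[of 1] order_trans[OF norm_ge_zero] by (auto simp: inv_abs_def)
  have "finsum_le (\<lambda>j. (inv_abs k ^ 2 * (2 * pi * C * A)) * (inv_abs j ^ p * inv_abs (k - j) ^ p)) ((inv_abs k ^ 2 * (2 * pi * C * A)) * (2 ^ p * 8 * inv_abs k ^ p))"
    by (intro finsum_le_cmult finsum_le_inv_abs_convolution p k) (auto simp: A C)
  then have "finsum_le (\<lambda>j. cmod (nf_coeff k j * cis (- (resonance k j * s)) * (b j * a (k - j) + a j * b (k - j)))) ((inv_abs k ^ 2 * (2 * pi * C * A)) * (2 ^ p * 8 * inv_abs k ^ p))"
  proof (rule finsum_le_mono)
    fix j
    have "cmod (nf_coeff k j * cis (- (resonance k j * s)) * (b j * a (k - j) + b (k - j) * a j))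
      \<le> inv_abs k ^ 2 * (pi * ((C * inv_abs j ^ p) * (A * inv_abs (k - j) ^ p))) + inv_abs k ^ 2 * (pi * ((C * inv_abs (k - j) ^ p) * (A * inv_abs j ^ p)))"
      unfolding distrib_left using b[of j] b[of "k - j"]
      by (intro order_trans[OF norm_triangle_ineq] add_mono nf_coeff_weight k a) (auto simp: C)
    then show "cmod (nf_coeff k j * cis (- (resonance k j * s)) * (b j * a (k - j) + a j * b (k - j)))
      \<le> (inv_abs k ^ 2 * (2 * pi * C * A)) * (inv_abs j ^ p * inv_abs (k - j) ^ p)" by (simp add: algebra_simps)
  qed simp
  from finsum_le_norm_infsum[OF this] show ?thesis unfolding nf_remainder_def by (simp add: power_add power2_eq_square mult_ac)
qed

text \<open>The splitting \<open>a b - c d = (a - c) b + c (b - d)\<close> that underlies all difference estimates.\<close>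
lemma product_difference_bound:
  assumes "cmod (a - c) \<le> S" "cmod (b - d) \<le> T" "cmod b \<le> B" "cmod c \<le> C"
  shows "cmod (a * b - c * d) \<le> S * B + C * T"
proof -
  have "a * b - c * d = (a - c) * b + c * (b - d)" by (simp add: algebra_simps)
  also have "cmod \<dots> \<le> S * B + C * T"
    using assms order_trans[OF norm_ge_zero assms(1)] order_trans[OF norm_ge_zero assms(4)]
    by (intro order_trans[OF norm_triangle_ineq] add_mono) (auto simp: norm_mult intro!: mult_mono)
  finally show ?thesis .
qed

lemma finsum_le_inverse_squares_sym: "finsum_le (\<lambda>j. inv_abs j ^ 2 + inv_abs (k - j) ^ 2) 8"
  using finsum_le_add[OF finsum_le_inverse_squares finsum_le_reflect[OF finsum_le_inverse_squares, of k]] by simp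

lemma finsum_le_product_difference:
  assumes a: "\<And>j. cmod (a j) \<le> A * inv_abs j ^ 2" and c: "\<And>j. cmod (c j) \<le> A * inv_abs j ^ 2"
    and S: "\<And>j. cmod (a j - c j) \<le> S"
  shows "finsum_le (\<lambda>j. cmod (a j * a (k - j) - c j * c (k - j))) (8 * A * S)"
proof -
  have A: "0 \<le> A" using a[of 1] order_trans[OF norm_ge_zero] by (auto simp: inv_abs_def)
  have S0: "0 \<le> S" using order_trans[OF norm_ge_zero S] .
  have "finsum_le (\<lambda>j. A * S * (inv_abs j ^ 2 + inv_abs (k - j) ^ 2)) (A * S * 8)"
    by (intro finsum_le_cmult finsum_le_inverse_squares_sym) (auto simp: A S0)
  then show ?thesis
  proof (rule finsum_le_mono)
    fix j show "cmod (a j * a (k - j) - c j * c (k - j)) \<le> A * S * (inv_abs j ^ 2 + inv_abs (k - j) ^ 2)"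
      using product_difference_bound[OF S[of j] S[of "k - j"] a[of "k - j"] c[of j]] by (simp add: algebra_simps)
  qed simp
qed

lemma l2_le_of_decay:
  assumes a: "\<And>j. cmod (a j) \<le> A * inv_abs j ^ 2"
  shows "l2_le a (4 * A\<^sup>2)"
proof -
  have "finsum_le (\<lambda>j. A\<^sup>2 * inv_abs j ^ 2) (A\<^sup>2 * 4)" by (intro finsum_le_cmult finsum_le_inverse_squares) auto
  then show ?thesis
  proof (rule finsum_le_mono)
    fix j
    have "(cmod (a j))\<^sup>2 \<le> (A * inv_abs j ^ 2)\<^sup>2" by (intro power_mono a) auto
    also have "\<dots> = A\<^sup>2 * inv_abs j ^ 4" by (simp add: power_mult_distrib)
    also have "\<dots> \<le> A\<^sup>2 * inv_abs j ^ 2" by (intro mult_left_mono inv_abs_power_le_2) auto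
    finally show "(cmod (a j))\<^sup>2 \<le> A\<^sup>2 * inv_abs j ^ 2" .
  qed simp
qed

lemma infsum_difference_bound:
  fixes f g :: "int \<Rightarrow> complex"
  assumes "f summable_on UNIV" "g summable_on UNIV" "finsum_le (\<lambda>j. cmod (f j - g j)) S"
  shows "cmod (infsum f UNIV - infsum g UNIV) \<le> S"
  proof -
  have "infsum (\<lambda>j. f j + - g j) UNIV = infsum f UNIV + infsum (\<lambda>j. - g j) UNIV"
    by (rule infsum_add) (use assms summable_on_uminus in auto)
  then show ?thesis using finsum_le_norm_infsum[OF assms(3)] by (simp add: infsum_uminus)
qed

lemma rotated_field_difference:
  assumes a: "\<And>j. cmod (a j) \<le> A * inv_abs j ^ 2" and c: "\<And>j. cmod (c j) \<le> A * inv_abs j ^ 2"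
    and S: "\<And>j. cmod (a j - c j) \<le> S"
  shows "cmod (rotated_field K s a k - rotated_field K s c k) \<le> pi * \<bar>real_of_int k\<bar> * (8 * A * S)"
proof -
  have AS: "0 \<le> 8 * A * S" by (rule finsum_le_nonneg[OF finsum_le_product_difference[OF a c S]])
  have "cmod ((\<Sum>\<^sub>\<infinity>j. cis (- (resonance k j * s)) * (a j * a (k - j))) - (\<Sum>\<^sub>\<infinity>j. cis (- (resonance k j * s)) * (c j * c (k - j)))) \<le> 8 * A * S"
    using finsum_le_product_difference[OF a c S, of k]
    by (intro infsum_difference_bound finsum_le_summable[OF finsum_le_rotated_rhs[OF l2_le_of_decay[OF a]]]
          finsum_le_summable[OF finsum_le_rotated_rhs[OF l2_le_of_decay[OF c]]])
       (simp add: right_diff_distrib[symmetric] norm_mult)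
  then have "cmod (rotated_rhs s a k - rotated_rhs s c k) \<le> pi * \<bar>real_of_int k\<bar> * (8 * A * S)"
    unfolding rotated_rhs_def right_diff_distrib[symmetric] norm_mult[of _ "_ - _"]
    by (simp add: norm_mult mult.assoc mult_left_mono)
  then show ?thesis using AS by (simp add: rotated_field_def)
qed

lemma nf_boundary_difference:
  assumes a: "\<And>j. cmod (a j) \<le> A * inv_abs j ^ 2" and c: "\<And>j. cmod (c j) \<le> A * inv_abs j ^ 2"
    and S: "\<And>j. cmod (a j - c j) \<le> S" and k: "k \<noteq> 0"
  shows "cmod (nf_boundary s a k - nf_boundary s c k) \<le> inv_abs k ^ 2 * (8 * A * S)"
  unfolding nf_boundary_def
proof (intro infsum_difference_bound finsum_le_summable[OF finsum_le_nf_boundary_rough[OF l2_le_of_decay[OF a] k]]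
    finsum_le_summable[OF finsum_le_nf_boundary_rough[OF l2_le_of_decay[OF c] k]])
  have "finsum_le (\<lambda>j. inv_abs k ^ 2 * cmod (a j * a (k - j) - c j * c (k - j))) (inv_abs k ^ 2 * (8 * A * S))"
    by (intro finsum_le_cmult finsum_le_product_difference a c S) auto
  then show "finsum_le (\<lambda>j. cmod (nf_coeff k j * cis (- (resonance k j * s)) * (a j * a (k - j)) - nf_coeff k j * cis (- (resonance k j * s)) * (c j * c (k - j)))) (inv_abs k ^ 2 * (8 * A * S))"
    unfolding right_diff_distrib[symmetric]
    by (rule finsum_le_mono) (use nf_coeff_weight_plain[OF k] in auto)
qed

text \<open>Each of the two products is split so that the difference falls on one factor, which gives four terms. A difference of
  time derivatives is compensated like a time derivative itself.\<close>
lemma nf_remainder_difference: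
  assumes a: "\<And>j. cmod (a j) \<le> A * inv_abs j ^ 2" and c: "\<And>j. cmod (c j) \<le> A * inv_abs j ^ 2"
    and S: "\<And>j. cmod (a j - c j) \<le> S" and k: "k \<noteq> 0"
  shows "cmod (nf_remainder s a (rotated_field K s a) k - nf_remainder s c (rotated_field K s c) k) \<le> inv_abs k ^ 2 * (pi * (8 * A * S * A + A\<^sup>2 * 32 * S) * 8)"
proof -
  define b d where "b = rotated_field K s a" and "d = rotated_field K s c"
  have A: "0 \<le> A" using a[of 1] order_trans[OF norm_ge_zero] by (auto simp: inv_abs_def)
  have S0: "0 \<le> S" using order_trans[OF norm_ge_zero S] .
  have bd: "cmod (b j - d j) \<le> pi * \<bar>real_of_int j\<bar> * (8 * A * S)" for j
    unfolding b_def d_def by (rule rotated_field_difference[OF a c S])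
  have b: "cmod (b j) \<le> pi * \<bar>real_of_int j\<bar> * (A\<^sup>2 * 32 * inv_abs j ^ 2)" for j
    using rotated_field_decay[of 2 a A K s j] a by (simp add: b_def)
  have d: "cmod (d j) \<le> pi * \<bar>real_of_int j\<bar> * (A\<^sup>2 * 32 * inv_abs j ^ 2)" for j
    using rotated_field_decay[of 2 c A K s j] c by (simp add: d_def)
  define E where "E = 8 * A * S * A + A\<^sup>2 * 32 * S"
  have s: "(\<lambda>j. nf_coeff k j * cis (- (resonance k j * s)) * (rotated_field K s e j * e (k - j) + e j * rotated_field K s e (k - j))) summable_on UNIV"
    if "\<And>j. cmod (e j) \<le> A * inv_abs j ^ 2" for e
    by (rule finsum_le_summable[OF finsum_le_nf_remainder_rough[OF l2_le_of_decay[OF that] k]])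
       (rule rotated_field_bound[OF l2_le_of_decay[OF that]])
  have "finsum_le (\<lambda>j. inv_abs k ^ 2 * (pi * E) * (inv_abs j ^ 2 + inv_abs (k - j) ^ 2)) (inv_abs k ^ 2 * (pi * E) * 8)"
    by (intro finsum_le_cmult finsum_le_inverse_squares_sym) (auto simp: A S0 E_def)
  then have "finsum_le (\<lambda>j. cmod (nf_coeff k j * cis (- (resonance k j * s)) * (b j * a (k - j) + a j * b (k - j))
     - nf_coeff k j * cis (- (resonance k j * s)) * (d j * c (k - j) + c j * d (k - j)))) (inv_abs k ^ 2 * (pi * E) * 8)"
  proof (rule finsum_le_mono)
    fix j
    define l where "l = k - j"
    define w where "w = nf_coeff k j * cis (- (resonance k j * s))"
    have "w * (b j * a l + a j * b l) - w * (d j * c l + c j * d l)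
      = (w * ((b j - d j) * a l) + w * (d j * (a l - c l))) + (w * ((b l - d l) * a j) + w * (d l * (a j - c j)))"
      by (simp add: algebra_simps)
    also have "cmod \<dots> \<le> (inv_abs k ^ 2 * (pi * ((8 * A * S) * (A * inv_abs l ^ 2))) + inv_abs k ^ 2 * (pi * ((A\<^sup>2 * 32 * inv_abs j ^ 2) * S)))
       + (inv_abs k ^ 2 * (pi * ((8 * A * S) * (A * inv_abs j ^ 2))) + inv_abs k ^ 2 * (pi * ((A\<^sup>2 * 32 * inv_abs l ^ 2) * S)))"
      unfolding w_def using bd[of j] bd[of l] d[of j] d[of l]
      by (intro order_trans[OF norm_triangle_ineq] add_mono nf_coeff_weight k a S) (auto simp: A S0 l_def)
    also have "\<dots> = inv_abs k ^ 2 * (pi * E) * (inv_abs j ^ 2 + inv_abs l ^ 2)" by (simp add: algebra_simps E_def)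
    finally show "cmod (nf_coeff k j * cis (- (resonance k j * s)) * (b j * a (k - j) + a j * b (k - j))
     - nf_coeff k j * cis (- (resonance k j * s)) * (d j * c (k - j) + c j * d (k - j))) \<le> inv_abs k ^ 2 * (pi * E) * (inv_abs j ^ 2 + inv_abs (k - j) ^ 2)"
      unfolding l_def w_def .
  qed simp
  from infsum_difference_bound[OF s[OF a] s[OF c] this[unfolded b_def d_def]] show ?thesis
    unfolding nf_remainder_def E_def b_def d_def by (simp only: mult.assoc)
qed

section \<open>A priori decay of the coefficients\<close>

lemma normal_form_increment:
  assumes v: "rotated_system K v {a..b}"
    and l2: "\<And>s. s \<in> {a..b} \<Longrightarrow> l2_le (v s) R"
    and B: "\<And>s. s \<in> {a..b} \<Longrightarrow> cmod (nf_boundary s (v s) k) \<le> \<beta>"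
    and T: "\<And>s. s \<in> {a..b} \<Longrightarrow> cmod (nf_remainder s (v s) (rotated_field K s (v s)) k) \<le> \<tau>"
    and k: "k \<in> K" and st: "s \<in> {a..b}" "t \<in> {a..b}"
  shows "cmod (v t k - v s k) \<le> 2 * \<beta> + \<tau> * \<bar>t - s\<bar>"
proof -
  have z: "rotated_field K s (\<lambda>_. 0) = (\<lambda>_. 0)" "nf_boundary s (\<lambda>_. 0) k = 0" "nf_remainder s (\<lambda>_. 0) (\<lambda>_. 0) k = 0" for s
    by (auto simp: fun_eq_iff rotated_field_def rotated_rhs_def nf_boundary_def nf_remainder_def)
  have w: "rotated_system K (\<lambda>_ _. 0) {a..b}" using v unfolding rotated_system_def by (simp add: z)
  have "0 \<le> R" using finsum_le_nonneg[OF l2[OF st(1)]] .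
  then have l0: "l2_le (\<lambda>_. 0) R" by (simp add: finsum_le_def)
  show ?thesis
    using normal_form_difference[OF v w l2 l0 _ _ k st, of \<beta> \<tau>] B T by (simp add: z)
qed

text \<open>From decay of order \<open>p \<ge> 2\<close> at all times to an increment of order \<open>p + 2\<close>.\<close>
lemma decay_step:
  assumes v: "rotated_system K v {a..b}" and l2: "\<And>s. s \<in> {a..b} \<Longrightarrow> l2_le (v s) R"
    and dec: "\<And>s k. s \<in> {a..b} \<Longrightarrow> cmod (v s k) \<le> A * inv_abs k ^ p" and p: "2 \<le> p"
    and st: "s \<in> {a..b}" "t \<in> {a..b}"
  shows "cmod (v t k - v s k) \<le> (2 * A\<^sup>2 * (2 ^ p * 8) + 2 * pi * A ^ 3 * (2 ^ p * 8)\<^sup>2 * \<bar>t - s\<bar>) * inv_abs k ^ (p + 2)"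
proof (cases "k \<in> K")
  case True
  then have k: "k \<noteq> 0" using v by (auto simp: rotated_system_def)
  have A: "0 \<le> A" using dec[OF st(1), of 1] order_trans[OF norm_ge_zero] by (auto simp: inv_abs_def)
  have "cmod (v t k - v s k) \<le> 2 * (A\<^sup>2 * (2 ^ p * 8) * inv_abs k ^ (p + 2))
     + 2 * pi * (A\<^sup>2 * (2 ^ p * 8)) * A * (2 ^ p * 8) * inv_abs k ^ (p + 2) * \<bar>t - s\<bar>"
  proof (rule normal_form_increment[OF v l2 _ _ True st])
    fix r assume r: "r \<in> {a..b}"
    show "cmod (nf_boundary r (v r) k) \<le> A\<^sup>2 * (2 ^ p * 8) * inv_abs k ^ (p + 2)"
      by (rule nf_boundary_decay[OF p dec[OF r] k])
    show "cmod (nf_remainder r (v r) (rotated_field K r (v r)) k) \<le> 2 * pi * (A\<^sup>2 * (2 ^ p * 8)) * A * (2 ^ p * 8) * inv_abs k ^ (p + 2)"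
      by (rule nf_remainder_decay[OF p dec[OF r] k _ rotated_field_decay[OF p dec[OF r]]]) (simp add: A)
  qed
  then show ?thesis by (simp add: algebra_simps power2_eq_square power3_eq_cube)
next
  case False
  have A: "0 \<le> A" using dec[OF st(1), of 1] order_trans[OF norm_ge_zero] by (auto simp: inv_abs_def)
  show ?thesis using rotated_systemD(3)[OF v _ False] st by (simp add: A)
qed

text \<open>The first two powers of decay need only the \<open>\<ell>\<^sup>2\<close> bound.\<close>
lemma decay_start:
  assumes v: "rotated_system K v {a..b}" and l2: "\<And>s. s \<in> {a..b} \<Longrightarrow> l2_le (v s) R"
    and st: "s \<in> {a..b}" "t \<in> {a..b}"
  shows "cmod (v t k - v s k) \<le> (2 * R + pi * R * (R + 4) * \<bar>t - s\<bar>) * inv_abs k ^ 2"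
proof (cases "k \<in> K")
  case True
  then have k: "k \<noteq> 0" using v by (auto simp: rotated_system_def)
  have "cmod (v t k - v s k) \<le> 2 * (inv_abs k ^ 2 * R) + inv_abs k ^ 2 * (pi * R * (R + 4)) * \<bar>t - s\<bar>"
  proof (rule normal_form_increment[OF v l2 _ _ True st])
    fix r assume r: "r \<in> {a..b}"
    show "cmod (nf_boundary r (v r) k) \<le> inv_abs k ^ 2 * R"
      unfolding nf_boundary_def by (rule finsum_le_norm_infsum[OF finsum_le_nf_boundary_rough[OF l2[OF r] k]])
    show "cmod (nf_remainder r (v r) (rotated_field K r (v r)) k) \<le> inv_abs k ^ 2 * (pi * R * (R + 4))"
      unfolding nf_remainder_def by (rule finsum_le_norm_infsum[OF finsum_le_nf_remainder_rough[OF l2[OF r] k rotated_field_bound[OF l2[OF r]]]])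
  qed
  then show ?thesis by (simp add: algebra_simps)
next
  case False
  have "0 \<le> R" using finsum_le_nonneg[OF l2[OF st(1)]] .
  then show ?thesis using rotated_systemD(3)[OF v _ False] st by simp
qed

text \<open>The constant of \<open>decay_step\<close> on intervals of length \<open>\<tau>\<close>.\<close>
definition decay_gain :: "real \<Rightarrow> nat \<Rightarrow> real \<Rightarrow> real" where
  "decay_gain \<tau> p A = 2 * A\<^sup>2 * (2 ^ p * 8) + 2 * pi * A ^ 3 * (2 ^ p * 8)\<^sup>2 * \<tau>"

lemma decay_gain_nonneg: "0 \<le> \<tau> \<Longrightarrow> 0 \<le> A \<Longrightarrow> 0 \<le> decay_gain \<tau> p A"
  unfolding decay_gain_def by (intro add_nonneg_nonneg mult_nonneg_nonneg) auto

text \<open>The constant of \<open>decay_start\<close> on intervals of length \<open>\<tau>\<close>.\<close>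
definition decay_gain_start :: "real \<Rightarrow> real \<Rightarrow> real" where
  "decay_gain_start \<tau> R = 2 * R + pi * R * (R + 4) * \<tau>"

lemma add_decay:
  assumes "cmod (x - y) \<le> D * inv_abs k ^ p" "cmod y \<le> A * inv_abs k ^ q" "p \<le> q" "0 \<le> A"
  shows "cmod x \<le> (A + D) * inv_abs k ^ p"
proof -
  have "cmod x \<le> cmod y + cmod (x - y)" using norm_triangle_ineq[of y "x - y"] by simp
  moreover have "A * inv_abs k ^ q \<le> A * inv_abs k ^ p" by (intro mult_left_mono power_decreasing assms) auto
  ultimately show ?thesis using assms by (simp add: algebra_simps)
qed

lemma rough_decay:
  assumes v: "rotated_system K v {t0 - \<tau>..t0 + \<tau>}" and \<tau>: "0 \<le> \<tau>"
    and l2: "\<And>s. s \<in> {t0 - \<tau>..t0 + \<tau>} \<Longrightarrow> l2_le (v s) R"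
    and A: "\<And>k. cmod (v t0 k) \<le> A * inv_abs k ^ 5"
    and s: "s \<in> {t0 - \<tau>..t0 + \<tau>}"
  shows "cmod (v s k) \<le> (A + decay_gain_start \<tau> R) * inv_abs k ^ 2"
proof -
  have A0: "0 \<le> A" using A[of 1] order_trans[OF norm_ge_zero] by (auto simp: inv_abs_def)
  have R: "0 \<le> R" using finsum_le_nonneg[OF l2[OF s]] .
  have "cmod (v s k - v t0 k) \<le> (2 * R + pi * R * (R + 4) * \<bar>s - t0\<bar>) * inv_abs k ^ 2"
    by (rule decay_start[OF v l2 _ s]) (use \<tau> in auto)
  also have "\<dots> \<le> decay_gain_start \<tau> R * inv_abs k ^ 2"
    unfolding decay_gain_start_def using s R by (intro mult_right_mono add_left_mono mult_left_mono) auto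
  finally show ?thesis by (rule add_decay[OF _ A]) (use A0 in auto)
qed

text \<open>Decay of order 2, 4 and 6 in turn. The data have order 5 only, so after the second step the solution has order 4, and
  only the increment improves to order 6. The constant precedes all quantifiers over the system: uniformity in \<open>K\<close> is what
  makes the Galerkin limit possible.\<close>
theorem a_priori_decay:
  assumes "0 \<le> \<tau>" "0 \<le> R" "0 \<le> A"
  obtains D where "0 \<le> D"
    "\<And>K v t0 s k. rotated_system K v {t0 - \<tau>..t0 + \<tau>} \<Longrightarrow> (\<And>s. s \<in> {t0 - \<tau>..t0 + \<tau>} \<Longrightarrow> l2_le (v s) R) \<Longrightarrow>
       (\<And>k. cmod (v t0 k) \<le> A * inv_abs k ^ 5) \<Longrightarrow> s \<in> {t0 - \<tau>..t0 + \<tau>} \<Longrightarrow>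
       cmod (v s k - v t0 k) \<le> D * inv_abs k ^ 6"
proof -
  define A2 where "A2 = A + decay_gain_start \<tau> R"
  define A4 where "A4 = A + decay_gain \<tau> 2 A2"
  define D where "D = decay_gain \<tau> 4 A4"
  have nn: "0 \<le> A2" "0 \<le> A4" "0 \<le> D"
    using assms by (auto simp: A2_def A4_def D_def decay_gain_start_def decay_gain_nonneg)
  show ?thesis
  proof (rule that[OF nn(3)])
    fix K v t0 s k
    assume v: "rotated_system K v {t0 - \<tau>..t0 + \<tau>}" and l2: "\<And>s. s \<in> {t0 - \<tau>..t0 + \<tau>} \<Longrightarrow> l2_le (v s) R"
      and A: "\<And>k. cmod (v t0 k) \<le> A * inv_abs k ^ 5" and s: "s \<in> {t0 - \<tau>..t0 + \<tau>}"
    have t0: "t0 \<in> {t0 - \<tau>..t0 + \<tau>}" using assms by auto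
    have step: "cmod (v s k - v t0 k) \<le> decay_gain \<tau> p B * inv_abs k ^ (p + 2)"
      if "\<And>s k. s \<in> {t0 - \<tau>..t0 + \<tau>} \<Longrightarrow> cmod (v s k) \<le> B * inv_abs k ^ p" "2 \<le> p" "0 \<le> B" "s \<in> {t0 - \<tau>..t0 + \<tau>}" for p B s k
    proof -
      have "cmod (v s k - v t0 k) \<le> (2 * B\<^sup>2 * (2 ^ p * 8) + 2 * pi * B ^ 3 * (2 ^ p * 8)\<^sup>2 * \<bar>s - t0\<bar>) * inv_abs k ^ (p + 2)"
        by (rule decay_step[OF v l2 that(1,2) t0 that(4)])
      also have "\<dots> \<le> decay_gain \<tau> p B * inv_abs k ^ (p + 2)"
        unfolding decay_gain_def using that(3,4) by (intro mult_right_mono add_left_mono mult_left_mono) auto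
      finally show ?thesis .
    qed
    have "cmod (v s k) \<le> A2 * inv_abs k ^ 2" if "s \<in> {t0 - \<tau>..t0 + \<tau>}" for s k
      unfolding A2_def by (rule rough_decay[OF v assms(1) l2 A that])
    from step[OF this _ nn(1)] have "cmod (v s k - v t0 k) \<le> decay_gain \<tau> 2 A2 * inv_abs k ^ 4" if "s \<in> {t0 - \<tau>..t0 + \<tau>}" for s k
      using that by simp
    from add_decay[OF this A] have "cmod (v s k) \<le> A4 * inv_abs k ^ 4" if "s \<in> {t0 - \<tau>..t0 + \<tau>}" for s k
      unfolding A4_def using that assms(3) by simp
    from step[OF this _ nn(2) s] show "cmod (v s k - v t0 k) \<le> D * inv_abs k ^ 6"
      unfolding D_def by simp
  qed
qed

section \<open>Local uniqueness for the rotated system\<close>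

text \<open>If the difference is bounded by \<open>S\<close> in all coefficients near \<open>t0\<close>, it is bounded by \<open>S / 2\<close>. For \<open>\<bar>k\<bar> \<le> N\<close> the
  equation itself gives at most \<open>N\<close> times a constant times the length \<open>\<delta>\<close> of the interval; for \<open>\<bar>k\<bar> > N\<close> the normal
  form gives a constant divided by \<open>k\<^sup>2\<close>. So \<open>N\<close> is chosen first and \<open>\<delta>\<close> after it.\<close>
theorem local_uniqueness:
  assumes v: "rotated_system K v {t0 - \<tau>..t0 + \<tau>}" and w: "rotated_system K w {t0 - \<tau>..t0 + \<tau>}" and \<tau>: "0 < \<tau>"
    and l2: "\<And>s. s \<in> {t0 - \<tau>..t0 + \<tau>} \<Longrightarrow> l2_le (v s) R" "\<And>s. s \<in> {t0 - \<tau>..t0 + \<tau>} \<Longrightarrow> l2_le (w s) R"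
    and A: "\<And>k. cmod (v t0 k) \<le> A * inv_abs k ^ 5" and eq: "w t0 = v t0"
  obtains \<delta> where "0 < \<delta>" "\<And>s. \<bar>s - t0\<bar> \<le> \<delta> \<Longrightarrow> v s = w s"
proof -
  define M where "M = A + decay_gain_start \<tau> R"
  define I where "I = {t0 - \<tau>..t0 + \<tau>}"
  have t0: "t0 \<in> I" using \<tau> by (auto simp: I_def)
  have dv: "cmod (v s k) \<le> M * inv_abs k ^ 2" if "s \<in> I" for s k
    unfolding M_def by (rule rough_decay[OF v _ l2(1) A]) (use \<tau> that in \<open>auto simp: I_def\<close>)
  have dw: "cmod (w s k) \<le> M * inv_abs k ^ 2" if "s \<in> I" for s k
    unfolding M_def by (rule rough_decay[OF w _ l2(2)]) (use \<tau> that A eq in \<open>auto simp: I_def\<close>)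
  have M: "0 \<le> M" using dv[OF t0, of 1] order_trans[OF norm_ge_zero] by (auto simp: inv_abs_def)
  define C1 where "C1 = pi * (8 * M)"
  define C3 where "C3 = pi * (8 * M * M + M\<^sup>2 * 32) * 8"
  define N where "N = 2 * (16 * M + C3) + 1"
  have nn: "0 \<le> C1" "0 \<le> C3" "0 < N" using M by (auto simp: C1_def C3_def N_def add_nonneg_pos)
  define \<delta> where "\<delta> = min (min 1 \<tau>) (1 / (2 * (N * C1 + 1)))"
  have \<delta>: "0 < \<delta>" "\<delta> \<le> 1" "\<delta> \<le> \<tau>" "N * C1 * \<delta> \<le> 1 / 2"
  proof -
    have p: "0 < N * C1 + 1" using nn by (simp add: add_nonneg_pos)
    then show "0 < \<delta>" using \<tau> by (simp add: \<delta>_def)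
    have "N * C1 * \<delta> \<le> (N * C1 + 1) * (1 / (2 * (N * C1 + 1)))"
      using nn p \<open>0 < \<delta>\<close> by (intro mult_mono) (auto simp: \<delta>_def)
    also have "\<dots> = 1 / 2"
    proof -
      have "q * (1 / (2 * q)) = 1 / 2" if "0 < q" for q :: real using that by simp
      from this[OF p] show ?thesis .
    qed
    finally show "N * C1 * \<delta> \<le> 1 / 2" .
  qed (auto simp: \<delta>_def)
  define J where "J = {t0 - \<delta>..t0 + \<delta>}"
  have J: "J \<subseteq> I" using \<delta>(3) by (auto simp: J_def I_def)
  have t0J: "t0 \<in> J" using \<delta> by (auto simp: J_def)
  note vJ = rotated_system_subset[OF v J[unfolded I_def]] and wJ = rotated_system_subset[OF w J[unfolded I_def]]
  have half: "cmod (v t k - w t k) \<le> S / 2"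
    if S: "\<And>s k. s \<in> J \<Longrightarrow> cmod (v s k - w s k) \<le> S" and t: "t \<in> J" for S t k
  proof (cases "k \<in> K")
    case False
    have "0 \<le> S" using order_trans[OF norm_ge_zero S[OF t]] .
    then show ?thesis using rotated_systemD(3)[OF vJ t False] rotated_systemD(3)[OF wJ t False] by simp
  next
    case True
    then have k: "k \<noteq> 0" using v by (auto simp: rotated_system_def)
    have S0: "0 \<le> S" using order_trans[OF norm_ge_zero S[OF t]] .
    have tt: "\<bar>t - t0\<bar> \<le> \<delta>" using t by (auto simp: J_def)
    show ?thesis
    proof (cases "\<bar>real_of_int k\<bar> \<le> N")
      case True
      have "cmod ((v t k - w t k) - (v t0 k - w t0 k)) \<le> (N * C1 * S) * \<bar>t - t0\<bar>"
      proof (rule vector_mean_value_bound[where S = J])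
        fix x assume x: "x \<in> J"
        show "((\<lambda>s. v s k - w s k) has_vector_derivative (rotated_field K x (v x) k - rotated_field K x (w x) k)) (at x within J)"
          by (intro has_vector_derivative_diff rotated_systemD(1)[OF vJ x] rotated_systemD(1)[OF wJ x])
        have "cmod (rotated_field K x (v x) k - rotated_field K x (w x) k) \<le> pi * \<bar>real_of_int k\<bar> * (8 * M * S)"
          by (rule rotated_field_difference[OF dv dw S]) (use x J in auto)
        also have "\<dots> = \<bar>real_of_int k\<bar> * (C1 * S)" by (simp add: C1_def)
        also have "\<dots> \<le> N * (C1 * S)" using True nn S0 by (intro mult_right_mono) auto
        finally show "cmod (rotated_field K x (v x) k - rotated_field K x (w x) k) \<le> N * C1 * S" by simp
      qed (use t t0J in \<open>auto simp: J_def\<close>)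
      also have "\<dots> \<le> (N * C1 * S) * \<delta>" using tt nn S0 by (intro mult_left_mono) auto
      also have "\<dots> = (N * C1 * \<delta>) * S" by simp
      also have "\<dots> \<le> 1 / 2 * S" using \<delta>(4) S0 by (intro mult_right_mono) auto
      finally show ?thesis by (simp add: eq)
    next
      case False
      have "cmod ((v t k - w t k) - (v t0 k - w t0 k)) \<le> 2 * (inv_abs k ^ 2 * (8 * M * S)) + (inv_abs k ^ 2 * (C3 * S)) * \<bar>t - t0\<bar>"
        unfolding J_def
      proof (rule normal_form_difference[OF vJ[unfolded J_def] wJ[unfolded J_def] _ _ _ _ \<open>k \<in> K\<close> t0J[unfolded J_def] t[unfolded J_def]])
        fix s assume "s \<in> {t0 - \<delta>..t0 + \<delta>}"
        then have sJ: "s \<in> J" and sI: "s \<in> I" using J by (auto simp: J_def)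
        show "l2_le (v s) R" "l2_le (w s) R" using l2 sI by (auto simp: I_def)
        show "cmod (nf_boundary s (v s) k - nf_boundary s (w s) k) \<le> inv_abs k ^ 2 * (8 * M * S)"
          by (rule nf_boundary_difference[OF dv[OF sI] dw[OF sI] S[OF sJ] k])
        show "cmod (nf_remainder s (v s) (rotated_field K s (v s)) k - nf_remainder s (w s) (rotated_field K s (w s)) k) \<le> inv_abs k ^ 2 * (C3 * S)"
          using nf_remainder_difference[OF dv[OF sI] dw[OF sI] S[OF sJ] k, of s K] by (simp add: C3_def algebra_simps)
      qed
      also have "\<dots> \<le> 2 * (inv_abs k ^ 2 * (8 * M * S)) + (inv_abs k ^ 2 * (C3 * S)) * 1"
        using tt \<delta>(2) nn S0 by (intro add_left_mono mult_left_mono) auto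
      also have "\<dots> = (inv_abs k ^ 2 * (16 * M + C3)) * S" by (simp add: algebra_simps)
      also have "\<dots> \<le> 1 / 2 * S"
      proof (rule mult_right_mono[OF _ S0])
        have "inv_abs k * N \<le> 1" using False k nn by (simp add: inv_abs_def field_simps)
        have "inv_abs k ^ 2 * (16 * M + C3) \<le> inv_abs k * (16 * M + C3)"
          using power_decreasing[of 1 2 "inv_abs k"] M nn by (intro mult_right_mono) auto
        also have "\<dots> \<le> inv_abs k * (N / 2)" by (intro mult_left_mono) (auto simp: N_def)
        finally show "inv_abs k ^ 2 * (16 * M + C3) \<le> 1 / 2" using \<open>inv_abs k * N \<le> 1\<close> by simp
      qed
      finally show ?thesis by (simp add: eq)
    qed
  qed
  have small: "cmod (v s k - w s k) \<le> 2 * M * (1 / 2) ^ n" if "s \<in> J" for s k n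
    using that
  proof (induction n arbitrary: s k)
    case 0
    have "M * inv_abs k ^ 2 \<le> M * 1 ^ 2" by (intro mult_left_mono power_mono M) auto
    then have "cmod (v s k) \<le> M" "cmod (w s k) \<le> M" using dv[of s k] dw[of s k] 0 J by auto
    then show ?case using norm_triangle_ineq4[of "v s k" "w s k"] by simp
  next
    case (Suc n)
    show ?case using half[OF Suc.IH Suc.prems, of k] by simp
  qed
  show ?thesis
  proof (rule that[OF \<delta>(1)])
    fix s assume "\<bar>s - t0\<bar> \<le> \<delta>"
    then have s: "s \<in> J" by (auto simp: J_def)
    have "(\<lambda>n. 2 * M * (1 / 2 :: real) ^ n) \<longlonglongrightarrow> 2 * M * 0"
      by (intro tendsto_intros LIMSEQ_power_zero) auto
    from LIMSEQ_le_const[OF this] have "cmod (v s k - w s k) \<le> 2 * M * 0" for k using small[OF s] by blast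
    then show "v s = w s" by (auto simp: fun_eq_iff)
  qed
qed

section \<open>Global flows of Lipschitz vector fields\<close>

text \<open>The antiderivative that vanishes at 0, on both sides of 0.\<close>
definition antiderivative :: "(real \<Rightarrow> 'a::banach) \<Rightarrow> real \<Rightarrow> 'a" where
  "antiderivative f t = (if 0 \<le> t then integral {0..t} f else - integral {t..0} f)"

lemma antiderivative_0 [simp]: "antiderivative f 0 = 0"
  by (simp add: antiderivative_def)

lemma antiderivative_has_vector_derivative:
  fixes f :: "real \<Rightarrow> 'a::banach"
  assumes f: "continuous_on UNIV f"
  shows "(antiderivative f has_vector_derivative f t) (at t)"
proof -
  define c where "c = \<bar>t\<bar> + 1"
  have int: "f integrable_on {a..b}" for a b
    by (rule integrable_continuous_interval) (rule continuous_on_subset[OF f], simp)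
  have eq: "integral {-c..s} f - integral {-c..0} f = antiderivative f s" if "s \<in> {-c<..<c}" for s
  proof (cases "0 \<le> s")
    case True
    then show ?thesis
      using Henstock_Kurzweil_Integration.integral_combine[of "-c" 0 s f] int that
      by (auto simp: antiderivative_def c_def algebra_simps)
  next
    case False
    then show ?thesis
      using Henstock_Kurzweil_Integration.integral_combine[of "-c" s 0 f] int that
      by (auto simp: antiderivative_def algebra_simps)
  qed
  have "((\<lambda>s. integral {-c..s} f) has_vector_derivative f t) (at t within {-c..c})"
    by (rule integral_has_vector_derivative) (auto intro: continuous_on_subset[OF f] simp: c_def)
  then have "((\<lambda>s. integral {-c..s} f) has_vector_derivative f t) (at t)"
    by (subst (asm) at_within_interior) (auto simp: c_def)
  then have "((\<lambda>s. integral {-c..s} f - integral {-c..0} f) has_vector_derivative f t) (at t)"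
    by (auto intro!: derivative_eq_intros)
  moreover have "t \<in> {-c<..<c}" by (auto simp: c_def)
  ultimately show ?thesis
    by (elim has_vector_derivative_transform_within_open[where S = "{-c<..<c}"]) (use eq in auto)
qed

lemma antiderivative_diff:
  fixes f g :: "real \<Rightarrow> 'a::banach"
  assumes "continuous_on UNIV f" "continuous_on UNIV g"
  shows "antiderivative (\<lambda>s. f s - g s) t = antiderivative f t - antiderivative g t"
proof -
  have "f integrable_on {a..b}" "g integrable_on {a..b}" for a b
    by (auto intro!: integrable_continuous_interval continuous_on_subset[OF assms(1)] continuous_on_subset[OF assms(2)])
  then show ?thesis by (simp add: antiderivative_def integral_diff)
qed

lemma antiderivative_exp_bound:
  fixes f :: "real \<Rightarrow> 'a::banach"
  assumes f: "continuous_on UNIV f" and a: "0 < a" and bd: "\<And>s. norm (f s) \<le> C * exp (a * \<bar>s\<bar>)"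
  shows "norm (antiderivative f t) \<le> C / a * exp (a * \<bar>t\<bar>)"
proof -
  have C: "0 \<le> C" using order_trans[OF norm_ge_zero bd[of 0]] by simp
  have int: "f integrable_on {a..b}" for a b
    by (rule integrable_continuous_interval) (rule continuous_on_subset[OF f], simp)
  have pos: "((\<lambda>s. C * exp (a * s)) has_integral (C / a * exp (a * t) - C / a * exp (a * 0))) {0..t}" if "0 \<le> t" for t
    using a that by (intro fundamental_theorem_of_calculus)
      (auto intro!: derivative_eq_intros simp flip: has_real_derivative_iff_has_vector_derivative)
  have neg: "((\<lambda>s. C * exp (- a * s)) has_integral (- C / a * exp (- a * 0) - (- C / a * exp (- a * t)))) {t..0}" if "t \<le> 0" for t
    using a that by (intro fundamental_theorem_of_calculus)
      (auto intro!: derivative_eq_intros simp flip: has_real_derivative_iff_has_vector_derivative)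
  show ?thesis
  proof (cases "0 \<le> t")
    case True
    have "norm (integral {0..t} f) \<le> integral {0..t} (\<lambda>s. C * exp (a * s))"
      using bd has_integral_integrable[OF pos[OF True]]
      by (intro integral_norm_bound_integral int) (auto, metis abs_of_nonneg)
    also have "\<dots> = C / a * exp (a * t) - C / a * exp (a * 0)" using pos[OF True] by (rule integral_unique)
    also have "\<dots> \<le> C / a * exp (a * t)" using C a by simp
    finally show ?thesis using True by (simp add: antiderivative_def)
  next
    case False
    then have t: "t \<le> 0" by simp
    have "norm (integral {t..0} f) \<le> integral {t..0} (\<lambda>s. C * exp (- a * s))"
    proof (intro integral_norm_bound_integral int has_integral_integrable[OF neg[OF t]])
      fix s assume "s \<in> {t..0}" then show "norm (f s) \<le> C * exp (- a * s)" using bd[of s] by simp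
    qed
    also have "\<dots> = - C / a * exp (- a * 0) - (- C / a * exp (- a * t))" using neg[OF t] by (rule integral_unique)
    also have "\<dots> \<le> C / a * exp (- a * t)" using C a by simp
    finally show ?thesis using False by (simp add: antiderivative_def)
  qed
qed

text \<open>Banach's fixed point theorem for the Picard operator. In the unknown \<open>exp (- 2 L \<bar>t\<bar>) x(t)\<close> it is a
  contraction with factor 1/2 on the bounded continuous functions on the whole line, which gives the solution
  for all times at once.\<close>
theorem lipschitz_ode_global:
  fixes F :: "'a::banach \<Rightarrow> 'a"
  assumes lip: "\<And>x y. norm (F x - F y) \<le> L * norm (x - y)" and L: "0 < L"
  obtains x where "x 0 = x0" "\<And>t. (x has_vector_derivative F (x t)) (at t)"
proof -
  define a where "a = 2 * L"
  have a: "0 < a" using L by (simp add: a_def)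
  have "L-lipschitz_on UNIV F"
    using L lip by (auto intro!: lipschitz_onI simp: dist_norm)
  then have Fc: "continuous_on UNIV F" by (rule lipschitz_on_continuous_on)
  define G where "G y s = F (exp (a * \<bar>s\<bar>) *\<^sub>R apply_bcontfun y s)" for y :: "real \<Rightarrow>\<^sub>C 'a" and s
  have Gc: "continuous_on UNIV (G y)" for y
    unfolding G_def by (intro continuous_on_compose2[OF Fc] continuous_intros) auto
  have Gd: "norm (G y s - G z s) \<le> L * dist y z * exp (a * \<bar>s\<bar>)" for y z s
  proof -
    have "norm (G y s - G z s) \<le> L * norm (exp (a * \<bar>s\<bar>) *\<^sub>R apply_bcontfun y s - exp (a * \<bar>s\<bar>) *\<^sub>R apply_bcontfun z s)"
      unfolding G_def by (rule lip)
    also have "\<dots> = L * (exp (a * \<bar>s\<bar>) * dist (apply_bcontfun y s) (apply_bcontfun z s))"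
      by (simp add: scaleR_diff_right[symmetric] dist_norm)
    also have "\<dots> \<le> L * (exp (a * \<bar>s\<bar>) * dist y z)" using L by (intro mult_left_mono dist_bounded) auto
    finally show ?thesis by (simp add: mult_ac)
  qed
  have Gb: "norm (G y s) \<le> (norm (F 0) + L * norm y) * exp (a * \<bar>s\<bar>)" for y s
  proof -
    have "norm (G y s) \<le> norm (F 0) + norm (G y s - G 0 s)"
      using norm_triangle_ineq[of "F 0" "G y s - G 0 s"] by (simp add: G_def)
    also have "\<dots> \<le> norm (F 0) * exp (a * \<bar>s\<bar>) + L * dist y 0 * exp (a * \<bar>s\<bar>)"
    proof (intro add_mono Gd)
      have "1 \<le> exp (a * \<bar>s\<bar>)" using a by simp
      then have "norm (F 0) * 1 \<le> norm (F 0) * exp (a * \<bar>s\<bar>)" by (intro mult_left_mono) auto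
      then show "norm (F 0) \<le> norm (F 0) * exp (a * \<bar>s\<bar>)" by simp
    qed
    finally show ?thesis by (simp add: algebra_simps)
  qed
  define P where "P y t = exp (- (a * \<bar>t\<bar>)) *\<^sub>R (x0 + antiderivative (G y) t)" for y t
  have Pc: "continuous_on UNIV (P y)" for y
  proof -
    have "continuous_on UNIV (antiderivative (G y))"
      using antiderivative_has_vector_derivative[OF Gc] has_vector_derivative_continuous
      by (metis continuous_at_imp_continuous_on)
    then show ?thesis unfolding P_def by (intro continuous_intros) auto
  qed
  have ee: "exp (- (a * \<bar>t\<bar>)) * (C * exp (a * \<bar>t\<bar>)) = C" for t C :: real
    by (simp add: exp_minus field_simps)
  have Pb: "norm (P y t) \<le> norm x0 + (norm (F 0) + L * norm y) / a" for y t
  proof -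
    have "norm (P y t) \<le> exp (- (a * \<bar>t\<bar>)) * (norm x0 + norm (antiderivative (G y) t))"
      unfolding P_def by (simp add: norm_triangle_ineq)
    also have "\<dots> = exp (- (a * \<bar>t\<bar>)) * norm x0 + exp (- (a * \<bar>t\<bar>)) * norm (antiderivative (G y) t)"
      by (simp add: distrib_left)
    also have "\<dots> \<le> 1 * norm x0 + exp (- (a * \<bar>t\<bar>)) * ((norm (F 0) + L * norm y) / a * exp (a * \<bar>t\<bar>))"
      using a by (intro add_mono mult_right_mono mult_left_mono antiderivative_exp_bound Gc Gb) auto
    finally show ?thesis unfolding ee by simp
  qed
  define \<Phi> where "\<Phi> y = Bcontfun (P y)" for y
  have \<Phi>: "apply_bcontfun (\<Phi> y) = P y" for y
    unfolding \<Phi>_def by (rule Bcontfun_inverse) (rule bcontfun_normI[OF Pc Pb])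
  have "\<exists>!y. \<Phi> y = y"
  proof (rule banach_fix_type)
    show "\<forall>y z. dist (\<Phi> y) (\<Phi> z) \<le> 1 / 2 * dist y z"
    proof (intro allI dist_bound)
      fix y z t
      have "dist (P y t) (P z t) = exp (- (a * \<bar>t\<bar>)) * norm (antiderivative (\<lambda>s. G y s - G z s) t)"
        unfolding P_def dist_norm scaleR_diff_right[symmetric] by (simp add: antiderivative_diff Gc)
      also have "\<dots> \<le> exp (- (a * \<bar>t\<bar>)) * (L * dist y z / a * exp (a * \<bar>t\<bar>))"
        by (intro mult_left_mono antiderivative_exp_bound continuous_on_diff Gc Gd a) auto
      also have "\<dots> = 1 / 2 * dist y z" unfolding ee using L by (simp add: a_def)
      finally show "dist (apply_bcontfun (\<Phi> y) t) (apply_bcontfun (\<Phi> z) t) \<le> 1 / 2 * dist y z" by (simp add: \<Phi>)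
    qed
  qed auto
  then obtain y where y: "\<Phi> y = y" by blast
  define x where "x t = exp (a * \<bar>t\<bar>) *\<^sub>R apply_bcontfun y t" for t
  have x: "x t = x0 + antiderivative (G y) t" for t
  proof -
    have "x t = exp (a * \<bar>t\<bar>) *\<^sub>R P y t" unfolding x_def by (subst y[symmetric]) (simp add: \<Phi>)
    also have "\<dots> = x0 + antiderivative (G y) t" unfolding P_def by (simp add: exp_minus)
    finally show ?thesis .
  qed
  show ?thesis
  proof (rule that)
    show "x 0 = x0" by (simp add: x)
    fix t
    have "((\<lambda>t. x0 + antiderivative (G y) t) has_vector_derivative 0 + G y t) (at t)"
      by (intro derivative_intros antiderivative_has_vector_derivative Gc)
    then show "(x has_vector_derivative F (x t)) (at t)"
      unfolding x[abs_def, symmetric] by (simp add: G_def x_def)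
  qed
qed

section \<open>From the Kawahara coefficients to the rotated system\<close>

text \<open>The vector field of the equation for the Fourier coefficients, with an additional transport with speed \<open>m\<close>.\<close>
definition kawahara_rhs :: "real \<Rightarrow> (int \<Rightarrow> complex) \<Rightarrow> int \<Rightarrow> complex" where
  "kawahara_rhs m a k = \<i> * dispersion m k * a k - \<i> * (pi * k) * (\<Sum>\<^sub>\<infinity>j. a j * a (k - j))"

definition fourier_system :: "real \<Rightarrow> int set \<Rightarrow> (real \<Rightarrow> int \<Rightarrow> complex) \<Rightarrow> real set \<Rightarrow> bool" where
  "fourier_system m K u I \<longleftrightarrow> 0 \<notin> K \<and> (\<forall>s\<in>I. (\<forall>k. k \<notin> K \<longrightarrow> u s k = 0) \<and>
     (\<forall>k\<in>K. ((\<lambda>s. u s k) has_vector_derivative kawahara_rhs m (u s) k) (at s within I)))"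

text \<open>Removing the linear evolution; it does not change absolute values.\<close>
definition rotate_phase :: "real \<Rightarrow> (real \<Rightarrow> int \<Rightarrow> complex) \<Rightarrow> real \<Rightarrow> int \<Rightarrow> complex" where
  "rotate_phase m u s k = cis (- dispersion m k * s) * u s k"

lemma cmod_rotate_phase [simp]: "cmod (rotate_phase m u s k) = cmod (u s k)"
  by (simp add: rotate_phase_def norm_mult)

lemma rotate_phase_derivative_eq:
  "cis (- dispersion m k * s) * kawahara_rhs m (u s) k + (\<i> * of_real (- dispersion m k)) * cis (- dispersion m k * s) * u s k = rotated_rhs s (rotate_phase m u s) k"
proof -
  have "cis (- (resonance k j * s)) * (rotate_phase m u s j * rotate_phase m u s (k - j)) = cis (- dispersion m k * s) * (u s j * u s (k - j))" for j
  proof -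
    have c: "cis a * ((cis b * x) * (cis d * y)) = cis (a + b + d) * (x * y)" for a b d x y
      unfolding cis_mult[symmetric] by (simp only: mult_ac)
    have e: "- (resonance k j * s) + - dispersion m j * s + - dispersion m (k - j) * s = - dispersion m k * s"
      unfolding dispersion_resonance[of m k j, symmetric] by (simp add: algebra_simps)
    show ?thesis unfolding rotate_phase_def c e ..
  qed
  then have "(\<Sum>\<^sub>\<infinity>j. cis (- (resonance k j * s)) * (rotate_phase m u s j * rotate_phase m u s (k - j))) = cis (- dispersion m k * s) * (\<Sum>\<^sub>\<infinity>j. u s j * u s (k - j))"
    by (simp add: infsum_cmult_right')
  then show ?thesis unfolding rotated_rhs_def kawahara_rhs_def by (simp add: algebra_simps)
qed

lemma fourier_system_imp_rotated_system:
  assumes "fourier_system m K u I" shows "rotated_system K (rotate_phase m u) I"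
  unfolding rotated_system_def
proof (intro conjI ballI allI impI)
  show "0 \<notin> K" using assms by (simp add: fourier_system_def)
  fix s k assume s: "s \<in> I"
  show "rotate_phase m u s k = 0" if "k \<notin> K" using assms that s by (simp add: fourier_system_def rotate_phase_def)
  show "((\<lambda>s. rotate_phase m u s k) has_vector_derivative rotated_field K s (rotate_phase m u s) k) (at s within I)"
  proof (cases "k \<in> K")
    case True
    then have "((\<lambda>s. u s k) has_vector_derivative kawahara_rhs m (u s) k) (at s within I)" using assms s by (simp add: fourier_system_def)
    from has_vector_derivative_mult[OF has_vector_derivative_cis_linear[of "- dispersion m k" s I] this]
    have "((\<lambda>s. cis (- dispersion m k * s) * u s k) has_vector_derivative rotated_rhs s (rotate_phase m u s) k) (at s within I)"
      by (simp only: rotate_phase_derivative_eq)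
    then show ?thesis using True by (simp only: rotated_field_def rotate_phase_def if_True)
  next
    case False
    have "((\<lambda>s. 0) has_vector_derivative 0) (at s within I)" by simp
    then have "((\<lambda>s. rotate_phase m u s k) has_vector_derivative 0) (at s within I)"
      by (rule has_vector_derivative_transform[OF s, rotated]) (use assms False in \<open>auto simp: fourier_system_def rotate_phase_def\<close>)
    then show ?thesis using False by (simp add: rotated_field_def)
  qed
qed

section \<open>Galerkin approximations\<close>

text \<open>Truncating real and imaginary parts makes the quadratic vector field globally Lipschitz. The truncation
  commutes with complex conjugation and does nothing on coefficients of modulus at most \<open>r\<close>.\<close>
definition clamp_box :: "real \<Rightarrow> complex \<Rightarrow> complex" where
  "clamp_box r z = Complex (max (- r) (min r (Re z))) (max (- r) (min r (Im z)))"

lemma clamp_box_bound: "0 \<le> r \<Longrightarrow> cmod (clamp_box r z) \<le> 2 * r"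
  using cmod_le[of "clamp_box r z"] by (auto simp: clamp_box_def max_def min_def split: if_splits)

lemma clamp_box_lipschitz: "cmod (clamp_box r z - clamp_box r w) \<le> cmod (z - w)"
proof -
  have *: "(max (- r) (min r x) - max (- r) (min r y))\<^sup>2 \<le> (x - y)\<^sup>2" for x y :: real
    by (subst abs_le_square_iff[symmetric]) (auto simp: max_def min_def)
  show ?thesis unfolding cmod_def clamp_box_def
    using *[of "Re z" "Re w"] *[of "Im z" "Im w"] by (intro real_sqrt_le_mono add_mono) auto
qed

lemma clamp_box_cnj: "0 \<le> r \<Longrightarrow> clamp_box r (cnj z) = cnj (clamp_box r z)"
  by (auto simp: clamp_box_def complex_eq_iff max_def min_def)

lemma clamp_box_id: "cmod z \<le> r \<Longrightarrow> clamp_box r z = z"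
  using abs_Re_le_cmod[of z] abs_Im_le_cmod[of z] by (auto simp: clamp_box_def complex_eq_iff)

lemma dispersion_uminus: "dispersion m (- k) = - dispersion m k"
  by (simp add: dispersion_def power_mult_distrib)

text \<open>With \<open>n = - k\<close> the sum is, up to sign, the sum of \<open>n a(n) a(j) a(l)\<close> over \<open>n + j + l = 0\<close>. By symmetry it
  equals the same sum with \<open>n\<close> replaced by \<open>j\<close> or \<open>l\<close>, and the three add up to 0. This is the conservation of the \<open>L\<^sup>2\<close>
  norm.\<close>
lemma energy_cancellation:
  fixes a :: "int \<Rightarrow> complex"
  assumes K: "finite K" "\<And>k. - k \<in> K \<longleftrightarrow> k \<in> K"
  shows "(\<Sum>k\<in>K. \<Sum>j\<in>K. of_int k * (a (- k) * (if k - j \<in> K then a j * a (k - j) else 0))) = 0"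
proof -
  define T where "T = {(n, j). n \<in> K \<and> j \<in> K \<and> - n - j \<in> K}"
  have fT: "finite T" by (rule finite_subset[of _ "K \<times> K"]) (use K in \<open>auto simp: T_def\<close>)
  define P where "P = (\<lambda>(n, j). a n * (a j * a (- n - j)))"
  define S where "S = (\<Sum>x\<in>T. of_int (fst x) * P x)"
  have "(\<Sum>k\<in>K. \<Sum>j\<in>K. of_int k * (a (- k) * (if k - j \<in> K then a j * a (k - j) else 0)))
     = (\<Sum>x\<in>K \<times> K. of_int (fst x) * (a (- fst x) * (if fst x - snd x \<in> K then a (snd x) * a (fst x - snd x) else 0)))"
    by (simp add: sum.cartesian_product case_prod_unfold)
  also have "\<dots> = (\<Sum>x\<in>{x \<in> K \<times> K. fst x - snd x \<in> K}. of_int (fst x) * (a (- fst x) * (a (snd x) * a (fst x - snd x))))"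
    by (rule sum.mono_neutral_cong_right) (use K in auto)
  also have "\<dots> = (\<Sum>x\<in>T. of_int (- fst x) * P x)"
  proof (rule sum.reindex_bij_witness[where i = "\<lambda>x. (- fst x, snd x)" and j = "\<lambda>x. (- fst x, snd x)"])
    fix x :: "int \<times> int" assume "x \<in> {x \<in> K \<times> K. fst x - snd x \<in> K}"
    then show "(- fst x, snd x) \<in> T" using K(2) by (cases x) (simp add: T_def)
  next
    fix x assume "x \<in> T"
    then show "(- fst x, snd x) \<in> {x \<in> K \<times> K. fst x - snd x \<in> K}" using K(2) by (cases x) (simp add: T_def)
  next
    fix x :: "int \<times> int"
    show "of_int (- fst (- fst x, snd x)) * P (- fst x, snd x) = of_int (fst x) * (a (- fst x) * (a (snd x) * a (fst x - snd x)))"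
      by (simp add: P_def)
  qed auto
  also have "\<dots> = - S" by (simp add: S_def sum_negf)
  finally have *: "(\<Sum>k\<in>K. \<Sum>j\<in>K. of_int k * (a (- k) * (if k - j \<in> K then a j * a (k - j) else 0))) = - S" .
  have comm: "- n - j = - j - n" for n j :: int by simp
  have S2: "S = (\<Sum>x\<in>T. of_int (snd x) * P x)" unfolding S_def
  proof (rule sum.reindex_bij_witness[where i = "\<lambda>x. (snd x, fst x)" and j = "\<lambda>x. (snd x, fst x)"])
    fix x assume "x \<in> T"
    then show "(snd x, fst x) \<in> T" by (cases x) (simp add: T_def, metis comm)
  next
    fix x assume "x \<in> T"
    then show "(snd x, fst x) \<in> T" by (cases x) (simp add: T_def, metis comm)
  next
    fix x
    have "P (snd x, fst x) = P x" unfolding P_def case_prod_unfold fst_conv snd_conv comm[of "snd x"]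
      by (simp only: mult.left_commute)
    then show "of_int (snd (snd x, fst x)) * P (snd x, fst x) = of_int (fst x) * P x" by simp
  qed auto
  have S3: "S = (\<Sum>x\<in>T. of_int (- fst x - snd x) * P x)" unfolding S_def
  proof (rule sum.reindex_bij_witness[where i = "\<lambda>x. (- fst x - snd x, snd x)" and j = "\<lambda>x. (- fst x - snd x, snd x)"])
    fix x assume "x \<in> T"
    then show "(- fst x - snd x, snd x) \<in> T" by (cases x) (simp add: T_def)
  next
    fix x assume "x \<in> T"
    then show "(- fst x - snd x, snd x) \<in> T" by (cases x) (simp add: T_def)
  next
    fix x
    have "P (- fst x - snd x, snd x) = P x" by (simp add: P_def case_prod_unfold mult_ac)
    then show "of_int (- fst (- fst x - snd x, snd x) - snd (- fst x - snd x, snd x)) * P (- fst x - snd x, snd x) = of_int (fst x) * P x"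
      by simp
  qed auto
  have "S + S + S = (\<Sum>x\<in>T. of_int (fst x) * P x + of_int (snd x) * P x + of_int (- fst x - snd x) * P x)"
    unfolding sum.distrib S2[symmetric] S3[symmetric] by (simp add: S_def)
  also have "\<dots> = 0" by (rule sum.neutral) (simp add: algebra_simps)
  finally have "S = 0" by simp
  with * show ?thesis by simp
qed

instance bcontfun :: (metric_space, banach) banach ..

text \<open>The set where \<open>y\<close> takes its initial value is closed, and it is open because \<open>y\<close> stays below the
  barrier nearby.\<close>
lemma constant_below_barrier:
  fixes y :: "real \<Rightarrow> real"
  assumes der: "\<And>t. (y has_real_derivative y' t) (at t)"
    and zero: "\<And>t. y t < b \<Longrightarrow> y' t = 0" and start: "y 0 < b"
  shows "y t = y 0"
proof -
  have cont: "continuous_on UNIV y"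
    by (intro continuous_at_imp_continuous_on ballI DERIV_isCont[OF der])
  have cl: "closed {t. y t = y 0}"
    by (rule closed_Collect_eq[OF cont continuous_on_const])
  have "\<exists>e>0. ball t e \<subseteq> {t. y t = y 0}" if t: "y t = y 0" for t
  proof -
    have "open {t. y t < b}" by (rule open_Collect_less[OF cont continuous_on_const])
    moreover have "t \<in> {t. y t < b}" using t start by simp
    ultimately obtain e where e: "e > 0" "ball t e \<subseteq> {t. y t < b}" by (rule openE)
    have "\<exists>c. \<forall>x\<in>ball t e. y x = c"
    proof (rule has_field_derivative_zero_constant[OF convex_ball])
      fix x assume "x \<in> ball t e"
      then have "y' x = 0" using e(2) by (intro zero) auto
      then show "(y has_real_derivative 0) (at x within ball t e)"
        using has_field_derivative_at_within[OF der, of x] by simp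
    qed
    then obtain c where c: "\<And>x. x \<in> ball t e \<Longrightarrow> y x = c" by blast
    have "y s = y 0" if "s \<in> ball t e" for s
      using c[OF that] c[of t] e(1) t by simp
    with e(1) show ?thesis by blast
  qed
  then have op: "open {t. y t = y 0}" unfolding open_contains_ball by blast
  have "{t. y t = y 0} = {} \<or> {t. y t = y 0} = UNIV"
    by (rule iffD1[OF clopen conjI[OF cl op]])
  then show ?thesis
  proof
    assume "{t. y t = y 0} = {}"
    moreover have "0 \<in> {t. y t = y 0}" by simp
    ultimately show ?thesis by simp
  next
    assume "{t. y t = y 0} = UNIV"
    then have "t \<in> {t. y t = y 0}" by simp
    then show ?thesis by simp
  qed
qed

text \<open>The vector field is truncated by \<open>clamp_box\<close> and composed with the projection to conjugate symmetric sequences, so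
  the symmetric part of the solution solves the same system. As long as the energy is below \<open>r\<^sup>2\<close> the truncation is
  inactive and the energy is constant; by \<open>constant_below_barrier\<close> this is always so, and the truncation can be removed.
  Finite sequences are embedded into the Banach space of bounded continuous functions on the line as piecewise
  linear interpolants.\<close>
theorem galerkin_solution:
  fixes c :: "int \<Rightarrow> complex"
  assumes K: "finite K" "\<And>k. - k \<in> K \<longleftrightarrow> k \<in> K" "0 \<notin> K"
    and c: "\<And>k. c (- k) = cnj (c k)" and R: "l2_le c R"
  obtains u where "fourier_system m K u UNIV" "\<And>k. k \<in> K \<Longrightarrow> u 0 k = c k" "\<And>t k. u t (- k) = cnj (u t k)" "\<And>t. l2_le (u t) R"
proof -
  \<comment> \<open>The level of truncation must satisfy \<open>r\<^sup>2 > R\<close>.\<close>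
  define r where "r = R + 1"
  have R0: "0 \<le> R" by (rule finsum_le_nonneg[OF R])
  have r: "0 \<le> r" "R < r\<^sup>2" 
  proof -
    have "r\<^sup>2 = R * R + 2 * R + 1" by (simp add: r_def power2_eq_square algebra_simps)
    then show "R < r\<^sup>2" using R0 mult_nonneg_nonneg[OF R0 R0] by linarith
  qed (use R0 in \<open>simp add: r_def\<close>)
  define q where "q a k = (\<Sum>j\<in>K. if k - j \<in> K then clamp_box r (a j) * clamp_box r (a (k - j)) else 0)" for a k
  define V where "V a k = (if k \<in> K then \<i> * dispersion m k * a k - \<i> * (pi * k) * q a k else 0)" for a k
  \<comment> \<open>The projection to sequences with \<open>x (- k) = cnj (x k)\<close>.\<close>
  define sy where "sy x k = (x k + cnj (x (- k))) / 2" for x :: "int \<Rightarrow> complex" and k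
  have sy_diff: "cmod (sy x k - sy y k) \<le> d" if "\<And>k. cmod (x k - y k) \<le> d" for x y k d
  proof -
    have "sy x k - sy y k = ((x k - y k) + cnj (x (- k) - y (- k))) / 2" by (simp add: sy_def diff_divide_distrib[symmetric])
    then have "cmod (sy x k - sy y k) = cmod ((x k - y k) + cnj (x (- k) - y (- k))) / 2"
      by (simp only: norm_divide norm_numeral)
    then have "cmod (sy x k - sy y k) \<le> (cmod (x k - y k) + cmod (cnj (x (- k) - y (- k)))) / 2"
      by (simp only:) (rule divide_right_mono[OF norm_triangle_ineq], simp)
    also have "\<dots> \<le> (d + d) / 2"
      by (intro divide_right_mono add_mono) (use that[of k] that[of "- k"] in \<open>auto simp only: complex_mod_cnj\<close>)
    finally show ?thesis by simp
  qed
  define Lk where "Lk k = \<bar>dispersion m k\<bar> + pi * \<bar>real_of_int k\<bar> * (card K * (4 * r))" for k :: int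
  define L where "L = (\<Sum>k\<in>K. Lk k) + 1"
  have Lk0: "0 \<le> Lk k" for k using r by (auto simp: Lk_def)
  have L0: "0 < L" using sum_nonneg[of K Lk] Lk0 by (simp add: L_def add_nonneg_pos)
  have Vlip: "cmod (V a k - V b k) \<le> L * d" if d: "\<And>k. cmod (a k - b k) \<le> d" for a b k d
  proof (cases "k \<in> K")
    case True
    have d0: "0 \<le> d" using order_trans[OF norm_ge_zero d] .
    have "cmod (q a k - q b k) \<le> (\<Sum>j\<in>K. 4 * r * d)"
      unfolding q_def sum_subtractf[symmetric]
    proof (rule order_trans[OF norm_sum], rule sum_mono)
      fix j
      have "cmod (clamp_box r (a j) * clamp_box r (a (k - j)) - clamp_box r (b j) * clamp_box r (b (k - j))) \<le> d * (2 * r) + (2 * r) * d"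
        by (intro product_difference_bound clamp_box_bound r order_trans[OF clamp_box_lipschitz d])
      then show "cmod ((if k - j \<in> K then clamp_box r (a j) * clamp_box r (a (k - j)) else 0)
        - (if k - j \<in> K then clamp_box r (b j) * clamp_box r (b (k - j)) else 0)) \<le> 4 * r * d"
        using r d0 by (auto simp: algebra_simps)
    qed
    then have q: "cmod (q a k - q b k) \<le> card K * (4 * r) * d" by simp
    have "V a k - V b k = \<i> * dispersion m k * (a k - b k) - \<i> * (pi * k) * (q a k - q b k)"
      using True by (simp add: V_def algebra_simps)
    also have "cmod \<dots> \<le> \<bar>dispersion m k\<bar> * cmod (a k - b k) + pi * \<bar>real_of_int k\<bar> * cmod (q a k - q b k)"
      by (rule order_trans[OF norm_triangle_ineq4]) (simp add: norm_mult)
    also have "\<dots> \<le> \<bar>dispersion m k\<bar> * d + pi * \<bar>real_of_int k\<bar> * (card K * (4 * r) * d)"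
      by (intro add_mono mult_left_mono d q) auto
    also have "\<dots> = Lk k * d" by (simp add: Lk_def algebra_simps)
    also have "\<dots> \<le> L * d" using member_le_sum[of k K Lk] True Lk0 K d0 by (intro mult_right_mono) (auto simp: L_def)
    finally show ?thesis .
  next
    case False
    then show ?thesis using order_trans[OF norm_ge_zero d] L0 by (simp add: V_def)
  qed
  \<comment> \<open>The hat functions at the points of \<open>K\<close> have sup norm 1 and vanish at all other integers.\<close>
  define emb :: "(int \<Rightarrow> complex) \<Rightarrow> (real \<Rightarrow>\<^sub>C complex)" where
    "emb f = Bcontfun (\<lambda>\<xi>. \<Sum>k\<in>K. of_real (max 0 (1 - \<bar>\<xi> - real_of_int k\<bar>)) * f k)" for f
  define ev :: "(real \<Rightarrow>\<^sub>C complex) \<Rightarrow> int \<Rightarrow> complex" where "ev x k = apply_bcontfun x (real_of_int k)" for x k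
  have hat_le: "cmod (\<Sum>k\<in>K. of_real (max 0 (1 - \<bar>\<xi> - real_of_int k\<bar>)) * f k) \<le> (\<Sum>k\<in>K. cmod (f k))" for f :: "int \<Rightarrow> complex" and \<xi>
  proof (rule order_trans[OF norm_sum], rule sum_mono)
    fix k
    have "max 0 (1 - \<bar>\<xi> - real_of_int k\<bar>) * cmod (f k) \<le> 1 * cmod (f k)" by (intro mult_right_mono) auto
    then show "cmod (of_real (max 0 (1 - \<bar>\<xi> - real_of_int k\<bar>)) * f k) \<le> cmod (f k)" by (simp add: norm_mult)
  qed
  have emb: "apply_bcontfun (emb f) = (\<lambda>\<xi>. \<Sum>k\<in>K. of_real (max 0 (1 - \<bar>\<xi> - real_of_int k\<bar>)) * f k)" for f
    unfolding emb_def by (rule Bcontfun_inverse, rule bcontfun_normI[OF _ hat_le]) (intro continuous_intros)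
  have ev_emb: "ev (emb f) k = (if k \<in> K then f k else 0)" for f k
  proof -
    have "max 0 (1 - \<bar>real_of_int k - real_of_int j\<bar>) = (if j = k then 1 else 0)" for j by auto
    then have "(\<Sum>j\<in>K. of_real (max 0 (1 - \<bar>real_of_int k - real_of_int j\<bar>)) * f j) = (\<Sum>j\<in>K. if j = k then f j else 0)"
      by (intro sum.cong refl) simp
    then show ?thesis unfolding ev_def emb using K by simp
  qed
  have norm_emb: "norm (emb f - emb g) \<le> (\<Sum>k\<in>K. cmod (f k - g k))" for f g
  proof (rule norm_bound)
    fix \<xi>
    have "apply_bcontfun (emb f - emb g) \<xi> = (\<Sum>k\<in>K. of_real (max 0 (1 - \<bar>\<xi> - real_of_int k\<bar>)) * (f k - g k))"
      by (simp add: emb right_diff_distrib sum_subtractf)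
    then show "norm (apply_bcontfun (emb f - emb g) \<xi>) \<le> (\<Sum>k\<in>K. cmod (f k - g k))" using hat_le by simp
  qed
  define F where "F x = emb (V (sy (ev x)))" for x
  have F: "ev (F x) = V (sy (ev x))" for x by (simp add: fun_eq_iff F_def ev_emb V_def)
  have x0: "ev (emb c) k = (if k \<in> K then c k else 0)" for k by (rule ev_emb)
  have Flip: "norm (F x - F y) \<le> (card K * L + 1) * norm (x - y)" for x y
  proof -
    have d: "cmod (ev x k - ev y k) \<le> norm (x - y)" for k
      unfolding ev_def by (metis minus_bcontfun.rep_eq norm_bounded)
    have "norm (F x - F y) \<le> (\<Sum>k\<in>K. L * norm (x - y))"
      unfolding F_def by (rule order_trans[OF norm_emb]) (intro sum_mono Vlip sy_diff d)
    also have "\<dots> \<le> (card K * L + 1) * norm (x - y)" by (simp add: algebra_simps)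
    finally show ?thesis .
  qed
  obtain x where x: "x 0 = emb c" "\<And>t. (x has_vector_derivative F (x t)) (at t)"
    using lipschitz_ode_global[where F = F and ?x0.0 = "emb c", OF Flip] L0 by (auto simp: add_nonneg_pos)
  have evl: "bounded_linear (\<lambda>x. ev x k)" for k
    unfolding ev_def by (rule bounded_linear_intro[where K = 1]) (auto simp: norm_bounded)
  define u where "u t k = (if k \<in> K then sy (ev (x t)) k else 0)" for t k
  have u_cnj: "u t (- k) = cnj (u t k)" for t k by (simp add: u_def sy_def K add.commute)
  have Vu: "V (sy (ev (x t))) = V (u t)" for t
    by (auto simp: V_def q_def u_def fun_eq_iff intro!: sum.cong)
  have q_cnj: "q (u t) (- k) = cnj (q (u t) k)" for t k
  proof -
    have "q (u t) (- k) = (\<Sum>j\<in>K. if - k + j \<in> K then clamp_box r (u t (- j)) * clamp_box r (u t (- k + j)) else 0)"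
      unfolding q_def by (rule sum.reindex_bij_witness[where i = uminus and j = uminus]) (use K in auto)
    also have "\<dots> = cnj (q (u t) k)"
      unfolding q_def cnj_sum
    proof (rule sum.cong[OF refl])
      fix j
      have "- k + j = - (k - j)" by simp
      then show "(if - k + j \<in> K then clamp_box r (u t (- j)) * clamp_box r (u t (- k + j)) else 0)
        = cnj (if k - j \<in> K then clamp_box r (u t j) * clamp_box r (u t (k - j)) else 0)"
        by (simp only: K(2) u_cnj clamp_box_cnj[OF r(1)]) simp
    qed
    finally show ?thesis .
  qed
  have V_cnj: "V (u t) (- k) = cnj (V (u t) k)" for t k
    by (simp add: V_def K u_cnj q_cnj dispersion_uminus)
  have u': "((\<lambda>t. u t k) has_vector_derivative V (u t) k) (at t)" for t k
  proof (cases "k \<in> K")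
    case True
    have d: "((\<lambda>t. ev (x t) k) has_vector_derivative V (u t) k) (at t)" for k
      using bounded_linear.has_vector_derivative[OF evl x(2)[of t], of k] by (simp add: F Vu)
    have "((\<lambda>t. (ev (x t) k + cnj (ev (x t) (- k))) / 2) has_vector_derivative (V (u t) k + cnj (V (u t) (- k))) / 2) (at t)"
      by (intro bounded_linear.has_vector_derivative[OF bounded_linear_divide] has_vector_derivative_add
          d bounded_linear.has_vector_derivative[OF bounded_linear_cnj])
    then show ?thesis using True by (simp add: u_def sy_def V_cnj)
  next
    case False then show ?thesis by (simp add: u_def V_def)
  qed
  define y where "y t = (\<Sum>k\<in>K. (cmod (u t k))\<^sup>2)" for t
  have y': "(y has_real_derivative (\<Sum>k\<in>K. 2 * Re (cnj (u t k) * V (u t) k))) (at t)" for t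
    unfolding y_def
  proof (intro DERIV_sum)
    fix k
    have re: "((\<lambda>t. Re (u t k)) has_real_derivative Re (V (u t) k)) (at t)"
      and im: "((\<lambda>t. Im (u t k)) has_real_derivative Im (V (u t) k)) (at t)"
      using bounded_linear.has_vector_derivative[OF bounded_linear_Re u'[of k t]]
        bounded_linear.has_vector_derivative[OF bounded_linear_Im u'[of k t]]
      by (simp_all add: has_real_derivative_iff_has_vector_derivative)
    have "((\<lambda>t. (Re (u t k))\<^sup>2 + (Im (u t k))\<^sup>2) has_real_derivative 2 * Re (cnj (u t k) * V (u t) k)) (at t)"
      by (rule DERIV_cong[OF DERIV_add[OF DERIV_power[OF re, of 2] DERIV_power[OF im, of 2]]]) (simp add: algebra_simps)
    then show "((\<lambda>t. (cmod (u t k))\<^sup>2) has_real_derivative 2 * Re (cnj (u t k) * V (u t) k)) (at t)"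
      by (simp add: cmod_power2)
  qed
  have u_le_y: "(cmod (u t k))\<^sup>2 \<le> y t" for t k
  proof (cases "k \<in> K")
    case True
    then show ?thesis unfolding y_def using member_le_sum[of k K "\<lambda>k. (cmod (u t k))\<^sup>2"] K by auto
  next
    case False then show ?thesis by (auto simp: u_def y_def intro!: sum_nonneg)
  qed
  have q_noclamp: "q (u t) k = (\<Sum>j\<in>K. if k - j \<in> K then u t j * u t (k - j) else 0)" if "y t < r\<^sup>2" for t k
  proof -
    have "cmod (u t k) \<le> r" for k
      by (rule power2_le_imp_le[OF _ r(1)]) (use u_le_y[of t k] that in linarith)
    then show ?thesis by (simp add: q_def clamp_box_id cong: if_cong)
  qed
  have y'0: "(\<Sum>k\<in>K. 2 * Re (cnj (u t k) * V (u t) k)) = 0" if t: "y t < r\<^sup>2" for t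
  proof -
    have "(\<Sum>k\<in>K. cnj (u t k) * V (u t) k) = (\<Sum>k\<in>K. \<i> * of_real (dispersion m k * (cmod (u t k))\<^sup>2)) - 
       \<i> * pi * (\<Sum>k\<in>K. \<Sum>j\<in>K. of_int k * (u t (- k) * (if k - j \<in> K then u t j * u t (k - j) else 0)))"
      unfolding sum_distrib_left sum_subtractf[symmetric]
    proof (rule sum.cong[OF refl])
      fix k assume k: "k \<in> K"
      have "cnj (u t k) * u t k = of_real ((cmod (u t k))\<^sup>2)" by (simp only: complex_norm_square mult.commute)
      then have "cnj (u t k) * (\<i> * dispersion m k * u t k) = \<i> * of_real (dispersion m k * (cmod (u t k))\<^sup>2)"
        by (simp add: mult_ac)
      then show "cnj (u t k) * V (u t) k = \<i> * of_real (dispersion m k * (cmod (u t k))\<^sup>2) -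
       (\<Sum>j\<in>K. \<i> * pi * (of_int k * (u t (- k) * (if k - j \<in> K then u t j * u t (k - j) else 0))))"
        using k by (simp add: V_def q_noclamp[OF t] right_diff_distrib sum_distrib_left[symmetric] u_cnj mult_ac)
    qed
    also have "Re \<dots> = 0" unfolding energy_cancellation[OF K(1,2)] by (simp add: Re_sum)
    finally have e: "Re (\<Sum>k\<in>K. cnj (u t k) * V (u t) k) = 0" .
    have "(\<Sum>k\<in>K. 2 * Re (cnj (u t k) * V (u t) k)) = 2 * Re (\<Sum>k\<in>K. cnj (u t k) * V (u t) k)"
      by (subst Re_sum) (rule sum_distrib_left[symmetric])
    then show ?thesis unfolding e by simp
  qed
  have y0: "y 0 \<le> R"
  proof -
    have "y 0 = (\<Sum>k\<in>K. (cmod (c k))\<^sup>2)" unfolding y_def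
      by (rule sum.cong) (auto simp: u_def sy_def x x0 K c)
    then show ?thesis using finsum_leD[OF R K(1)] by simp
  qed
  have y: "y t = y 0" for t
  proof (rule constant_below_barrier[OF y', where b = "r\<^sup>2"])
    show "(\<Sum>k\<in>K. 2 * Re (cnj (u t k) * V (u t) k)) = 0" if "y t < r\<^sup>2" for t by (rule y'0[OF that])
    show "y 0 < r\<^sup>2" using y0 r(2) by simp
  qed
  show ?thesis
  proof (rule that)
    show "fourier_system m K u UNIV"
      unfolding fourier_system_def
    proof (intro conjI ballI allI impI K)
      fix t k
      show "k \<notin> K \<Longrightarrow> u t k = 0" by (simp add: u_def)
      assume k: "k \<in> K"
      have "(\<Sum>\<^sub>\<infinity>j. u t j * u t (k - j)) = (\<Sum>\<^sub>\<infinity>j\<in>K. if k - j \<in> K then u t j * u t (k - j) else 0)"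
        by (rule infsum_cong_neutral) (auto simp: u_def)
      also have "\<dots> = q (u t) k" using y[of t] y0 r by (simp add: q_noclamp K)
      finally show "((\<lambda>s. u s k) has_vector_derivative kawahara_rhs m (u t) k) (at t)"
        using u'[of k t] k by (simp add: kawahara_rhs_def V_def)
    qed
    show "u 0 k = c k" if "k \<in> K" for k using that by (simp add: u_def sy_def x x0 K c)
    show "u t (- k) = cnj (u t k)" for t k by (rule u_cnj)
    show "l2_le (u t) R" for t
      unfolding finsum_le_def
    proof (intro allI impI)
      fix G :: "int set" assume G: "finite G"
      have "(\<Sum>k\<in>G. (cmod (u t k))\<^sup>2) \<le> (\<Sum>k\<in>G \<union> K. (cmod (u t k))\<^sup>2)" using G K by (intro sum_mono2) auto
      also have "\<dots> = y t" unfolding y_def using G K by (intro sum.mono_neutral_right) (auto simp: u_def)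
      finally show "(\<Sum>k\<in>G. (cmod (u t k))\<^sup>2) \<le> R" using y[of t] y0 by simp
    qed
  qed
qed

section \<open>Passage to the limit\<close>

text \<open>Tannery's theorem for unordered sums and arbitrary filters; the filter of the compactness argument below
  is not given by a sequence.\<close>
lemma infsum_tendsto_dominated:
  fixes f :: "'n \<Rightarrow> int \<Rightarrow> 'a::banach"
  assumes lim: "\<And>j. ((\<lambda>n. f n j) \<longlongrightarrow> g j) G" and G: "G \<noteq> bot"
    and bd: "\<forall>\<^sub>F n in G. \<forall>j. norm (f n j) \<le> h j" and h: "finsum_le h S"
  shows "((\<lambda>n. \<Sum>\<^sub>\<infinity>j. f n j) \<longlongrightarrow> (\<Sum>\<^sub>\<infinity>j. g j)) G"
proof -
  define Y where "Y = {n. \<forall>j. norm (f n j) \<le> h j}"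
  have evY: "\<forall>\<^sub>F n in G. n \<in> Y" using bd by (simp add: Y_def)
  have h0: "0 \<le> h j" for j
    using eventually_happens'[OF G bd] order_trans[OF norm_ge_zero] by blast
  have "finsum_le (\<lambda>j. norm (h j)) S" using h h0 by (simp add: finsum_le_def)
  then have hs: "h summable_on UNIV" by (rule finsum_le_summable)
  have gb: "norm (g j) \<le> h j" for j
    by (rule tendsto_upperbound[OF tendsto_norm[OF lim] _ G]) (use bd in \<open>auto elim: eventually_mono\<close>)
  have gs: "g summable_on UNIV"
    by (rule finsum_le_summable[of _ S], rule finsum_le_mono[OF h gb]) simp
  show ?thesis
  proof (rule swap_uniform_limit'[where F = "finite_subsets_at_top UNIV" and S = Y])
    show "\<forall>\<^sub>F F in finite_subsets_at_top UNIV. ((\<lambda>n. \<Sum>j\<in>F. f n j) \<longlongrightarrow> (\<Sum>j\<in>F. g j)) G"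
      by (intro always_eventually allI tendsto_sum lim)
    show "((\<lambda>F. \<Sum>j\<in>F. g j) \<longlongrightarrow> (\<Sum>\<^sub>\<infinity>j. g j)) (finite_subsets_at_top UNIV)"
      using has_sum_infsum[OF gs] by (simp add: has_sum_def)
    show "uniform_limit Y (\<lambda>F n. \<Sum>j\<in>F. f n j) (\<lambda>n. \<Sum>\<^sub>\<infinity>j. f n j) (finite_subsets_at_top UNIV)"
      using Weierstrass_m_test_general[where f = "\<lambda>j n. f n j" and Y = Y and X = UNIV and M = h] hs by (auto simp: Y_def)
  qed (use evY in auto)
qed

text \<open>Tychonoff's theorem gives a cluster point in the product topology. Intersecting the filter of its neighbourhoods with
  the sequence yields a filter along which all coordinates converge, which takes the place of a diagonal subsequence.\<close>
lemma pointwise_cluster_point: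
  fixes X :: "nat \<Rightarrow> 'i \<Rightarrow> complex"
  assumes "\<And>n i. cmod (X n i) \<le> B"
  obtains x G where "G \<noteq> bot" "G \<le> sequentially" "\<And>i. ((\<lambda>n. X n i) \<longlongrightarrow> x i) G"
proof -
  have "compactin (product_topology (\<lambda>_. euclidean) UNIV) (PiE UNIV (\<lambda>_::'i. cball (0::complex) B))"
    by (subst compactin_PiE) simp
  then have c: "compact (PiE UNIV (\<lambda>_::'i. cball (0::complex) B))"
    by (simp add: euclidean_product_topology)
  have "\<forall>\<^sub>F y in filtermap X sequentially. y \<in> PiE UNIV (\<lambda>_. cball 0 B)"
    using assms by (simp add: eventually_filtermap PiE_iff)
  then obtain x where x: "inf (nhds x) (filtermap X sequentially) \<noteq> bot"
    using c unfolding compact_filter by (metis filtermap_bot_iff sequentially_bot)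
  define G where "G = inf sequentially (filtercomap X (nhds x))"
  have "G \<noteq> bot"
  proof
    assume "G = bot"
    then have "\<forall>\<^sub>F n in G. False" by simp
    then obtain P Q where P: "eventually P sequentially" and Q: "eventually Q (filtercomap X (nhds x))" and PQ: "\<And>n. P n \<Longrightarrow> Q n \<Longrightarrow> False"
      unfolding G_def eventually_inf by auto
    from Q obtain Q' where Q': "eventually Q' (nhds x)" "\<And>n. Q' (X n) \<Longrightarrow> Q n" unfolding eventually_filtercomap by auto
    have "eventually (\<lambda>y. \<not> Q' y) (filtermap X sequentially)"
      unfolding eventually_filtermap using P by (rule eventually_mono) (use Q' PQ in blast)
    then have "eventually (\<lambda>y. False) (inf (nhds x) (filtermap X sequentially))"
      using Q'(1) unfolding eventually_inf by blast
    with x show False by (simp add: eventually_False)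
  qed
  moreover have "G \<le> sequentially" by (simp add: G_def)
  moreover have "((\<lambda>n. X n i) \<longlongrightarrow> x i) G" for i
  proof -
    have X: "(X \<longlongrightarrow> x) G" unfolding G_def by (rule filterlim_mono[OF filterlim_filtercomap]) auto
    show ?thesis
    proof (rule topological_tendstoI)
      fix A :: "complex set" assume A: "open A" "x i \<in> A"
      have "open ((\<lambda>f :: 'i \<Rightarrow> complex. f i) -` A)"
        by (rule open_vimage[OF A(1) continuous_on_product_coordinates])
      then have "\<forall>\<^sub>F n in G. X n \<in> (\<lambda>f. f i) -` A" using A(2) by (intro topological_tendstoD[OF X]) auto
      then show "\<forall>\<^sub>F n in G. X n i \<in> A" by simp
    qed
  qed
  ultimately show ?thesis by (rule that)
qed

lemma fourier_system_subset: "fourier_system m K u I \<Longrightarrow> J \<subseteq> I \<Longrightarrow> fourier_system m K u J"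
  unfolding fourier_system_def by (meson has_vector_derivative_within_subset subsetD)

lemma dispersion_bound: "\<bar>dispersion m k\<bar> * inv_abs k ^ 5 \<le> (2 * pi) ^ 5 + (2 * pi) ^ 3 + \<bar>m\<bar> * (2 * pi)"
proof (cases "k = 0")
  case True then show ?thesis by simp
next
  case False
  define x where "x = \<bar>real_of_int k\<bar>"
  have x1: "1 \<le> x" using False by (simp add: x_def)
  have "\<bar>dispersion m k\<bar> \<le> \<bar>(2 * pi * k) ^ 5\<bar> + \<bar>(2 * pi * k) ^ 3\<bar> + \<bar>m * (2 * pi * k)\<bar>"
    unfolding dispersion_def by linarith
  also have "\<dots> = (2 * pi) ^ 5 * x ^ 5 + (2 * pi) ^ 3 * x ^ 3 + \<bar>m\<bar> * (2 * pi) * x ^ 1"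
    by (simp add: x_def abs_mult power_mult_distrib power_abs)
  also have "\<dots> \<le> (2 * pi) ^ 5 * x ^ 5 + (2 * pi) ^ 3 * x ^ 5 + \<bar>m\<bar> * (2 * pi) * x ^ 5"
    using x1 by (intro add_mono mult_left_mono power_increasing) auto
  also have "\<dots> = ((2 * pi) ^ 5 + (2 * pi) ^ 3 + \<bar>m\<bar> * (2 * pi)) * x ^ 5" by (simp add: algebra_simps)
  finally have "\<bar>dispersion m k\<bar> * inv_abs k ^ 5 \<le> ((2 * pi) ^ 5 + (2 * pi) ^ 3 + \<bar>m\<bar> * (2 * pi)) * x ^ 5 * inv_abs k ^ 5"
    by (intro mult_right_mono) auto
  also have "\<dots> = ((2 * pi) ^ 5 + (2 * pi) ^ 3 + \<bar>m\<bar> * (2 * pi)) * (x * inv_abs k) ^ 5" by (simp only: power_mult_distrib mult.assoc)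
  finally show ?thesis using abs_mult_inv_abs[OF False] by (simp add: x_def)
qed

lemma kawahara_rhs_nonlinear_bound:
  assumes "2 \<le> p" "\<And>j. cmod (a j) \<le> A * inv_abs j ^ p"
  shows "cmod (\<i> * (pi * k) * (\<Sum>\<^sub>\<infinity>j. a j * a (k - j))) \<le> pi * A\<^sup>2 * (2 ^ p * 8) * inv_abs k ^ (p - 1)"
proof (cases "k = 0")
  case False
  have "cmod (\<Sum>\<^sub>\<infinity>j. a j * a (k - j)) \<le> A\<^sup>2 * (2 ^ p * 8 * inv_abs k ^ p)"
    by (rule finsum_le_norm_infsum[OF finsum_le_convolution_decay[OF assms(1) False assms(2)]])
  then have "cmod (\<i> * (pi * k) * (\<Sum>\<^sub>\<infinity>j. a j * a (k - j))) \<le> pi * \<bar>real_of_int k\<bar> * (A\<^sup>2 * (2 ^ p * 8 * inv_abs k ^ p))"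
    unfolding norm_mult[of _ "infsum _ _"] by (simp add: norm_mult mult.assoc mult_left_mono)
  also have "inv_abs k ^ p = inv_abs k * inv_abs k ^ (p - 1)" using assms(1) by (cases p) auto
  also have "pi * \<bar>real_of_int k\<bar> * (A\<^sup>2 * (2 ^ p * 8 * (inv_abs k * inv_abs k ^ (p - 1)))) = pi * A\<^sup>2 * (2 ^ p * 8) * inv_abs k ^ (p - 1) * (\<bar>real_of_int k\<bar> * inv_abs k)"
    by (simp only: mult_ac)
  finally show ?thesis using abs_mult_inv_abs[OF False] by simp
qed simp

text \<open>Decay of order 5 exactly compensates the symbol of order 5, so the time derivatives of the coefficients
  are bounded uniformly in the frequency.\<close>
lemma kawahara_rhs_bound:
  assumes a: "\<And>j. cmod (a j) \<le> A * inv_abs j ^ 5"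
  shows "cmod (kawahara_rhs m a k) \<le> ((2 * pi) ^ 5 + (2 * pi) ^ 3 + \<bar>m\<bar> * (2 * pi)) * A + pi * A\<^sup>2 * 256"
proof -
  have A: "0 \<le> A" using a[of 1] order_trans[OF norm_ge_zero] by (auto simp: inv_abs_def)
  have "cmod (kawahara_rhs m a k) \<le> cmod (\<i> * dispersion m k * a k) + cmod (\<i> * (pi * k) * (\<Sum>\<^sub>\<infinity>j. a j * a (k - j)))"
    unfolding kawahara_rhs_def by (rule norm_triangle_ineq4)
  also have "\<dots> \<le> ((2 * pi) ^ 5 + (2 * pi) ^ 3 + \<bar>m\<bar> * (2 * pi)) * A + pi * A\<^sup>2 * 256"
  proof (rule add_mono)
    have "cmod (\<i> * dispersion m k * a k) \<le> \<bar>dispersion m k\<bar> * (A * inv_abs k ^ 5)" using a[of k] by (simp add: norm_mult mult_left_mono)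
    also have "\<dots> = (\<bar>dispersion m k\<bar> * inv_abs k ^ 5) * A" by simp
    also have "\<dots> \<le> ((2 * pi) ^ 5 + (2 * pi) ^ 3 + \<bar>m\<bar> * (2 * pi)) * A"
      by (intro mult_right_mono dispersion_bound A)
    finally show "cmod (\<i> * dispersion m k * a k) \<le> ((2 * pi) ^ 5 + (2 * pi) ^ 3 + \<bar>m\<bar> * (2 * pi)) * A" .
    have "cmod (\<i> * (pi * k) * (\<Sum>\<^sub>\<infinity>j. a j * a (k - j))) \<le> pi * A\<^sup>2 * (2 ^ 5 * 8) * inv_abs k ^ (5 - 1)"
      by (rule kawahara_rhs_nonlinear_bound[OF _ a]) simp
    also have "\<dots> \<le> pi * A\<^sup>2 * (2 ^ 5 * 8) * 1" by (intro mult_left_mono power_le_one) auto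
    finally show "cmod (\<i> * (pi * k) * (\<Sum>\<^sub>\<infinity>j. a j * a (k - j))) \<le> pi * A\<^sup>2 * 256" by simp
  qed
  finally show ?thesis .
qed

lemma kawahara_rhs_difference:
  assumes a: "\<And>j. cmod (a j) \<le> A * inv_abs j ^ 2" and c: "\<And>j. cmod (c j) \<le> A * inv_abs j ^ 2"
    and S: "\<And>j. cmod (a j - c j) \<le> S"
  shows "cmod (kawahara_rhs m a k - kawahara_rhs m c k) \<le> (\<bar>dispersion m k\<bar> + pi * \<bar>real_of_int k\<bar> * (8 * A)) * S"
proof -
  have s: "(\<lambda>j. e j * e (k - j)) summable_on UNIV" if "\<And>j. cmod (e j) \<le> A * inv_abs j ^ 2" for e
    using finsum_le_rotated_rhs[OF l2_le_of_decay[OF that], of k 0] by (intro finsum_le_summable) simp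
  have q: "cmod ((\<Sum>\<^sub>\<infinity>j. a j * a (k - j)) - (\<Sum>\<^sub>\<infinity>j. c j * c (k - j))) \<le> 8 * A * S"
    by (rule infsum_difference_bound[OF s[OF a] s[OF c] finsum_le_product_difference[OF a c S]])
  have "kawahara_rhs m a k - kawahara_rhs m c k = \<i> * dispersion m k * (a k - c k) - \<i> * (pi * k) * ((\<Sum>\<^sub>\<infinity>j. a j * a (k - j)) - (\<Sum>\<^sub>\<infinity>j. c j * c (k - j)))"
    by (simp add: kawahara_rhs_def algebra_simps)
  also have "cmod \<dots> \<le> \<bar>dispersion m k\<bar> * cmod (a k - c k) + pi * \<bar>real_of_int k\<bar> * cmod ((\<Sum>\<^sub>\<infinity>j. a j * a (k - j)) - (\<Sum>\<^sub>\<infinity>j. c j * c (k - j)))"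
    by (rule order_trans[OF norm_triangle_ineq4]) (simp add: norm_mult)
  also have "\<dots> \<le> \<bar>dispersion m k\<bar> * S + pi * \<bar>real_of_int k\<bar> * (8 * A * S)"
    by (intro add_mono mult_left_mono S q) auto
  finally show ?thesis by (simp add: algebra_simps)
qed

text \<open>The coefficients are Lipschitz in time uniformly in the frequency, so the right hand side at a fixed frequency is
  Lipschitz as well. The estimate involves finitely many times only and therefore passes to
  pointwise limits.\<close>
lemma fourier_system_taylor:
  assumes u: "fourier_system m K u {-\<tau>..\<tau>}" and b: "\<And>s k. \<bar>s\<bar> \<le> \<tau> \<Longrightarrow> cmod (u s k) \<le> M * inv_abs k ^ 5"
    and k: "k \<in> K" and st: "\<bar>s\<bar> \<le> \<tau>" "\<bar>t\<bar> \<le> \<tau>"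
  shows "cmod (u s k - u t k - (s - t) *\<^sub>R kawahara_rhs m (u t) k) \<le>
    (\<bar>dispersion m k\<bar> + pi * \<bar>real_of_int k\<bar> * (8 * M)) * (((2 * pi) ^ 5 + (2 * pi) ^ 3 + \<bar>m\<bar> * (2 * pi)) * M + pi * M\<^sup>2 * 256) * \<bar>s - t\<bar>\<^sup>2"
proof -
  define E where "E = ((2 * pi) ^ 5 + (2 * pi) ^ 3 + \<bar>m\<bar> * (2 * pi)) * M + pi * M\<^sup>2 * 256"
  define C where "C = \<bar>dispersion m k\<bar> + pi * \<bar>real_of_int k\<bar> * (8 * M)"
  have M: "0 \<le> M" using b[OF st(1), of 1] order_trans[OF norm_ge_zero] by (auto simp: inv_abs_def)
  have C: "0 \<le> C" using M by (simp add: C_def)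
  have E: "0 \<le> E" unfolding E_def using M by (intro add_nonneg_nonneg mult_nonneg_nonneg) auto
  have b2: "cmod (u r j) \<le> M * inv_abs j ^ 2" if "\<bar>r\<bar> \<le> \<tau>" for r j
    using b[OF that, of j] mult_left_mono[OF inv_abs_power_le_2[of 5 j] M] by linarith
  have lip: "cmod (u x j - u t j) \<le> E * \<bar>x - t\<bar>" if x: "\<bar>x\<bar> \<le> \<tau>" for x j
  proof (cases "j \<in> K")
    case True
    show ?thesis
    proof (rule vector_mean_value_bound[where S = "{-\<tau>..\<tau>}"])
      fix r assume r: "r \<in> {-\<tau>..\<tau>}"
      show "((\<lambda>s. u s j) has_vector_derivative kawahara_rhs m (u r) j) (at r within {-\<tau>..\<tau>})"
        using u True r by (simp add: fourier_system_def)
      show "cmod (kawahara_rhs m (u r) j) \<le> E" unfolding E_def by (rule kawahara_rhs_bound[OF b]) (use r in auto)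
    qed (use x st in auto)
  next
    case False
    have "x \<in> {-\<tau>..\<tau>}" "t \<in> {-\<tau>..\<tau>}" using x st by auto
    then show ?thesis using u False E by (simp add: fourier_system_def)
  qed
  define S where "S = closed_segment t s"
  have S: "\<bar>x\<bar> \<le> \<tau>" "\<bar>x - t\<bar> \<le> \<bar>s - t\<bar>" if "x \<in> S" for x
    using that st unfolding S_def closed_segment_eq_real_ivl by (auto split: if_splits)
  have "norm (u s k - u t k - (s - t) *\<^sub>R kawahara_rhs m (u t) k) \<le> norm (s - t) * (C * (E * \<bar>s - t\<bar>))"
  proof (rule vector_differentiable_bound_linearization[where S = S])
    fix x assume x: "x \<in> S"
    have *: "y \<in> {-\<tau>..\<tau>}" if "y \<in> S" for y
    proof -
      have "- \<tau> \<le> y \<and> y \<le> \<tau>" using S(1)[OF that] by linarith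
      then show ?thesis by simp
    qed
    have Sx: "x \<in> {-\<tau>..\<tau>}" "S \<subseteq> {-\<tau>..\<tau>}" using * x by blast+
    show "((\<lambda>s. u s k) has_vector_derivative kawahara_rhs m (u x) k) (at x within S)"
      by (rule has_vector_derivative_within_subset[where S = "{-\<tau>..\<tau>}"])
         (use u k Sx in \<open>auto simp: fourier_system_def\<close>)
    have "cmod (kawahara_rhs m (u x) k - kawahara_rhs m (u t) k) \<le> C * (E * \<bar>x - t\<bar>)"
      unfolding C_def using S[OF x] st by (intro kawahara_rhs_difference b2 lip) auto
    also have "\<dots> \<le> C * (E * \<bar>s - t\<bar>)" using S(2)[OF x] C E by (intro mult_left_mono) auto
    finally show "norm (kawahara_rhs m (u x) k - kawahara_rhs m (u t) k) \<le> C * (E * \<bar>s - t\<bar>)" .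
  qed (auto simp: S_def)
  then show ?thesis unfolding C_def[symmetric] E_def[symmetric] by (simp add: power2_eq_square mult_ac)
qed

lemma has_vector_derivative_quadratic_bound:
  fixes f :: "real \<Rightarrow> 'a::real_normed_vector"
  assumes "0 < e" "\<And>s. \<bar>s - t\<bar> < e \<Longrightarrow> norm (f s - f t - (s - t) *\<^sub>R d) \<le> C * \<bar>s - t\<bar>\<^sup>2"
  shows "(f has_vector_derivative d) (at t)"
  unfolding has_vector_derivative_def
proof (rule has_derivativeI_sandwich[OF assms(1)])
  show "((\<lambda>s. C * \<bar>s - t\<bar>) \<longlongrightarrow> 0) (at t)"
    by (rule tendsto_eq_intros refl | simp)+
  fix s assume "s \<noteq> t" "dist s t < e"
  then show "norm (f s - f t - (s - t) *\<^sub>R d) / norm (s - t) \<le> C * \<bar>s - t\<bar>"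
    using assms(2)[of s] by (simp add: divide_le_eq power2_eq_square dist_real_def mult.assoc)
qed (rule bounded_linear_scaleR_left)

text \<open>The cluster point inherits the bounds, the symmetry and the initial values of the Galerkin solutions. The right hand
  side converges by domination, and the Taylor estimate identifies it as the derivative.\<close>
theorem meanfree_existence:
  fixes c :: "int \<Rightarrow> complex"
  assumes cnj: "\<And>k. c (- k) = cnj (c k)" and c0: "c 0 = 0" and R: "l2_le c R"
    and A: "\<And>k. cmod (c k) \<le> A * inv_abs k ^ 5"
  obtains u where "fourier_system m (UNIV - {0}) u UNIV" "u 0 = c" "\<And>t k. u t (- k) = cnj (u t k)"
    "\<And>\<tau>. \<exists>D\<ge>0. \<forall>t k. \<bar>t\<bar> \<le> \<tau> \<longrightarrow> cmod (u t k) \<le> cmod (c k) + D * inv_abs k ^ 6"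
proof -
  have R0: "0 \<le> R" by (rule finsum_le_nonneg[OF R])
  have A0: "0 \<le> A" using A[of 1] order_trans[OF norm_ge_zero] by (auto simp: inv_abs_def)
  define K where "K n = {- int n..int n} - {0}" for n
  have "\<exists>u. fourier_system m (K n) u UNIV \<and> (\<forall>k\<in>K n. u 0 k = c k) \<and> (\<forall>t k. u t (- k) = cnj (u t k)) \<and> (\<forall>t. l2_le (u t) R)" for n
  proof -
    have "finite (K n)" "- k \<in> K n \<longleftrightarrow> k \<in> K n" "0 \<notin> K n" for k by (auto simp: K_def)
    from galerkin_solution[OF this cnj R, of m] show ?thesis by metis
  qed
  then obtain U where U: "\<And>n. fourier_system m (K n) (U n) UNIV" "\<And>n k. k \<in> K n \<Longrightarrow> U n 0 k = c k"
    "\<And>n t k. U n t (- k) = cnj (U n t k)" "\<And>n t. l2_le (U n t) R"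
    by metis
  have U0: "U n t k = 0" if "k \<notin> K n" for n t k using U(1)[of n] that by (simp add: fourier_system_def)
  have Uc: "cmod (U n 0 k) \<le> cmod (c k)" for n k using U(2)[of k n] U0[of k n 0] by (cases "k \<in> K n") auto
  have "\<exists>D\<ge>0. \<forall>n t k. \<bar>t\<bar> \<le> \<tau> \<longrightarrow> cmod (U n t k) \<le> cmod (c k) + D * inv_abs k ^ 6" for \<tau>
  proof (cases "0 \<le> \<tau>")
    case True
    from a_priori_decay[OF this R0 A0] obtain D where D: "0 \<le> D"
      "\<And>K v t0 s k. rotated_system K v {t0 - \<tau>..t0 + \<tau>} \<Longrightarrow> (\<And>s. s \<in> {t0 - \<tau>..t0 + \<tau>} \<Longrightarrow> l2_le (v s) R) \<Longrightarrow>
       (\<And>k. cmod (v t0 k) \<le> A * inv_abs k ^ 5) \<Longrightarrow> s \<in> {t0 - \<tau>..t0 + \<tau>} \<Longrightarrow>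
       cmod (v s k - v t0 k) \<le> D * inv_abs k ^ 6" by blast
    have "cmod (U n t k) \<le> cmod (c k) + D * inv_abs k ^ 6" if "\<bar>t\<bar> \<le> \<tau>" for n t k
    proof -
      have "cmod (rotate_phase m (U n) t k - rotate_phase m (U n) 0 k) \<le> D * inv_abs k ^ 6"
      proof (rule D(2)[where K = "K n" and ?t0.0 = 0])
        show "rotated_system (K n) (rotate_phase m (U n)) {0 - \<tau>..0 + \<tau>}" by (rule fourier_system_imp_rotated_system[OF fourier_system_subset[OF U(1)]]) simp
        show "l2_le (rotate_phase m (U n) s) R" for s using U(4)[of n s] by simp
        show "cmod (rotate_phase m (U n) 0 k) \<le> A * inv_abs k ^ 5" for k using order_trans[OF Uc A] by simp
      qed (use that in auto)
      then have "cmod (rotate_phase m (U n) t k) \<le> cmod (rotate_phase m (U n) 0 k) + D * inv_abs k ^ 6"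
        using norm_triangle_ineq2[of "rotate_phase m (U n) t k" "rotate_phase m (U n) 0 k"] by linarith
      then show ?thesis using Uc[of n k] by simp
    qed
    with D(1) show ?thesis by blast
  next
    case False then show ?thesis by (intro exI[of _ 0]) auto
  qed
  then have "\<forall>\<tau>. \<exists>D. 0 \<le> D \<and> (\<forall>n t k. \<bar>t\<bar> \<le> \<tau> \<longrightarrow> cmod (U n t k) \<le> cmod (c k) + D * inv_abs k ^ 6)" by simp
  from choice[OF this] obtain D where
    D': "\<forall>\<tau>. 0 \<le> D \<tau> \<and> (\<forall>n t k. \<bar>t\<bar> \<le> \<tau> \<longrightarrow> cmod (U n t k) \<le> cmod (c k) + D \<tau> * inv_abs k ^ 6)" ..
  have D: "0 \<le> D \<tau>" "\<bar>t\<bar> \<le> \<tau> \<Longrightarrow> cmod (U n t k) \<le> cmod (c k) + D \<tau> * inv_abs k ^ 6" for \<tau> n t k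
    using D' by simp_all
  define M where "M \<tau> = A + D \<tau>" for \<tau>
  have M: "cmod (c k) + D \<tau> * inv_abs k ^ 6 \<le> M \<tau> * inv_abs k ^ 5" for \<tau> k
    using A[of k] mult_left_mono[OF power_decreasing[of 5 6 "inv_abs k"] D(1)[of \<tau>]] by (simp add: M_def algebra_simps)
  have Mn: "0 \<le> M \<tau>" for \<tau> using A0 D(1) by (simp add: M_def)
  have UM: "cmod (U n t k) \<le> M \<tau> * inv_abs k ^ 5" if "\<bar>t\<bar> \<le> \<tau>" for n t k \<tau>
    using D(2)[OF that, of n k] M[of k \<tau>] by linarith
  define X where "X n p = U n (fst p) (snd p)" for n and p :: "real \<times> int"
  have "cmod (X n p) \<le> sqrt R" for n p
    unfolding X_def using finsum_le_term[OF U(4)[of n "fst p"], of "snd p"] by (rule real_le_rsqrt)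
  from pointwise_cluster_point[of X "sqrt R", OF this] obtain x G
    where G: "G \<noteq> bot" "G \<le> sequentially" and x: "\<And>p. ((\<lambda>n. X n p) \<longlongrightarrow> x p) G" by blast
  define u where "u t k = x (t, k)" for t k
  have lim: "((\<lambda>n. U n t k) \<longlongrightarrow> u t k) G" for t k using x[of "(t, k)"] by (simp add: u_def X_def)
  have evK: "\<forall>\<^sub>F n in G. k \<in> K n" if "k \<noteq> 0" for k
  proof -
    have "\<forall>\<^sub>F n in sequentially. k \<in> K n"
      using eventually_ge_at_top[of "nat \<bar>k\<bar>"] by eventually_elim (use that in \<open>auto simp: K_def\<close>)
    then show ?thesis using G(2) by (simp add: filter_leD)
  qed
  have uD: "cmod (u t k) \<le> cmod (c k) + D \<tau> * inv_abs k ^ 6" if "\<bar>t\<bar> \<le> \<tau>" for t k \<tau>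
    by (rule tendsto_upperbound[OF tendsto_norm[OF lim] _ G(1)]) (use D(2)[OF that] in auto)
  have uM: "cmod (u t k) \<le> M \<tau> * inv_abs k ^ 5" if "\<bar>t\<bar> \<le> \<tau>" for t k \<tau>
    using uD[OF that, of k] M[of k \<tau>] by linarith
  have u0: "u t 0 = 0" for t
    using uM[of t "\<bar>t\<bar>" 0] by simp
  have V: "((\<lambda>n. kawahara_rhs m (U n t) k) \<longlongrightarrow> kawahara_rhs m (u t) k) G" for t k
    unfolding kawahara_rhs_def
  proof (intro tendsto_intros lim infsum_tendsto_dominated[OF _ G(1)])
    define B where "B = M \<bar>t\<bar>"
    show "\<forall>\<^sub>F n in G. \<forall>j. cmod (U n t j * U n t (k - j)) \<le> B * inv_abs j ^ 2 * (B * 1)"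
    proof (intro always_eventually allI)
      fix n j
      have "cmod (U n t j) \<le> B * inv_abs j ^ 2"
        using UM[of t "\<bar>t\<bar>" n j] mult_left_mono[OF inv_abs_power_le_2[of 5 j] Mn[of "\<bar>t\<bar>"]] by (simp add: B_def)
      moreover have "cmod (U n t (k - j)) \<le> B * 1"
        using UM[of t "\<bar>t\<bar>" n "k - j"] mult_left_mono[OF power_le_one[of "inv_abs (k - j)" 5] Mn[of "\<bar>t\<bar>"]] by (simp add: B_def)
      ultimately show "cmod (U n t j * U n t (k - j)) \<le> B * inv_abs j ^ 2 * (B * 1)"
        unfolding norm_mult using Mn by (intro mult_mono) (auto simp: B_def)
    qed
    have "finsum_le (\<lambda>j. (B * B) * inv_abs j ^ 2) ((B * B) * 4)" by (intro finsum_le_cmult finsum_le_inverse_squares) auto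
    then show "finsum_le (\<lambda>j. B * inv_abs j ^ 2 * (B * 1)) ((B * B) * 4)" by (simp add: mult_ac)
  qed
  have der: "((\<lambda>s. u s k) has_vector_derivative kawahara_rhs m (u t) k) (at t)" if k: "k \<noteq> 0" for t k
  proof -
    define \<tau> where "\<tau> = \<bar>t\<bar> + 1"
    define C where "C = (\<bar>dispersion m k\<bar> + pi * \<bar>real_of_int k\<bar> * (8 * M \<tau>)) *
      (((2 * pi) ^ 5 + (2 * pi) ^ 3 + \<bar>m\<bar> * (2 * pi)) * M \<tau> + pi * (M \<tau>)\<^sup>2 * 256)"
    show ?thesis
    proof (rule has_vector_derivative_quadratic_bound[where e = 1 and C = C])
      fix s :: real assume "\<bar>s - t\<bar> < 1"
      then have st: "\<bar>s\<bar> \<le> \<tau>" "\<bar>t\<bar> \<le> \<tau>" by (auto simp: \<tau>_def)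
      have "((\<lambda>n. cmod (U n s k - U n t k - (s - t) *\<^sub>R kawahara_rhs m (U n t) k)) \<longlongrightarrow>
         cmod (u s k - u t k - (s - t) *\<^sub>R kawahara_rhs m (u t) k)) G"
        by (intro tendsto_intros lim V)
      moreover have "\<forall>\<^sub>F n in G. cmod (U n s k - U n t k - (s - t) *\<^sub>R kawahara_rhs m (U n t) k) \<le> C * \<bar>s - t\<bar>\<^sup>2"
        using evK[OF k]
      proof eventually_elim
        case (elim n)
        show ?case unfolding C_def
          by (rule fourier_system_taylor[OF fourier_system_subset[OF U(1)] UM elim st]) auto
      qed
      ultimately show "cmod (u s k - u t k - (s - t) *\<^sub>R kawahara_rhs m (u t) k) \<le> C * \<bar>s - t\<bar>\<^sup>2"
        using G(1) by (rule tendsto_upperbound)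
    qed simp
  qed
  show ?thesis
  proof (rule that)
    show "fourier_system m (UNIV - {0}) u UNIV" unfolding fourier_system_def using der u0 by auto
    show "u 0 = c"
    proof
      fix k show "u 0 k = c k"
      proof (cases "k = 0")
        case False
        have "((\<lambda>n. U n 0 k) \<longlongrightarrow> c k) G"
          by (rule tendsto_eventually) (use evK[OF False] U(2) in \<open>auto elim: eventually_mono\<close>)
        then show ?thesis using tendsto_unique[OF G(1) lim] by blast
      qed (simp add: u0 c0)
    qed
    show "u t (- k) = cnj (u t k)" for t k
      using tendsto_unique[OF G(1) lim[of t "- k"]] tendsto_cnj[OF lim[of t k]] by (simp add: U(3))
    show "\<exists>D\<ge>0. \<forall>t k. \<bar>t\<bar> \<le> \<tau> \<longrightarrow> cmod (u t k) \<le> cmod (c k) + D * inv_abs k ^ 6" for \<tau>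
      using D(1) uD by blast
  qed
qed

section \<open>Uniqueness for the mean-free system\<close>

text \<open>The set of times at which the solutions agree is closed by continuity of the coefficients and open by
  \<open>local_uniqueness\<close>.\<close>
theorem meanfree_uniqueness:
  assumes u: "fourier_system m K u UNIV" and w: "fourier_system m K w UNIV" and eq: "u 0 = w 0"
    and l2: "\<And>t. \<exists>\<delta>>0. \<exists>R. \<forall>s. \<bar>s - t\<bar> \<le> \<delta> \<longrightarrow> l2_le (u s) R \<and> l2_le (w s) R"
    and dec: "\<And>t. \<exists>A. \<forall>k. cmod (u t k) \<le> A * inv_abs k ^ 5"
  shows "u t = w t"
proof -
  define Z where "Z = {t. \<forall>k. u t k = w t k}"
  have cont: "continuous_on UNIV (\<lambda>t. z t k)" if z: "fourier_system m K z UNIV" for z k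
  proof (cases "k \<in> K")
    case True
    then have "isCont (\<lambda>t. z t k) t" for t
      using z unfolding fourier_system_def by (meson UNIV_I has_vector_derivative_continuous)
    then show ?thesis by (intro continuous_at_imp_continuous_on) auto
  next
    case False
    then have "z t k = 0" for t using z by (simp add: fourier_system_def)
    then show ?thesis by (simp only: continuous_on_const)
  qed
  have cl: "closed Z"
    unfolding Z_def by (intro closed_Collect_all closed_Collect_eq cont u w)
  have "\<exists>e>0. ball t e \<subseteq> Z" if t: "t \<in> Z" for t
  proof -
    obtain \<delta> R where \<delta>: "0 < \<delta>" and R: "\<And>s. \<bar>s - t\<bar> \<le> \<delta> \<Longrightarrow> l2_le (u s) R \<and> l2_le (w s) R"
      using l2[of t] by blast
    obtain A where A: "\<And>k. cmod (u t k) \<le> A * inv_abs k ^ 5" using dec[of t] by blast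
    have I: "\<bar>s - t\<bar> \<le> \<delta>" if "s \<in> {t - \<delta>..t + \<delta>}" for s using that by (simp add: abs_le_iff)
    have v: "rotated_system K (rotate_phase m u) {t - \<delta>..t + \<delta>}" "rotated_system K (rotate_phase m w) {t - \<delta>..t + \<delta>}"
      by (intro fourier_system_imp_rotated_system fourier_system_subset[OF u] fourier_system_subset[OF w] subset_UNIV)+
    have l: "l2_le (rotate_phase m u s) R" "l2_le (rotate_phase m w s) R" if "s \<in> {t - \<delta>..t + \<delta>}" for s
      using R[OF I[OF that]] by simp_all
    have A': "cmod (rotate_phase m u t k) \<le> A * inv_abs k ^ 5" for k using A by simp
    have e: "rotate_phase m w t = rotate_phase m u t" using t by (simp add: fun_eq_iff rotate_phase_def Z_def)
    obtain d where d: "0 < d" "\<And>s. \<bar>s - t\<bar> \<le> d \<Longrightarrow> rotate_phase m u s = rotate_phase m w s"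
      using local_uniqueness[OF v \<delta> l A' e] by blast
    have "s \<in> Z" if "s \<in> ball t d" for s
    proof -
      have "\<bar>s - t\<bar> \<le> d" using that by (simp add: dist_real_def abs_minus_commute)
      then have "rotate_phase m u s k = rotate_phase m w s k" for k using d(2) by metis
      then show ?thesis by (simp add: Z_def rotate_phase_def)
    qed
    then show ?thesis using d(1) by blast
  qed
  then have op: "open Z" unfolding open_contains_ball by blast
  have "Z = {} \<or> Z = UNIV" by (rule iffD1[OF clopen conjI[OF cl op]])
  moreover have "0 \<in> Z" using eq by (simp add: Z_def)
  ultimately have "t \<in> Z" by (metis UNIV_I empty_iff)
  then show ?thesis by (simp add: Z_def fun_eq_iff)
qed

section \<open>Fourier coefficients\<close>

text \<open>One period with Lebesgue measure, a probability space.\<close>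
abbreviation circle :: "real measure" where "circle \<equiv> lebesgue_on {0..1}"

lemma finite_measure_circle: "finite_measure circle"
  by (rule finite_measure_lebesgue_on) (simp add: fmeasurableI)

lemma measure_circle: "measure circle (space circle) = 1"
  by (simp add: measure_restrict_space space_restrict_space)

lemma LINT_circle:
  fixes f :: "real \<Rightarrow> 'a::{banach,second_countable_topology}"
  shows "(LINT x:{0..1}|lebesgue. f x) = integral\<^sup>L circle f"
  unfolding set_lebesgue_integral_def by (rule integral_restrict_space[symmetric]) simp

lemma set_integrable_circle:
  fixes f :: "real \<Rightarrow> 'a::{banach,second_countable_topology}"
  shows "set_integrable lebesgue {0..1} f \<longleftrightarrow> integrable circle f"
  unfolding set_integrable_def by (rule integrable_restrict_space[symmetric]) simp

lemma measurable_circle_continuous: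
  fixes f :: "real \<Rightarrow> 'a::{second_countable_topology,real_normed_vector}"
  assumes "continuous_on UNIV f" shows "f \<in> borel_measurable circle"
  using borel_measurable_continuous_onI[OF assms]
  by (intro measurable_restrict_space1 measurable_completion) simp

lemma integrable_circle_bounded:
  fixes f :: "real \<Rightarrow> 'a::{banach,second_countable_topology}"
  assumes "f \<in> borel_measurable circle" "\<And>x. norm (f x) \<le> B"
  shows "integrable circle f"
  by (rule finite_measure.integrable_const_bound[OF finite_measure_circle, where B = B]) (use assms in auto)

lemma integrable_circle_continuous:
  fixes f :: "real \<Rightarrow> 'a::{banach,second_countable_topology}"
  assumes "continuous_on UNIV f" "\<And>x. norm (f x) \<le> B"
  shows "integrable circle f"
  by (rule integrable_circle_bounded[OF measurable_circle_continuous[OF assms(1)] assms(2)])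

lemma integrable_mult_bounded:
  fixes f g :: "real \<Rightarrow> complex"
  assumes f: "integrable circle f" and g: "g \<in> borel_measurable circle" "\<And>x. cmod (g x) \<le> B"
  shows "integrable circle (\<lambda>x. f x * g x)"
proof (rule Bochner_Integration.integrable_bound[of _ "\<lambda>x. B * norm (f x)"])
  show "integrable circle (\<lambda>x. B * norm (f x))" using f by simp
  show "(\<lambda>x. f x * g x) \<in> borel_measurable circle" using f g by measurable
  have "norm (f x * g x) \<le> norm (B * norm (f x))" for x
    using mult_left_mono[OF g(2)[of x], of "cmod (f x)"] order_trans[OF norm_ge_zero g(2)[of x]]
    by (simp add: norm_mult mult.commute)
  then show "AE x in circle. norm (f x * g x) \<le> norm (B * norm (f x))" by simp
qed

definition expk :: "int \<Rightarrow> real \<Rightarrow> complex" where "expk k x = cis (2 * pi * k * x)"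

lemma cmod_expk [simp]: "cmod (expk k x) = 1" by (simp add: expk_def)
lemma continuous_expk [continuous_intros]: "continuous_on S (expk k)"
  unfolding expk_def by (intro continuous_intros)
lemma measurable_expk [measurable]: "expk k \<in> borel_measurable circle"
  by (rule measurable_circle_continuous[OF continuous_expk])
lemma expk_mult: "expk j x * expk k x = expk (j + k) x" by (simp add: expk_def cis_mult algebra_simps)
lemma expk_0 [simp]: "expk 0 x = 1" by (simp add: expk_def)
lemma cnj_expk: "cnj (expk k x) = expk (- k) x" by (simp add: expk_def cis_cnj)

lemma expk_periodic: "expk k (x + 1) = expk k x"
proof -
  have "expk k (x + 1) = expk k x * cis (2 * pi * k)" by (simp add: expk_def cis_mult algebra_simps)
  also have "cis (2 * pi * k) = 1" by (simp add: complex_eq_iff cos_int_2pin sin_int_2pin)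
  finally show ?thesis by simp
qed

definition fourier :: "(real \<Rightarrow> real) \<Rightarrow> int \<Rightarrow> complex" where
  "fourier g k = (LINT x|circle. of_real (g x) * expk (- k) x)"

lemma integrable_mult_expk:
  assumes "integrable circle (g :: real \<Rightarrow> real)"
  shows "integrable circle (\<lambda>x. of_real (g x) * expk k x)"
  by (rule integrable_mult_bounded[where B = 1]) (use assms in auto)

section \<open>A function is determined by its Fourier coefficients\<close>

text \<open>Trigonometric polynomials as a function of the angle, closed under sums by definition and under products by
  induction, hence an algebra to which the Stone-Weierstrass theorem applies.\<close>
inductive trigpoly :: "(real \<Rightarrow> complex) \<Rightarrow> bool" where
  mono: "trigpoly (\<lambda>x. c * cis (of_int k * x))"
| add: "trigpoly f \<Longrightarrow> trigpoly g \<Longrightarrow> trigpoly (\<lambda>x. f x + g x)"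

lemma trigpoly_mult: assumes "trigpoly f" "trigpoly g" shows "trigpoly (\<lambda>x. f x * g x)"
  using assms(1)
proof induction
  case (mono c k)
  show ?case using assms(2)
  proof induction
    case (mono d j)
    have "(\<lambda>x. c * cis (of_int k * x) * (d * cis (of_int j * x))) = (\<lambda>x. (c * d) * cis (of_int (k + j) * x))"
    proof
      fix x :: real
      have "c * cis (of_int k * x) * (d * cis (of_int j * x)) = (c * d) * (cis (of_int k * x) * cis (of_int j * x))"
        by (simp only: mult_ac)
      then show "c * cis (of_int k * x) * (d * cis (of_int j * x)) = (c * d) * cis (of_int (k + j) * x)"
        by (simp add: cis_mult distrib_right)
    qed
    then show ?case using trigpoly.mono by metis
  next
    case (add f g)
    then show ?case using trigpoly.add[OF add.IH] by (simp add: distrib_left)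
  qed
next
  case (add f1 f2)
  then show ?case using trigpoly.add[OF add.IH] by (simp add: distrib_right)
qed

lemma trigpoly_Re: "trigpoly (\<lambda>x. of_real (Re (cis x)))" and trigpoly_Im: "trigpoly (\<lambda>x. of_real (Im (cis x)))"
proof -
  have "trigpoly (\<lambda>x. (1/2) * cis (of_int 1 * x) + (1/2) * cis (of_int (-1) * x))"
    by (intro trigpoly.intros)
  also have "(\<lambda>x. (1/2) * cis (of_int 1 * x) + (1/2) * cis (of_int (-1) * x)) = (\<lambda>x. of_real (Re (cis x)))"
    by (auto simp: fun_eq_iff complex_eq_iff)
  finally show "trigpoly (\<lambda>x. of_real (Re (cis x)))" .
  have "trigpoly (\<lambda>x. (- \<i>/2) * cis (of_int 1 * x) + (\<i>/2) * cis (of_int (-1) * x))"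
    by (intro trigpoly.intros)
  also have "(\<lambda>x. (- \<i>/2) * cis (of_int 1 * x) + (\<i>/2) * cis (of_int (-1) * x)) = (\<lambda>x. of_real (Im (cis x)))"
    by (auto simp: fun_eq_iff complex_eq_iff)
  finally show "trigpoly (\<lambda>x. of_real (Im (cis x)))" .
qed

lemma trigpoly_dense:
  assumes "continuous_on (sphere 0 1) G" "0 < e"
  shows "\<exists>g. trigpoly (\<lambda>x. complex_of_real (g (cis x))) \<and> (\<forall>x. \<bar>G (cis x) - g (cis x)\<bar> < e)"
proof -
  define P where "P g \<longleftrightarrow> continuous_on (sphere 0 1) g \<and> trigpoly (\<lambda>x. complex_of_real (g (cis x)))" for g :: "complex \<Rightarrow> real"
  have "\<exists>g. P g \<and> (\<forall>z\<in>sphere 0 1. \<bar>G z - g z\<bar> < e)"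
  proof (rule Stone_Weierstrass_HOL[where P = P])
    show "P (\<lambda>z. c)" for c using trigpoly.mono[of "of_real c" 0] by (simp add: P_def)
    show "P (\<lambda>z. f z + g z)" if "P f \<and> P g" for f g
      using that trigpoly.add by (auto simp: P_def intro!: continuous_intros)
    show "P (\<lambda>z. f z * g z)" if "P f \<and> P g" for f g
      using that trigpoly_mult by (auto simp: P_def intro!: continuous_intros)
    show "\<exists>f. P f \<and> f z \<noteq> f w" if "z \<in> sphere 0 1 \<and> w \<in> sphere 0 1 \<and> z \<noteq> w" for z w
    proof (cases "Re z = Re w")
      case True
      then have "Im z \<noteq> Im w" using that by (auto simp: complex_eq_iff)
      moreover have "P Im" unfolding P_def using trigpoly_Im by (auto intro!: continuous_intros)
      ultimately show ?thesis by blast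
    next
      case False
      moreover have "P Re" unfolding P_def using trigpoly_Re by (auto intro!: continuous_intros)
      ultimately show ?thesis by blast
    qed
  qed (use assms in \<open>auto simp: P_def\<close>)
  then show ?thesis by (auto simp: P_def)
qed

lemma trigpoly_orthogonal:
  assumes f: "integrable circle f" and z: "\<And>k. fourier f k = 0" and h: "trigpoly h"
  shows "integrable circle (\<lambda>x. of_real (f x) * h (2 * pi * x)) \<and> (LINT x|circle. of_real (f x) * h (2 * pi * x)) = 0"
  using h
proof induction
  case (mono c k)
  have eq: "(\<lambda>x. of_real (f x) * (c * cis (of_int k * (2 * pi * x)))) = (\<lambda>x. c * (of_real (f x) * expk (- (- k)) x))"
    by (auto simp: expk_def mult_ac)
  show ?case unfolding eq using integrable_mult_expk[OF f, of k] z[of "- k"] by (simp add: fourier_def)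
next
  case (add g h)
  then show ?case by (simp add: distrib_left)
qed

text \<open>A function with vanishing coefficients is orthogonal to trigonometric polynomials, hence to their uniform
  limits.\<close>
lemma continuous_orthogonal:
  assumes f: "integrable circle f" and z: "\<And>k. fourier f k = 0" and G: "continuous_on UNIV (G :: complex \<Rightarrow> real)"
    and Gb: "\<And>z. \<bar>G z\<bar> \<le> B"
  shows "integrable circle (\<lambda>x. f x * G (cis (2 * pi * x)))" "(LINT x|circle. f x * G (cis (2 * pi * x))) = 0"
proof -
  have Gc: "continuous_on UNIV (\<lambda>x. G (cis (2 * pi * x)))"
    by (intro continuous_on_compose2[OF G] continuous_intros) auto
  have m: "integrable circle (\<lambda>x. f x * H x)" if "H \<in> borel_measurable circle" "\<And>x. \<bar>H x\<bar> \<le> C" for H C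
  proof (rule Bochner_Integration.integrable_bound[of _ "\<lambda>x. C * norm (f x)"])
    show "integrable circle (\<lambda>x. C * norm (f x))" using f by simp
    show "(\<lambda>x. f x * H x) \<in> borel_measurable circle" using f that by measurable
    have "norm (f x * H x) \<le> norm (C * norm (f x))" for x
      using mult_left_mono[OF that(2)[of x], of "\<bar>f x\<bar>"] order_trans[OF abs_ge_zero that(2)[of x]]
      by (simp add: abs_mult mult.commute)
    then show "AE x in circle. norm (f x * H x) \<le> norm (C * norm (f x))" by simp
  qed
  show I: "integrable circle (\<lambda>x. f x * G (cis (2 * pi * x)))"
    by (rule m[OF measurable_circle_continuous[OF Gc] Gb])
  have "\<bar>LINT x|circle. f x * G (cis (2 * pi * x))\<bar> \<le> e * (LINT x|circle. \<bar>f x\<bar>)" if e: "0 < e" for e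
  proof -
    obtain g where g: "trigpoly (\<lambda>x. complex_of_real (g (cis x)))" "\<And>x. \<bar>G (cis x) - g (cis x)\<bar> < e"
      using trigpoly_dense[OF continuous_on_subset[OF G] e] by auto
    from trigpoly_orthogonal[OF f z g(1)]
    have "integrable circle (\<lambda>x. complex_of_real (f x * g (cis (2 * pi * x))))"
      "(LINT x|circle. complex_of_real (f x * g (cis (2 * pi * x)))) = 0" by simp_all
    then have gi: "integrable circle (\<lambda>x. f x * g (cis (2 * pi * x)))" and g0: "(LINT x|circle. f x * g (cis (2 * pi * x))) = 0"
      unfolding complex_of_real_integrable_eq integral_complex_of_real by simp_all
    have "(LINT x|circle. f x * G (cis (2 * pi * x))) = (LINT x|circle. f x * G (cis (2 * pi * x)) - f x * g (cis (2 * pi * x)))"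
      using I gi g0 by simp
    also have "\<bar>\<dots>\<bar> \<le> (LINT x|circle. e * \<bar>f x\<bar>)"
    proof (rule order_trans[OF integral_abs_bound], rule integral_mono)
      fix x
      have "\<bar>f x * G (cis (2 * pi * x)) - f x * g (cis (2 * pi * x))\<bar> = \<bar>f x\<bar> * \<bar>G (cis (2 * pi * x)) - g (cis (2 * pi * x))\<bar>"
        by (simp add: abs_mult right_diff_distrib[symmetric])
      also have "\<dots> \<le> \<bar>f x\<bar> * e" using g(2)[of "2 * pi * x"] by (intro mult_left_mono) auto
      finally show "\<bar>f x * G (cis (2 * pi * x)) - f x * g (cis (2 * pi * x))\<bar> \<le> e * \<bar>f x\<bar>" by (simp add: mult.commute)
    qed (use I gi f in auto)
    finally show ?thesis by simp
  qed
  note * = this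
  show "(LINT x|circle. f x * G (cis (2 * pi * x))) = 0"
  proof (rule ccontr)
    define J where "J = (LINT x|circle. \<bar>f x\<bar>)"
    define Q where "Q = \<bar>LINT x|circle. f x * G (cis (2 * pi * x))\<bar>"
    assume "\<not> ?thesis"
    then have Q: "0 < Q" by (simp add: Q_def)
    have J: "0 \<le> J" by (simp add: J_def)
    have "0 < Q / (2 * (J + 1))" using Q J by simp
    from *[OF this] have "Q \<le> Q / (2 * (J + 1)) * J" by (simp only: Q_def J_def)
    also have "\<dots> \<le> Q / 2" using Q J by (simp add: field_simps)
    finally show False using Q by simp
  qed
qed

text \<open>The functions \<open>max 0 (1 - n infdist z C)\<close> decrease to the indicator of the closed set \<open>C\<close>.\<close>
lemma closed_set_integral_zero:
  assumes f: "integrable circle f" and z: "\<And>k. fourier f k = 0" and C: "closed C" "C \<noteq> {}"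
  shows "(LINT x|circle. f x * indicator C (cis (2 * pi * x))) = 0"
proof -
  define G where "G n z = max 0 (1 - real n * infdist z C)" for n z
  have Gc: "continuous_on UNIV (G n)" for n unfolding G_def by (intro continuous_intros)
  have Gb: "\<bar>G n z\<bar> \<le> 1" for n z using infdist_nonneg[of z C] by (auto simp: G_def)
  have lim: "(\<lambda>n. G n z) \<longlonglongrightarrow> indicator C z" for z
  proof (cases "z \<in> C")
    case True then show ?thesis by (simp add: G_def)
  next
    case False
    then have d: "0 < infdist z C" using infdist_pos_not_in_closed[OF C] by simp
    then obtain N where N: "1 < real N * infdist z C" using reals_Archimedean3 by blast
    have "\<forall>\<^sub>F n in sequentially. G n z = 0"
      using eventually_ge_at_top[of N]
    proof eventually_elim
      case (elim n)
      have "real N * infdist z C \<le> real n * infdist z C" using elim d by simp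
      with N show ?case by (simp add: G_def)
    qed
    then show ?thesis using False by (simp add: tendsto_eventually)
  qed
  have "(\<lambda>n. LINT x|circle. f x * G n (cis (2 * pi * x))) \<longlonglongrightarrow> (LINT x|circle. f x * indicator C (cis (2 * pi * x)))"
  proof (rule integral_dominated_convergence[where w = "\<lambda>x. \<bar>f x\<bar>"])
    have m: "(\<lambda>x. cis (2 * pi * x)) \<in> circle \<rightarrow>\<^sub>M borel"
      by (rule measurable_circle_continuous) (intro continuous_intros)
    have "C \<in> sets borel" using C(1) by simp
    then have "indicator C \<in> borel_measurable (borel :: complex measure)" by (rule borel_measurable_indicator)
    from measurable_compose[OF m this] show "(\<lambda>x. f x * indicator C (cis (2 * pi * x))) \<in> borel_measurable circle"
      using f by measurable
    show "(\<lambda>x. f x * G n (cis (2 * pi * x))) \<in> borel_measurable circle" for n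
      using continuous_orthogonal(1)[OF f z Gc Gb] by simp
    show "AE x in circle. (\<lambda>n. f x * G n (cis (2 * pi * x))) \<longlonglongrightarrow> f x * indicator C (cis (2 * pi * x))"
      by (intro AE_I2 tendsto_intros lim)
    show "AE x in circle. norm (f x * G n (cis (2 * pi * x))) \<le> \<bar>f x\<bar>" for n
      using mult_left_mono[OF Gb, of "\<bar>f _\<bar>"] by (intro AE_I2) (simp add: abs_mult)
  qed (use f in auto)
  then show ?thesis using continuous_orthogonal(2)[OF f z Gc Gb] by (simp add: LIMSEQ_const_iff)
qed

text \<open>The map \<open>x \<mapsto> cis (2 \<pi> x)\<close> identifies only the endpoints of \<open>[0, 1]\<close>, so the interval is the preimage of its image.\<close>
lemma interval_integral_zero:
  assumes f: "integrable circle f" and z: "\<And>k. fourier f k = 0" and ab: "0 < a" "a \<le> b" "b < 1"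
  shows "integral {a..b} f = 0"
proof -
  define C where "C = (\<lambda>x. cis (2 * pi * x)) ` {a..b}"
  have "compact C" unfolding C_def by (intro compact_continuous_image continuous_intros) auto
  then have C: "closed C" "C \<noteq> {}" using ab by (auto simp: compact_imp_closed C_def)
  have pre: "cis (2 * pi * x) \<in> C \<longleftrightarrow> x \<in> {a..b}" if x: "x \<in> {0..1}" for x
  proof
    assume "cis (2 * pi * x) \<in> C"
    then obtain y where y: "y \<in> {a..b}" "cis (2 * pi * x) = cis (2 * pi * y)" by (auto simp: C_def)
    then have "sin (2 * pi * x) = sin (2 * pi * y) \<and> cos (2 * pi * x) = cos (2 * pi * y)" by (simp add: complex_eq_iff)
    then obtain n :: int where "2 * pi * x = 2 * pi * y + 2 * pi * of_int n" using sin_cos_eq_iff by metis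
    then have "2 * pi * x = 2 * pi * (y + of_int n)" by (simp add: distrib_left)
    then have n: "x = y + of_int n" by simp
    have "-1 < real_of_int n" "real_of_int n < 1" using n x y(1) ab by auto
    then have "n = 0" by linarith
    then show "x \<in> {a..b}" using n y(1) by simp
  qed (auto simp: C_def)
  have "0 = (LINT x|circle. f x * indicator C (cis (2 * pi * x)))" using closed_set_integral_zero[OF f z C] by simp
  also have "\<dots> = (LINT x|circle. indicator {a..b} x *\<^sub>R f x)"
    by (rule Bochner_Integration.integral_cong) (auto simp: space_restrict_space indicator_def pre)
  also have "\<dots> = (LINT x:{a..b}|lebesgue. f x)"
    unfolding set_lebesgue_integral_def
    by (subst integral_restrict_space) (use ab in \<open>auto simp: indicator_def intro!: Bochner_Integration.integral_cong\<close>)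
  also have "\<dots> = integral {a..b} f"
  proof (rule set_lebesgue_integral_eq_integral)
    have "set_integrable lebesgue {0..1} f" using f by (simp add: set_integrable_circle)
    then show "set_integrable lebesgue {a..b} f" by (rule set_integrable_subset) (use ab in auto)
  qed
  finally show ?thesis by simp
qed

text \<open>All integrals over small intervals vanish, and almost everywhere the function is the limit of its averages.\<close>
theorem fourier_uniqueness:
  assumes f: "integrable circle f" and z: "\<And>k. fourier f k = 0"
  shows "negligible {x \<in> {0..1}. f x \<noteq> 0}"
proof -
  define g where "g x = (if x \<in> {0..1} then f x else 0)" for x
  have "f absolutely_integrable_on {0..1}" using f by (simp add: set_integrable_circle)
  then have "f integrable_on {0..1}" by (rule set_lebesgue_integral_eq_integral(1))
  then have "g integrable_on UNIV" unfolding g_def by (simp only: integrable_restrict_UNIV)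
  then have gi: "g integrable_on cbox a b" for a b
    by (rule integrable_on_subcbox) simp
  obtain N where N: "negligible N" "\<And>x e. x \<notin> N \<Longrightarrow> 0 < e \<Longrightarrow> \<exists>d>0. \<forall>h. 0 < h \<and> h < d \<longrightarrow>
      norm (integral (cbox x (x + h *\<^sub>R One)) g /\<^sub>R h ^ DIM(real) - g x) < e"
    using integrable_ccontinuous_explicit[OF gi] by blast
  have "g x = 0" if x: "0 < x" "x < 1" "x \<notin> N" for x
  proof (rule ccontr)
    assume "g x \<noteq> 0"
    then obtain d where d: "0 < d" "\<And>h. 0 < h \<Longrightarrow> h < d \<Longrightarrow> norm (integral (cbox x (x + h *\<^sub>R One)) g /\<^sub>R h ^ DIM(real) - g x) < \<bar>g x\<bar>"
      using N(2)[OF x(3), of "\<bar>g x\<bar>"] by auto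
    have "0 < min d (1 - x)" using d(1) x(2) by simp
    from dense[OF this] obtain h where "0 < h" "h < min d (1 - x)" by blast
    then have h: "0 < h" "h < d" "x + h < 1" by auto
    have "integral {x..x + h} g = integral {x..x + h} f"
      by (rule integral_cong) (use x h in \<open>auto simp: g_def\<close>)
    also have "\<dots> = 0" by (rule interval_integral_zero[OF f z]) (use x h in auto)
    finally show False using d(2)[OF h(1,2)] by simp
  qed
  note gz = this
  have sub: "{x \<in> {0..1}. f x \<noteq> 0} \<subseteq> N \<union> {0, 1}"
  proof (rule subsetI, rule ccontr)
    fix x assume x: "x \<in> {x \<in> {0..1}. f x \<noteq> 0}" "x \<notin> N \<union> {0, 1}"
    then have "0 < x" "x < 1" "x \<notin> N" by auto
    from gz[OF this] x show False by (simp add: g_def)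
  qed
  have "negligible (N \<union> {0, 1})" by (intro negligible_Un N(1) negligible_finite) simp
  then show ?thesis using sub by (rule negligible_subset)
qed

section \<open>Square integrable functions on the circle\<close>

text \<open>Square integrability over one period, for functions that need not be periodic.\<close>
definition sq_integrable :: "(real \<Rightarrow> real) \<Rightarrow> bool" where
  "sq_integrable g \<longleftrightarrow> g \<in> borel_measurable circle \<and> integrable circle (\<lambda>x. (g x)\<^sup>2)"

lemma integrable_mult_sq_integrable:
  assumes "sq_integrable f" "sq_integrable g" shows "integrable circle (\<lambda>x. f x * g x)"
proof (rule Bochner_Integration.integrable_bound[of _ "\<lambda>x. (f x)\<^sup>2 + (g x)\<^sup>2"])
  show "integrable circle (\<lambda>x. (f x)\<^sup>2 + (g x)\<^sup>2)" using assms by (simp add: sq_integrable_def)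
  show "(\<lambda>x. f x * g x) \<in> borel_measurable circle" using assms by (auto simp: sq_integrable_def)
  have "\<bar>f x * g x\<bar> \<le> (f x)\<^sup>2 + (g x)\<^sup>2" for x
    using sum_squares_bound[of "\<bar>f x\<bar>" "\<bar>g x\<bar>"] abs_ge_zero[of "f x * g x"]
    unfolding abs_mult power2_abs by linarith
  then show "AE x in circle. norm (f x * g x) \<le> norm ((f x)\<^sup>2 + (g x)\<^sup>2)" by simp
qed

lemma sq_integrable_const [simp]: "sq_integrable (\<lambda>_. c)"
  unfolding sq_integrable_def using integrable_circle_bounded[of "\<lambda>_. c\<^sup>2" "c\<^sup>2"] by simp

lemma sq_integrable_cmult: "sq_integrable f \<Longrightarrow> sq_integrable (\<lambda>x. c * f x)"
  by (auto simp: sq_integrable_def power_mult_distrib)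

lemma sq_integrable_add: assumes "sq_integrable f" "sq_integrable g" shows "sq_integrable (\<lambda>x. f x + g x)"
  using assms integrable_mult_sq_integrable[OF assms] by (auto simp: sq_integrable_def power2_sum mult.assoc)

lemma sq_integrable_diff: assumes "sq_integrable f" "sq_integrable g" shows "sq_integrable (\<lambda>x. f x - g x)"
  using sq_integrable_add[OF assms(1) sq_integrable_cmult[OF assms(2), of "-1"]] by simp

lemma sq_integrable_integrable: "sq_integrable f \<Longrightarrow> integrable circle f"
  using integrable_mult_sq_integrable[of f "\<lambda>_. 1"] by simp

lemma sq_integrable_abs: "sq_integrable f \<Longrightarrow> sq_integrable (\<lambda>x. \<bar>f x\<bar>)"
  by (auto simp: sq_integrable_def)

text \<open>The quadratic polynomial \<open>t \<mapsto> \<integral> (\<bar>f\<bar> - t \<bar>g\<bar>)\<^sup>2\<close> is nonnegative.\<close>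
lemma cauchy_schwarz:
  assumes f: "sq_integrable f" and g: "sq_integrable g"
  shows "(LINT x|circle. \<bar>f x\<bar> * \<bar>g x\<bar>) \<le> sqrt (LINT x|circle. (f x)\<^sup>2) * sqrt (LINT x|circle. (g x)\<^sup>2)"
proof -
  define A B C where "A = (LINT x|circle. (f x)\<^sup>2)" and "B = (LINT x|circle. (g x)\<^sup>2)" and "C = (LINT x|circle. \<bar>f x\<bar> * \<bar>g x\<bar>)"
  have nn: "0 \<le> A" "0 \<le> B" "0 \<le> C" by (auto simp: A_def B_def C_def intro!: integral_nonneg_AE)
  have quad: "0 \<le> A - 2 * t * C + t\<^sup>2 * B" for t
  proof -
    have i: "integrable circle (\<lambda>x. \<bar>f x\<bar> * \<bar>g x\<bar>)" by (rule integrable_mult_sq_integrable[OF sq_integrable_abs[OF f] sq_integrable_abs[OF g]])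
    have "0 \<le> (LINT x|circle. (\<bar>f x\<bar> - t * \<bar>g x\<bar>)\<^sup>2)" by simp
    also have "(\<lambda>x. (\<bar>f x\<bar> - t * \<bar>g x\<bar>)\<^sup>2) = (\<lambda>x. (f x)\<^sup>2 - 2 * t * (\<bar>f x\<bar> * \<bar>g x\<bar>) + t\<^sup>2 * (g x)\<^sup>2)"
      by (simp add: fun_eq_iff power2_diff power_mult_distrib mult_ac)
    also have "(LINT x|circle. (f x)\<^sup>2 - 2 * t * (\<bar>f x\<bar> * \<bar>g x\<bar>) + t\<^sup>2 * (g x)\<^sup>2) = A - 2 * t * C + t\<^sup>2 * B"
      using f g i by (simp add: A_def B_def C_def sq_integrable_def)
    finally show ?thesis .
  qed
  have "C\<^sup>2 \<le> A * B"
  proof (cases "B = 0")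
    case True
    have "C = 0"
    proof (rule ccontr)
      assume "C \<noteq> 0"
      define t where "t = (A + 1) / (2 * C)"
      have "t * (2 * C) = A + 1" using \<open>C \<noteq> 0\<close> by (simp only: t_def) simp
      then show False using quad[of t] True by (simp add: mult_ac)
    qed
    then show ?thesis using True by simp
  next
    case False
    then have B: "0 < B" using nn by simp
    define q where "q = C / B"
    have qB: "q * B = C" using B by (simp add: q_def)
    have "0 \<le> (A - 2 * q * C + q\<^sup>2 * B) * B" using quad[of q] B by (intro mult_nonneg_nonneg) auto
    also have "\<dots> = A * B - 2 * (q * B) * C + (q * B)\<^sup>2" by (simp only: power2_eq_square ring_distribs mult_ac)
    also have "\<dots> = A * B - C\<^sup>2" unfolding qB by (simp add: power2_eq_square)
    finally show ?thesis by simp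
  qed
  then have "sqrt (C\<^sup>2) \<le> sqrt (A * B)" by (rule real_sqrt_le_mono)
  then show ?thesis using nn by (simp add: real_sqrt_mult A_def B_def C_def)
qed

lemma integral_const_1: "(LINT x|circle. (1::real)) = 1"
  using measure_circle by (simp only: lebesgue_integral_const) simp

lemma L1_le_L2:
  assumes "sq_integrable f" shows "(LINT x|circle. \<bar>f x\<bar>) \<le> sqrt (LINT x|circle. (f x)\<^sup>2)"
proof -
  have "(LINT x|circle. (1::real)\<^sup>2) = 1" by (simp only: one_power2 integral_const_1)
  then show ?thesis using cauchy_schwarz[OF assms sq_integrable_const[of 1]] by (simp only: abs_one mult_1_right real_sqrt_one)
qed

lemma L2_per_iff: "g \<in> L2_per \<longleftrightarrow> (\<forall>x. g (x + 1) = g x) \<and> g \<in> borel_measurable lebesgue \<and> sq_integrable g"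
proof -
  have "g \<in> borel_measurable circle" if "g \<in> borel_measurable lebesgue"
    using that by (rule measurable_restrict_space1)
  then show ?thesis unfolding L2_per_def sq_integrable_def set_integrable_circle power2_abs by blast
qed

lemma L2_norm_circle: "L2_norm g = sqrt (LINT x|circle. (g x)\<^sup>2)"
  by (simp add: L2_norm_def LINT_circle)

lemma L2_per_sq_integrable: "g \<in> L2_per \<Longrightarrow> sq_integrable g" by (simp add: L2_per_iff)

lemma L2_per_diff: "f \<in> L2_per \<Longrightarrow> g \<in> L2_per \<Longrightarrow> (\<lambda>x. f x - g x) \<in> L2_per"
  by (auto simp: L2_per_iff sq_integrable_diff)

lemma L2_per_cmult: "f \<in> L2_per \<Longrightarrow> (\<lambda>x. c * f x) \<in> L2_per"
  by (auto simp: L2_per_iff sq_integrable_cmult)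

text \<open>The exceptional set is the union of countably many translates of its part in one period.\<close>
lemma AE_lebesgue_periodic:
  assumes "\<And>x. P (x + 1) \<longleftrightarrow> P x" and n: "negligible {x \<in> {0..1}. \<not> P x}"
  shows "AE x in lebesgue. P (x::real)"
proof -
  define N where "N = {x \<in> {0..1}. \<not> P x}"
  have PN: "P (x + real n) \<longleftrightarrow> P x" for x n
  proof (induction n)
    case (Suc n)
    have e: "x + real (Suc n) = (x + real n) + 1" by simp
    have "P (x + real (Suc n)) \<longleftrightarrow> P (x + real n + 1)" unfolding e ..
    also have "\<dots> \<longleftrightarrow> P (x + real n)" by (rule assms(1))
    also have "\<dots> \<longleftrightarrow> P x" by (rule Suc.IH)
    finally show ?case .
  qed simp
  have P: "P (x + of_int k) \<longleftrightarrow> P x" for x k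
  proof (cases "0 \<le> k")
    case True then show ?thesis using PN[of x "nat k"] by simp
  next
    case False then show ?thesis using PN[of "x + of_int k" "nat (- k)"] by simp
  qed
  have "{x. \<not> P x} \<subseteq> (\<Union>k::int. (+) (of_int k) ` N)"
  proof
    fix x assume "x \<in> {x. \<not> P x}"
    then have nP: "\<not> P (frac x)" using P[of x "- \<lfloor>x\<rfloor>"] by (simp add: frac_def)
    have "0 \<le> frac x" "frac x \<le> 1" using frac_lt_1[of x] by simp_all
    with nP have "frac x \<in> N" by (simp add: N_def)
    then have "of_int \<lfloor>x\<rfloor> + frac x \<in> (+) (of_int \<lfloor>x\<rfloor>) ` N" by (rule imageI)
    moreover have "of_int \<lfloor>x\<rfloor> + frac x = x" by (simp add: frac_def)
    ultimately have "x \<in> (+) (of_int \<lfloor>x\<rfloor>) ` N" by simp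
    then show "x \<in> (\<Union>k::int. (+) (of_int k) ` N)" by (rule UN_I[OF UNIV_I])
  qed
  moreover have "negligible (\<Union>k::int. (+) (of_int k) ` N)"
    using n by (intro negligible_countable_Union) (auto intro!: negligible_translation simp: N_def)
  ultimately have "negligible {x. \<not> P x}" by (rule negligible_subset[rotated])
  then have "{x. \<not> P x} \<in> null_sets lebesgue" by (simp add: negligible_iff_null_sets)
  then show ?thesis by (rule AE_I') simp
qed

lemma fourier_diff: "integrable circle f \<Longrightarrow> integrable circle g \<Longrightarrow> fourier (\<lambda>x. f x - g x) k = fourier f k - fourier g k"
  using integrable_mult_expk[of f "- k"] integrable_mult_expk[of g "- k"]
  by (simp add: fourier_def left_diff_distrib)

lemma fourier_cmult: "integrable circle f \<Longrightarrow> fourier (\<lambda>x. c * f x) k = of_real c * fourier f k"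
  using integrable_mult_expk[of f "- k"] by (simp add: fourier_def mult.assoc)

theorem fourier_determines:
  assumes "integrable circle f" "integrable circle g" "\<And>x. f (x + 1) = f x" "\<And>x. g (x + 1) = g x"
    and "\<And>k. fourier f k = fourier g k"
  shows "AE x in lebesgue. f x = g x"
proof (rule AE_lebesgue_periodic)
  have "negligible {x \<in> {0..1}. f x - g x \<noteq> 0}"
    by (rule fourier_uniqueness) (use assms in \<open>simp_all add: fourier_diff\<close>)
  then show "negligible {x \<in> {0..1}. f x \<noteq> g x}" by simp
qed (use assms in simp)

lemma AE_circle: "AE x in lebesgue. P x \<Longrightarrow> AE x in circle. P x"
  by (subst AE_restrict_space_iff) (auto elim: eventually_mono)

lemma fourier_bound: assumes "sq_integrable g" shows "cmod (fourier g k) \<le> sqrt (LINT x|circle. (g x)\<^sup>2)"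
proof -
  have "cmod (fourier g k) \<le> (LINT x|circle. cmod (of_real (g x) * expk (- k) x))"
    unfolding fourier_def by (rule integral_norm_bound)
  also have "\<dots> = (LINT x|circle. \<bar>g x\<bar>)" by (simp add: norm_mult)
  finally show ?thesis using L1_le_L2[OF assms] by simp
qed

lemma fourier_uminus: "fourier g (- k) = cnj (fourier g k)"
proof -
  have e: "cnj (of_real (g x) * expk (- k) x) = of_real (g x) * expk (- (- k)) x" for x
    by (simp add: cnj_expk)
  show ?thesis unfolding fourier_def Bochner_Integration.integral_cnj[symmetric] e ..
qed

section \<open>Trigonometric sums and Bessel's inequality\<close>

lemma integral_expk: "(LINT x|circle. expk k x) = (if k = 0 then 1 else 0)"
proof (cases "k = 0")
  case True then show ?thesis using measure_circle by simp
next
  case False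
  define c where "c = 2 * pi * real_of_int k"
  have c: "c \<noteq> 0" using False by (simp add: c_def)
  have "((\<lambda>x. cis (c * x) / (\<i> * c)) has_vector_derivative expk k x) (at x within {0..1})" for x
  proof -
    have "((\<lambda>x. cis (c * x) / (\<i> * c)) has_vector_derivative (\<i> * c * cis (c * x)) / (\<i> * c)) (at x within {0..1})"
      by (intro bounded_linear.has_vector_derivative[OF bounded_linear_divide] has_vector_derivative_cis_linear)
    then show ?thesis using c by (simp add: expk_def c_def)
  qed
  then have "(expk k has_integral (cis (c * 1) / (\<i> * c) - cis (c * 0) / (\<i> * c))) {0..1}"
    by (intro fundamental_theorem_of_calculus) auto
  moreover have "cis c = 1" by (simp add: c_def complex_eq_iff cos_int_2pin sin_int_2pin)
  ultimately have "integral {0..1} (expk k) = 0" by (simp add: integral_unique)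
  moreover have "set_integrable lebesgue {0..1} (expk k)"
    unfolding set_integrable_circle by (rule integrable_circle_continuous[where B = 1]) (auto intro: continuous_intros)
  ultimately show ?thesis using False set_lebesgue_integral_eq_integral(2)[of "{0..1}" "expk k"] by (simp add: LINT_circle)
qed

text \<open>The real part makes this a real function in general; for a symmetric index set and conjugate symmetric
  coefficients it changes nothing.\<close>
definition trig_sum :: "(int \<Rightarrow> complex) \<Rightarrow> int set \<Rightarrow> real \<Rightarrow> real" where
  "trig_sum c F x = Re (\<Sum>k\<in>F. c k * expk k x)"

lemma trig_sum_complex:
  assumes c: "\<And>k. c (- k) = cnj (c k)" and F: "\<And>k. - k \<in> F \<longleftrightarrow> k \<in> F"
  shows "complex_of_real (trig_sum c F x) = (\<Sum>k\<in>F. c k * expk k x)"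
proof -
  have "cnj (\<Sum>k\<in>F. c k * expk k x) = (\<Sum>k\<in>F. c (- k) * expk (- k) x)" by (simp add: cnj_expk c)
  also have "\<dots> = (\<Sum>k\<in>F. c k * expk k x)"
    by (rule sum.reindex_bij_witness[where i = uminus and j = uminus]) (use F in auto)
  finally show ?thesis unfolding trig_sum_def by (metis Reals_cnj_iff of_real_Re)
qed

lemma trig_sum_continuous: "continuous_on UNIV (trig_sum c F)"
  unfolding trig_sum_def by (intro continuous_intros)

lemma trig_sum_sq_integrable: "sq_integrable (trig_sum c F)"
proof -
  define B where "B = (\<Sum>k\<in>F. cmod (c k))"
  have "\<bar>trig_sum c F x\<bar> \<le> B" for x
    unfolding trig_sum_def B_def
    by (rule order_trans[OF abs_Re_le_cmod], rule order_trans[OF norm_sum]) (simp add: norm_mult)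
  then have "norm ((trig_sum c F x)\<^sup>2) \<le> B\<^sup>2" for x using power_mono[of "\<bar>trig_sum c F x\<bar>" B 2] by simp
  then have "integrable circle (\<lambda>x. (trig_sum c F x)\<^sup>2)"
    by (rule integrable_circle_continuous[rotated]) (intro continuous_intros trig_sum_continuous)
  then show ?thesis using measurable_circle_continuous[OF trig_sum_continuous] by (simp add: sq_integrable_def)
qed

lemma trig_sum_periodic: "trig_sum c F (x + 1) = trig_sum c F x" by (simp add: trig_sum_def expk_periodic)

lemma integrable_expk [simp]: "integrable circle (expk k)"
  by (rule integrable_circle_continuous[where B = 1]) (auto intro: continuous_intros)

context
  fixes c :: "int \<Rightarrow> complex" and F :: "int set"
  assumes c: "\<And>k. c (- k) = cnj (c k)" and F: "\<And>k. - k \<in> F \<longleftrightarrow> k \<in> F" and fin: "finite F"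
begin

lemmas trig_sum_as_complex = trig_sum_complex[where c = c and F = F, OF c F]

lemma fourier_trig_sum: "fourier (trig_sum c F) k = (if k \<in> F then c k else 0)"
proof -
  have "fourier (trig_sum c F) k = (LINT x|circle. (\<Sum>j\<in>F. c j * expk (j - k) x))"
    unfolding fourier_def trig_sum_as_complex by (simp add: sum_distrib_right mult.assoc expk_mult)
  also have "\<dots> = (\<Sum>j\<in>F. c j * (if j - k = 0 then 1 else 0))"
    by (subst Bochner_Integration.integral_sum) (simp_all add: integral_expk)
  also have "\<dots> = (if k \<in> F then c k else 0)" using fin by (simp add: if_distrib cong: if_cong)
  finally show ?thesis .
qed

lemma integral_mult_trig_sum:
  assumes "integrable circle g"
  shows "(LINT x|circle. of_real (trig_sum c F x * g x) * expk (- k) x) = (\<Sum>j\<in>F. c j * fourier g (k - j))"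
proof -
  have "of_real (trig_sum c F x * g x) * expk (- k) x = (\<Sum>j\<in>F. c j * (of_real (g x) * expk (- (k - j)) x))" for x
    unfolding of_real_mult trig_sum_as_complex sum_distrib_right
  proof (rule sum.cong[OF refl])
    fix j
    have "expk (- (k - j)) x = expk j x * expk (- k) x" by (simp add: expk_mult)
    then show "c j * expk j x * of_real (g x) * expk (- k) x = c j * (of_real (g x) * expk (- (k - j)) x)"
      by (simp only: mult_ac)
  qed
  then have "(LINT x|circle. of_real (trig_sum c F x * g x) * expk (- k) x) = (LINT x|circle. (\<Sum>j\<in>F. c j * (of_real (g x) * expk (- (k - j)) x)))"
    by (simp only:)
  also have "\<dots> = (\<Sum>j\<in>F. c j * fourier g (k - j))"
    unfolding fourier_def by (subst Bochner_Integration.integral_sum) (use integrable_mult_expk[OF assms] in auto)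
  finally show ?thesis .
qed

lemma integral_real_mult_trig_sum:
  assumes "integrable circle g"
  shows "complex_of_real (LINT x|circle. trig_sum c F x * g x) = (\<Sum>j\<in>F. c j * cnj (fourier g j))"
proof -
  have "complex_of_real (LINT x|circle. trig_sum c F x * g x) = (LINT x|circle. of_real (trig_sum c F x * g x) * expk (- 0) x)"
    by (simp add: integral_complex_of_real[symmetric])
  also have "\<dots> = (\<Sum>j\<in>F. c j * fourier g (0 - j))" by (rule integral_mult_trig_sum[OF assms])
  finally show ?thesis by (simp add: fourier_uminus)
qed

lemma integral_trig_sum_square: "(LINT x|circle. (trig_sum c F x)\<^sup>2) = (\<Sum>j\<in>F. (cmod (c j))\<^sup>2)"
proof -
  have "complex_of_real (LINT x|circle. trig_sum c F x * trig_sum c F x) = (\<Sum>j\<in>F. c j * cnj (fourier (trig_sum c F) j))"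
    by (rule integral_real_mult_trig_sum[OF sq_integrable_integrable[OF trig_sum_sq_integrable]])
  also have "\<dots> = (\<Sum>j\<in>F. of_real ((cmod (c j))\<^sup>2))"
    by (rule sum.cong) (simp_all add: fourier_trig_sum complex_norm_square[symmetric] del: of_real_power)
  also have "\<dots> = of_real (\<Sum>j\<in>F. (cmod (c j))\<^sup>2)" by (rule of_real_sum[symmetric])
  finally have "(LINT x|circle. trig_sum c F x * trig_sum c F x) = (\<Sum>j\<in>F. (cmod (c j))\<^sup>2)" by (simp only: of_real_eq_iff)
  then show ?thesis by (simp only: power2_eq_square)
qed

end

lemma bessel:
  assumes g: "sq_integrable g" shows "finsum_le (\<lambda>k. (cmod (fourier g k))\<^sup>2) (LINT x|circle. (g x)\<^sup>2)"
  unfolding finsum_le_def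
proof (intro allI impI)
  fix F0 :: "int set" assume F0: "finite F0"
  define F where "F = F0 \<union> uminus ` F0"
  have F: "finite F" "\<And>k. - k \<in> F \<longleftrightarrow> k \<in> F" 
  proof -
    show "finite F" using F0 by (simp add: F_def)
    have "- k \<in> F" if "k \<in> F" for k using that by (auto simp: F_def)
    note m = this
    show "- k \<in> F \<longleftrightarrow> k \<in> F" for k using m[of k] m[of "- k"] by auto
  qed
  define T where "T = trig_sum (fourier g) F"
  have "complex_of_real (LINT x|circle. T x * g x) = of_real (\<Sum>j\<in>F. (cmod (fourier g j))\<^sup>2)"
    unfolding T_def integral_real_mult_trig_sum[where c = "fourier g" and F = F, OF fourier_uminus F(2,1) sq_integrable_integrable[OF g]]
    by (simp add: complex_norm_square[symmetric] del: of_real_power)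
  then have Tg: "(LINT x|circle. T x * g x) = (\<Sum>j\<in>F. (cmod (fourier g j))\<^sup>2)" by (simp only: of_real_eq_iff)
  have TT: "(LINT x|circle. (T x)\<^sup>2) = (\<Sum>j\<in>F. (cmod (fourier g j))\<^sup>2)"
    unfolding T_def by (rule integral_trig_sum_square[where c = "fourier g" and F = F, OF fourier_uminus F(2,1)])
  have sT: "sq_integrable T" unfolding T_def by (rule trig_sum_sq_integrable)
  have i: "integrable circle (\<lambda>x. T x * g x)" by (rule integrable_mult_sq_integrable[OF sT g])
  have "0 \<le> (LINT x|circle. (g x - T x)\<^sup>2)" by simp
  also have "(\<lambda>x. (g x - T x)\<^sup>2) = (\<lambda>x. (g x)\<^sup>2 - 2 * (T x * g x) + (T x)\<^sup>2)"
    by (simp add: fun_eq_iff power2_diff mult_ac)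
  also have "(LINT x|circle. (g x)\<^sup>2 - 2 * (T x * g x) + (T x)\<^sup>2) = (LINT x|circle. (g x)\<^sup>2) - 2 * (LINT x|circle. T x * g x) + (LINT x|circle. (T x)\<^sup>2)"
    using g sT i by (simp add: sq_integrable_def)
  finally have "(\<Sum>j\<in>F. (cmod (fourier g j))\<^sup>2) \<le> (LINT x|circle. (g x)\<^sup>2)" unfolding Tg TT by simp
  moreover have "(\<Sum>j\<in>F0. (cmod (fourier g j))\<^sup>2) \<le> (\<Sum>j\<in>F. (cmod (fourier g j))\<^sup>2)"
    by (rule sum_mono2) (use F in \<open>auto simp: F_def\<close>)
  ultimately show "(\<Sum>j\<in>F0. (cmod (fourier g j))\<^sup>2) \<le> (LINT x|circle. (g x)\<^sup>2)" by simp
qed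

section \<open>The Riesz-Fischer theorem and Parseval's identity\<close>

definition freqs :: "nat \<Rightarrow> int set" where "freqs n = {- int n..int n}"

lemma freqs [simp]: "finite (freqs n)" "- k \<in> freqs n \<longleftrightarrow> k \<in> freqs n" "m \<le> n \<Longrightarrow> freqs m \<subseteq> freqs n"
  by (auto simp: freqs_def)

text \<open>The partial sums are Cauchy in \<open>L\<^sup>2\<close>, hence in \<open>L\<^sup>1\<close>, and a subsequence converges almost everywhere. Fatou's
  lemma shows that the partial sums converge to its limit in \<open>L\<^sup>2\<close>. The limit is periodic and measurable on the
  whole line because it is defined there by the same formula.\<close>
theorem riesz_fischer:
  assumes c: "\<And>k. c (- k) = cnj (c k)" and R: "l2_le c R"
  obtains g where "g \<in> L2_per" "\<And>k. fourier g k = c k" "(\<lambda>n. LINT x|circle. (g x - trig_sum c (freqs n) x)\<^sup>2) \<longlonglongrightarrow> 0"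
proof -
  define S where "S n = trig_sum c (freqs n)" for n
  define a where "a n = (\<Sum>k\<in>freqs n. (cmod (c k))\<^sup>2)" for n
  have sS: "sq_integrable (S n)" for n unfolding S_def by (rule trig_sum_sq_integrable)
  have inc: "incseq a" unfolding a_def by (intro incseq_SucI sum_mono2) (auto simp: freqs_def)
  have aR: "a n \<le> R" for n unfolding a_def by (rule finsum_leD[OF R]) simp
  have dist: "(LINT x|circle. (S n x - S m x)\<^sup>2) = a n - a m" if "m \<le> n" for m n
  proof -
    have sub: "freqs m \<subseteq> freqs n" using that by simp
    have "S n x - S m x = trig_sum c (freqs n - freqs m) x" for x
      unfolding S_def trig_sum_def using sum.subset_diff[OF sub, of "\<lambda>k. c k * expk k x"] by simp
    then have "(LINT x|circle. (S n x - S m x)\<^sup>2) = (\<Sum>k\<in>freqs n - freqs m. (cmod (c k))\<^sup>2)"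
      using integral_trig_sum_square[of c "freqs n - freqs m"] c by simp
    also have "\<dots> = a n - a m" unfolding a_def using sub by (subst sum_diff) auto
    finally show ?thesis .
  qed
  obtain L where L: "a \<longlonglongrightarrow> L" "\<And>n. a n \<le> L"
    using incseq_convergent[OF inc, of R] aR by blast
  have distL: "(LINT x|circle. (S n x - S m x)\<^sup>2) \<le> L - a (min m n)" for m n
  proof (cases "m \<le> n")
    case True then show ?thesis using dist[OF True] L(2)[of n] by simp
  next
    case False
    then have "(LINT x|circle. (S n x - S m x)\<^sup>2) = a m - a n" using dist[of n m] by (simp add: power2_commute)
    then show ?thesis using False L(2)[of m] by (simp add: min_def)
  qed
  have "\<exists>N. \<forall>i\<ge>N. \<forall>j\<ge>N. LINT x|circle. norm (S i x - S j x) < e" if e: "0 < e" for e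
  proof -
    have "\<forall>\<^sub>F n in sequentially. L - e\<^sup>2 < a n" using L(1) e by (intro order_tendstoD) auto
    then obtain N where N: "\<And>n. n \<ge> N \<Longrightarrow> L - e\<^sup>2 < a n" by (auto simp: eventually_sequentially)
    have "(LINT x|circle. norm (S i x - S j x)) < e" if "i \<ge> N" "j \<ge> N" for i j
    proof -
      have "(LINT x|circle. \<bar>S i x - S j x\<bar>) \<le> sqrt (LINT x|circle. (S i x - S j x)\<^sup>2)"
        by (rule L1_le_L2[OF sq_integrable_diff[OF sS sS]])
      also have "\<dots> < sqrt (e\<^sup>2)" using distL[of i j] N[of "min j i"] that by (intro real_sqrt_less_mono) auto
      finally show ?thesis using e by simp
    qed
    then show ?thesis by blast
  qed
  from cauchy_L1_AE_cauchy_subseq[of circle S, OF sq_integrable_integrable[OF sS] this]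
  obtain r where r: "strict_mono r" "AE x in circle. Cauchy (\<lambda>i. S (r i) x)" by metis
  define g where "g x = lim (\<lambda>i. S (r i) x)" for x
  have per: "g (x + 1) = g x" for x unfolding g_def S_def trig_sum_periodic ..
  have "S n \<in> borel_measurable borel" for n
    unfolding S_def by (rule borel_measurable_continuous_onI[OF trig_sum_continuous])
  then have "g \<in> borel_measurable borel" unfolding g_def by (rule borel_measurable_lim_metric)
  then have gm: "g \<in> borel_measurable lebesgue" by (intro measurable_completion) simp
  then have gc: "g \<in> borel_measurable circle" by (rule measurable_restrict_space1)
  have Sm: "S n \<in> borel_measurable circle" for n using sS by (simp add: sq_integrable_def)
  have conv: "AE x in circle. (\<lambda>i. S (r i) x) \<longlonglongrightarrow> g x"
    using r(2) by eventually_elim (simp add: g_def Cauchy_convergent_iff convergent_LIMSEQ_iff)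
  have rge: "i \<le> r i" for i by (rule seq_suble[OF r(1)])
  have fatou: "(\<integral>\<^sup>+x. ennreal ((g x - S m x)\<^sup>2) \<partial>circle) \<le> ennreal (L - a m)" for m
  proof -
    have "(\<integral>\<^sup>+x. ennreal ((g x - S m x)\<^sup>2) \<partial>circle) = (\<integral>\<^sup>+x. liminf (\<lambda>i. ennreal ((S (r i) x - S m x)\<^sup>2)) \<partial>circle)"
    proof (rule nn_integral_cong_AE)
      show "AE x in circle. ennreal ((g x - S m x)\<^sup>2) = liminf (\<lambda>i. ennreal ((S (r i) x - S m x)\<^sup>2))"
        using conv
      proof eventually_elim
        case (elim x)
        have "(\<lambda>i. ennreal ((S (r i) x - S m x)\<^sup>2)) \<longlonglongrightarrow> ennreal ((g x - S m x)\<^sup>2)"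
          by (intro tendsto_intros tendsto_ennrealI elim)
        then show ?case using lim_imp_Liminf[OF sequentially_bot] by metis
      qed
    qed
    also have "\<dots> \<le> liminf (\<lambda>i. \<integral>\<^sup>+x. ennreal ((S (r i) x - S m x)\<^sup>2) \<partial>circle)"
      by (rule nn_integral_liminf) (use Sm in measurable)
    also have "\<dots> \<le> liminf (\<lambda>i. ennreal (L - a m))"
    proof (rule Liminf_mono)
      show "\<forall>\<^sub>F i in sequentially. (\<integral>\<^sup>+x. ennreal ((S (r i) x - S m x)\<^sup>2) \<partial>circle) \<le> ennreal (L - a m)"
        using eventually_ge_at_top[of m]
      proof eventually_elim
        case (elim i)
        have "(\<integral>\<^sup>+x. ennreal ((S (r i) x - S m x)\<^sup>2) \<partial>circle) = ennreal (LINT x|circle. (S (r i) x - S m x)\<^sup>2)"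
          by (rule nn_integral_eq_integral) (use sq_integrable_diff[OF sS sS] in \<open>auto simp: sq_integrable_def\<close>)
        also have "\<dots> \<le> ennreal (L - a m)"
          using distL[of "r i" m] elim rge[of i] by (intro ennreal_leI) (simp add: min_def)
        finally show ?case .
      qed
    qed
    also have "\<dots> = ennreal (L - a m)" by (simp add: Liminf_const)
    finally show ?thesis .
  qed
  have sd: "sq_integrable (\<lambda>x. g x - S m x)" for m
    unfolding sq_integrable_def
  proof
    show "(\<lambda>x. g x - S m x) \<in> borel_measurable circle" using gc Sm by measurable
    show "integrable circle (\<lambda>x. (g x - S m x)\<^sup>2)"
      by (rule integrableI_nonneg) (use gc Sm in measurable, auto intro: le_less_trans[OF fatou])
  qed
  have int_le: "(LINT x|circle. (g x - S m x)\<^sup>2) \<le> L - a m" for m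
    using fatou[of m] nn_integral_eq_integral[of circle "\<lambda>x. (g x - S m x)\<^sup>2"] sd[of m] L(2)[of m]
    by (simp add: sq_integrable_def)
  have lim0: "(\<lambda>m. LINT x|circle. (g x - S m x)\<^sup>2) \<longlonglongrightarrow> 0"
  proof (rule tendsto_sandwich[OF _ _ tendsto_const])
    show "(\<lambda>m. L - a m) \<longlonglongrightarrow> 0" using tendsto_diff[OF tendsto_const L(1), of L] by simp
  qed (use int_le in auto)
  have sg: "sq_integrable g" using sq_integrable_add[OF sd[of 0] sS[of 0]] by simp
  show ?thesis
  proof (rule that)
    show "g \<in> L2_per" using per gm sg by (simp add: L2_per_iff)
    show "(\<lambda>n. LINT x|circle. (g x - trig_sum c (freqs n) x)\<^sup>2) \<longlonglongrightarrow> 0" using lim0 by (simp add: S_def)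
    fix k
    have "(\<lambda>m. sqrt (LINT x|circle. (g x - S m x)\<^sup>2)) \<longlonglongrightarrow> sqrt 0" by (rule tendsto_real_sqrt[OF lim0])
    then have l: "(\<lambda>m. sqrt (LINT x|circle. (g x - S m x)\<^sup>2)) \<longlonglongrightarrow> 0" by simp
    have "cmod (fourier g k - c k) \<le> 0"
    proof (rule tendsto_lowerbound[OF l])
      show "\<forall>\<^sub>F m in sequentially. cmod (fourier g k - c k) \<le> sqrt (LINT x|circle. (g x - S m x)\<^sup>2)"
        using eventually_ge_at_top[of "nat \<bar>k\<bar>"]
      proof eventually_elim
        case (elim m)
        then have "k \<in> freqs m" by (auto simp: freqs_def)
        then have "fourier (S m) k = c k" unfolding S_def by (subst fourier_trig_sum[where c = c, OF c]) auto
        then have "fourier g k - c k = fourier (\<lambda>x. g x - S m x) k"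
          using fourier_diff[OF sq_integrable_integrable[OF sg] sq_integrable_integrable[OF sS], of m k] by simp
        then show ?case using fourier_bound[OF sd[of m], of k] by simp
      qed
    qed simp
    then show "fourier g k = c k" by simp
  qed
qed

text \<open>The function with the same coefficients provided by \<open>riesz_fischer\<close> agrees almost everywhere with the given
  one.\<close>
lemma fourier_partial_sums_converge:
  assumes g: "g \<in> L2_per"
  shows "(\<lambda>n. LINT x|circle. (g x - trig_sum (fourier g) (freqs n) x)\<^sup>2) \<longlonglongrightarrow> 0"
proof -
  obtain h where h: "h \<in> L2_per" "\<And>k. fourier h k = fourier g k" "(\<lambda>n. LINT x|circle. (h x - trig_sum (fourier g) (freqs n) x)\<^sup>2) \<longlonglongrightarrow> 0"
    using riesz_fischer[OF fourier_uminus bessel[OF L2_per_sq_integrable[OF g]]] by blast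
  have "AE x in lebesgue. h x = g x"
    by (rule fourier_determines) (use g h in \<open>auto simp: L2_per_iff sq_integrable_integrable\<close>)
  then have ae: "AE x in circle. h x = g x" by (rule AE_circle)
  have m: "trig_sum (fourier g) (freqs n) \<in> borel_measurable circle" "h \<in> borel_measurable circle" "g \<in> borel_measurable circle" for n
    using trig_sum_sq_integrable[of "fourier g" "freqs n"] h g by (auto simp: L2_per_iff sq_integrable_def)
  have "(LINT x|circle. (h x - trig_sum (fourier g) (freqs n) x)\<^sup>2) = (LINT x|circle. (g x - trig_sum (fourier g) (freqs n) x)\<^sup>2)" for n
    by (rule integral_cong_AE) (use m ae in \<open>auto elim: eventually_mono\<close>)
  with h(3) show ?thesis by simp
qed

text \<open>For a partial sum of \<open>g\<close> in place of \<open>g\<close> this is a finite computation; the error is controlled by the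
  Cauchy-Schwarz inequality.\<close>
theorem fourier_product:
  assumes g: "g \<in> L2_per" and h: "h \<in> L2_per"
  shows "((\<lambda>j. fourier g j * fourier h (k - j)) has_sum fourier (\<lambda>x. g x * h x) k) UNIV"
proof -
  note sg = L2_per_sq_integrable[OF g] and sh = L2_per_sq_integrable[OF h]
  have "(\<lambda>j. fourier g j * fourier h (k - j)) summable_on UNIV"
    using finsum_le_l2_product[OF bessel[OF sg] bessel[OF sh], of k] by (intro finsum_le_summable) (simp add: norm_mult)
  then have s: "((\<lambda>j. fourier g j * fourier h (k - j)) has_sum (\<Sum>\<^sub>\<infinity>j. fourier g j * fourier h (k - j))) UNIV" by simp
  have lim1: "(\<lambda>n. \<Sum>j\<in>freqs n. fourier g j * fourier h (k - j)) \<longlonglongrightarrow> (\<Sum>\<^sub>\<infinity>j. fourier g j * fourier h (k - j))"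
    unfolding freqs_def by (rule has_sum_symmetric_tendsto[OF s])
  define D where "D n = sqrt (LINT x|circle. (g x - trig_sum (fourier g) (freqs n) x)\<^sup>2) * sqrt (LINT x|circle. (h x)\<^sup>2)" for n
  have D: "D \<longlonglongrightarrow> 0"
    unfolding D_def using tendsto_mult_left_zero[OF tendsto_real_sqrt[OF fourier_partial_sums_converge[OF g], simplified]] by simp
  have "cmod (fourier (\<lambda>x. g x * h x) k - (\<Sum>j\<in>freqs n. fourier g j * fourier h (k - j))) \<le> D n" for n
  proof -
    define T where "T = trig_sum (fourier g) (freqs n)"
    have sT: "sq_integrable T" unfolding T_def by (rule trig_sum_sq_integrable)
    have "(\<Sum>j\<in>freqs n. fourier g j * fourier h (k - j)) = fourier (\<lambda>x. T x * h x) k"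
      unfolding T_def fourier_def[of "\<lambda>x. trig_sum (fourier g) (freqs n) x * h x"]
      by (rule integral_mult_trig_sum[where c = "fourier g", OF fourier_uminus _ _ sq_integrable_integrable[OF sh], symmetric]) auto
    then have "fourier (\<lambda>x. g x * h x) k - (\<Sum>j\<in>freqs n. fourier g j * fourier h (k - j)) = fourier (\<lambda>x. (g x - T x) * h x) k"
      using fourier_diff[OF integrable_mult_sq_integrable[OF sg sh] integrable_mult_sq_integrable[OF sT sh], of k] by (simp add: left_diff_distrib)
    also have "cmod \<dots> \<le> (LINT x|circle. cmod (of_real ((g x - T x) * h x) * expk (- k) x))"
      unfolding fourier_def by (rule integral_norm_bound)
    also have "\<dots> = (LINT x|circle. \<bar>g x - T x\<bar> * \<bar>h x\<bar>)"
      by (simp only: norm_mult norm_of_real cmod_expk mult_1_right abs_mult)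
    also have "\<dots> \<le> D n" unfolding D_def T_def[symmetric] by (rule cauchy_schwarz[OF sq_integrable_diff[OF sg sT] sh])
    finally show ?thesis .
  qed
  then have "(\<lambda>n. fourier (\<lambda>x. g x * h x) k - (\<Sum>j\<in>freqs n. fourier g j * fourier h (k - j))) \<longlonglongrightarrow> 0"
    by (intro Lim_null_comparison[OF _ D]) auto
  from tendsto_diff[OF tendsto_const[of "fourier (\<lambda>x. g x * h x) k"] this]
  have "(\<lambda>n. \<Sum>j\<in>freqs n. fourier g j * fourier h (k - j)) \<longlonglongrightarrow> fourier (\<lambda>x. g x * h x) k" by simp
  then have "fourier (\<lambda>x. g x * h x) k = (\<Sum>\<^sub>\<infinity>j. fourier g j * fourier h (k - j))" by (rule LIMSEQ_unique[OF _ lim1])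
  with s show ?thesis by (simp only:)
qed

theorem parseval:
  assumes g: "g \<in> L2_per"
  shows "((\<lambda>k. (cmod (fourier g k))\<^sup>2) has_sum (L2_norm g)\<^sup>2) UNIV"
proof -
  have 1: "fourier g j * fourier g (0 - j) = complex_of_real ((cmod (fourier g j))\<^sup>2)" for j
    unfolding diff_0 fourier_uminus by (rule complex_norm_square[symmetric])
  have 2: "fourier (\<lambda>x. g x * g x) 0 = complex_of_real ((L2_norm g)\<^sup>2)"
  proof -
    have "fourier (\<lambda>x. g x * g x) 0 = complex_of_real (LINT x|circle. g x * g x)" by (simp add: fourier_def del: of_real_mult)
    moreover have "(L2_norm g)\<^sup>2 = (LINT x|circle. g x * g x)"
      unfolding L2_norm_circle power2_eq_square[of "g _"] by (rule real_sqrt_pow2) (simp add: integral_nonneg_AE)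
    ultimately show ?thesis by (simp only:)
  qed
  have "((\<lambda>k. complex_of_real ((cmod (fourier g k))\<^sup>2)) has_sum complex_of_real ((L2_norm g)\<^sup>2)) UNIV"
    using fourier_product[OF g g, of 0] unfolding 1 2 .
  then show ?thesis by (simp only: has_sum_of_real_iff)
qed

section \<open>Weak derivatives as Fourier multipliers\<close>

lemma fourier_real_integral:
  assumes "integrable circle (g :: real \<Rightarrow> real)"
  shows "fourier g 0 = of_real (LINT x|circle. g x)"
  by (simp add: fourier_def)

lemma parseval_pairing:
  assumes g: "g \<in> L2_per" and h: "h \<in> L2_per"
  shows "complex_of_real (LINT x|circle. g x * h x) = (\<Sum>\<^sub>\<infinity>j. fourier g j * fourier h (- j))"
proof -
  have "(\<Sum>\<^sub>\<infinity>j. fourier g j * fourier h (0 - j)) = fourier (\<lambda>x. g x * h x) 0"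
    by (rule infsumI[OF fourier_product[OF g h]])
  then show ?thesis
    using fourier_real_integral[OF integrable_mult_sq_integrable[OF L2_per_sq_integrable[OF g] L2_per_sq_integrable[OF h]]] by simp
qed

definition real_trig :: "complex \<Rightarrow> real \<Rightarrow> real \<Rightarrow> real" where
  "real_trig \<zeta> c x = Re (\<zeta> * cis (c * x))"

text \<open>Real and imaginary parts of a character are the cases \<open>\<zeta> = 1\<close> and \<open>\<zeta> = - i\<close>; differentiation
  multiplies \<open>\<zeta>\<close> by \<open>i c\<close>.\<close>
lemma real_trig_derivative: "(real_trig \<zeta> c has_real_derivative real_trig (\<i> * c * \<zeta>) c x) (at x)"
proof -
  have "((\<lambda>x. \<zeta> * cis (c * x)) has_vector_derivative \<zeta> * (\<i> * c * cis (c * x))) (at x)"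
    by (intro bounded_linear.has_vector_derivative[OF bounded_linear_mult_right] has_vector_derivative_cis_linear)
  from bounded_linear.has_vector_derivative[OF bounded_linear_Re this] show ?thesis
    unfolding has_real_derivative_iff_has_vector_derivative real_trig_def by (simp only: mult_ac)
qed

lemma deriv_real_trig: "(deriv ^^ n) (real_trig \<zeta> c) = real_trig ((\<i> * c) ^ n * \<zeta>) c"
proof (induction n)
  case (Suc n)
  have "deriv (real_trig \<xi> c) = real_trig (\<i> * c * \<xi>) c" for \<xi>
    by (rule ext) (rule DERIV_imp_deriv[OF real_trig_derivative])
  then show ?case using Suc by (simp add: mult.assoc)
qed simp

lemma smooth_per_real_trig: "smooth_per (real_trig \<zeta> (2 * pi * of_int k))"
proof -
  have p: "real_trig \<zeta> (2 * pi * of_int k) (x + 1) = real_trig \<zeta> (2 * pi * of_int k) x" for x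
    using expk_periodic[of k x] by (simp add: real_trig_def expk_def)
  have "real_trig \<xi> c differentiable_on UNIV" for \<xi> c
    using real_trig_derivative by (auto simp: differentiable_on_def intro!: differentiableI has_field_derivative_imp_has_derivative)
  then show ?thesis unfolding smooth_per_def deriv_real_trig using p by blast
qed

text \<open>Test with the real and imaginary parts of the characters.\<close>
theorem fourier_weak_deriv:
  assumes "has_weak_deriv m g w"
  shows "fourier w k = (2 * pi * \<i> * of_int k) ^ m * fourier g k"
proof -
  have gw: "g \<in> L2_per" "w \<in> L2_per" using assms by (auto simp: has_weak_deriv_def)
  define c where "c = 2 * pi * real_of_int (- k)"
  have e: "expk (- k) x = cis (c * x)" for x by (simp add: expk_def c_def)
  have pair: "(LINT x|circle. h x * real_trig \<zeta> c x) = Re (\<zeta> * fourier h k)" if "h \<in> L2_per" for h \<zeta>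
  proof -
    have i: "integrable circle (\<lambda>x. of_real (h x) * expk (- k) x)"
      by (rule integrable_mult_expk[OF sq_integrable_integrable[OF L2_per_sq_integrable[OF that]]])
    have "Re (\<zeta> * fourier h k) = Re (LINT x|circle. \<zeta> * (of_real (h x) * expk (- k) x))" using i by (simp add: fourier_def)
    also have "\<dots> = (LINT x|circle. Re (\<zeta> * (of_real (h x) * expk (- k) x)))"
      by (rule integral_Re[symmetric]) (use i in simp)
    also have "\<dots> = (LINT x|circle. h x * real_trig \<zeta> c x)"
    proof (rule Bochner_Integration.integral_cong[OF refl])
      fix x
      have "\<zeta> * (of_real (h x) * expk (- k) x) = of_real (h x) * (\<zeta> * cis (c * x))" by (simp only: e mult_ac)
      then show "Re (\<zeta> * (of_real (h x) * expk (- k) x)) = h x * real_trig \<zeta> c x" by (simp only: real_trig_def times_complex.sel(1) Re_complex_of_real Im_complex_of_real mult_zero_left diff_0_right)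
    qed
    finally show ?thesis by simp
  qed
  have "Re (\<zeta> * ((\<i> * c) ^ m * fourier g k - (-1) ^ m * fourier w k)) = 0" for \<zeta>
  proof -
    have "(LINT x:{0..1}|lebesgue. g x * (deriv ^^ m) (real_trig \<zeta> c) x) = (-1) ^ m * (LINT x:{0..1}|lebesgue. w x * real_trig \<zeta> c x)"
      using assms smooth_per_real_trig[of \<zeta> "- k"] unfolding has_weak_deriv_def c_def by blast
    then have "Re ((\<i> * c) ^ m * \<zeta> * fourier g k) = (-1) ^ m * Re (\<zeta> * fourier w k)"
      unfolding LINT_circle deriv_real_trig pair[OF gw(1)] pair[OF gw(2)] .
    also have "(-1) ^ m * Re (\<zeta> * fourier w k) = Re (\<zeta> * ((-1) ^ m * fourier w k))"
      by (cases "even m") simp_all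
    finally have "Re ((\<i> * c) ^ m * \<zeta> * fourier g k - \<zeta> * ((-1) ^ m * fourier w k)) = 0" by simp
    moreover have "(\<i> * c) ^ m * \<zeta> * fourier g k - \<zeta> * ((-1) ^ m * fourier w k) = \<zeta> * ((\<i> * c) ^ m * fourier g k - (-1) ^ m * fourier w k)"
      by (simp only: right_diff_distrib mult_ac)
    ultimately show ?thesis by simp
  qed
  note * = this
  define D where "D = (\<i> * c) ^ m * fourier g k - (-1) ^ m * fourier w k"
  have "Re D = 0" "Im D = 0" using *[of 1] *[of "- \<i>"] by (simp_all add: D_def)
  then have "D = 0" by (simp add: complex_eq_iff)
  then have "(\<i> * c) ^ m * fourier g k = (-1) ^ m * fourier w k" by (simp add: D_def)
  moreover have "(\<i> * of_real c) = (-1) * (2 * pi * \<i> * of_int k)" by (simp add: c_def)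
  ultimately have "(-1) ^ m * ((2 * pi * \<i> * of_int k) ^ m * fourier g k) = (-1) ^ m * fourier w k"
    by (simp only: power_mult_distrib mult.assoc)
  then show ?thesis by simp
qed

lemma deriv_periodic:
  assumes "\<And>x. f (x + 1) = f (x :: real)" shows "deriv f (x + 1) = deriv f x"
proof -
  have "(f has_real_derivative D) (at (x + 1)) \<longleftrightarrow> (f has_real_derivative D) (at x)" for D
    using DERIV_shift[of f D x 1] assms by simp
  then show ?thesis by (simp add: deriv_def)
qed

lemma smooth_per_deriv: "smooth_per \<phi> \<Longrightarrow> smooth_per (deriv \<phi>)"
  unfolding smooth_per_def
proof (intro conjI allI)
  assume a: "(\<forall>x. \<phi> (x + 1) = \<phi> x) \<and> (\<forall>n. (deriv ^^ n) \<phi> differentiable_on UNIV)"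
  show "deriv \<phi> (x + 1) = deriv \<phi> x" for x using a by (intro deriv_periodic) auto
  show "(deriv ^^ n) (deriv \<phi>) differentiable_on UNIV" for n
    using conjunct2[OF a, rule_format, of "Suc n"] by (simp only: funpow_Suc_right o_apply)
qed

lemma smooth_per_has_derivative:
  assumes "smooth_per \<phi>" shows "(\<phi> has_real_derivative deriv \<phi> x) (at x)"
proof -
  have "\<phi> differentiable_on UNIV" using assms unfolding smooth_per_def by (metis funpow_0)
  then have "\<phi> differentiable (at x)" by (simp add: differentiable_on_def)
  then have "\<phi> field_differentiable (at x)"
    by (simp add: field_differentiable_def real_differentiable_def)
  then show ?thesis by (simp add: DERIV_deriv_iff_field_differentiable)
qed

lemma smooth_per_continuous: "smooth_per \<phi> \<Longrightarrow> continuous_on UNIV \<phi>"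
  using smooth_per_has_derivative by (intro continuous_at_imp_continuous_on ballI) (blast intro: DERIV_isCont)

lemma smooth_per_L2: assumes "smooth_per \<phi>" shows "\<phi> \<in> L2_per"
proof -
  have c: "continuous_on UNIV \<phi>" by (rule smooth_per_continuous[OF assms])
  have "compact (\<phi> ` {0..1})" by (rule compact_continuous_image[OF continuous_on_subset[OF c]]) auto
  then have "bounded (\<phi> ` {0..1})" by (rule compact_imp_bounded)
  then obtain B where B: "\<And>x. x \<in> {0..1} \<Longrightarrow> \<bar>\<phi> x\<bar> \<le> B"
    unfolding bounded_iff real_norm_def by blast
  have m: "\<phi> \<in> borel_measurable circle" by (rule measurable_circle_continuous[OF c])
  have "integrable circle (\<lambda>x. (\<phi> x)\<^sup>2)"
  proof (rule finite_measure.integrable_const_bound[OF finite_measure_circle, where B = "B\<^sup>2"])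
    have "norm ((\<phi> x)\<^sup>2) \<le> B\<^sup>2" if "x \<in> {0..1}" for x
      using power_mono[OF B[OF that], of 2] by simp
    then show "AE x in circle. norm ((\<phi> x)\<^sup>2) \<le> B\<^sup>2" by (intro AE_I2) (simp add: space_restrict_space)
  qed (use m in measurable)
  moreover have "\<phi> \<in> borel_measurable lebesgue"
    using borel_measurable_continuous_onI[OF c] by (intro measurable_completion) simp
  ultimately show ?thesis using m assms by (simp add: L2_per_iff sq_integrable_def smooth_per_def)
qed

lemma fourier_deriv_smooth:
  assumes p: "smooth_per \<phi>"
  shows "fourier (deriv \<phi>) k = (2 * pi * \<i> * of_int k) * fourier \<phi> k"
proof -
  define c where "c = 2 * pi * real_of_int (- k)"
  have e: "expk (- k) x = cis (c * x)" for x by (simp add: expk_def c_def)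
  define G where "G x = complex_of_real (\<phi> x) * expk (- k) x" for x
  define G' where "G' x = complex_of_real (\<phi> x) * (\<i> * c * expk (- k) x) + of_real (deriv \<phi> x) * expk (- k) x" for x
  have "((\<lambda>x. complex_of_real (\<phi> x)) has_vector_derivative of_real (deriv \<phi> x)) (at x within {0..1})" for x
    using smooth_per_has_derivative[OF p, of x]
    by (intro bounded_linear.has_vector_derivative[OF bounded_linear_of_real])
       (simp add: has_real_derivative_iff_has_vector_derivative has_vector_derivative_at_within)
  then have "(G has_vector_derivative G' x) (at x within {0..1})" for x
    unfolding G_def G'_def e by (intro has_vector_derivative_mult has_vector_derivative_cis_linear)
  then have "(G' has_integral (G 1 - G 0)) {0..1}" by (intro fundamental_theorem_of_calculus) auto
  moreover have "G 1 = G 0"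
    using expk_periodic[of "- k" 0] p by (simp add: G_def smooth_per_def) (metis add_0)
  ultimately have z: "integral {0..1} G' = 0" by (simp add: integral_unique)
  have i1: "integrable circle (\<lambda>x. of_real (\<phi> x) * expk (- k) x)" and i2: "integrable circle (\<lambda>x. of_real (deriv \<phi> x) * expk (- k) x)"
    by (intro integrable_mult_expk sq_integrable_integrable L2_per_sq_integrable smooth_per_L2 p smooth_per_deriv)+
  have G': "G' = (\<lambda>x. (\<i> * c) * (of_real (\<phi> x) * expk (- k) x) + of_real (deriv \<phi> x) * expk (- k) x)"
    by (simp add: G'_def fun_eq_iff mult_ac)
  have "(LINT x|circle. G' x) = (\<i> * c) * fourier \<phi> k + fourier (deriv \<phi>) k"
    unfolding G' fourier_def using i1 i2 by simp
  moreover have "(LINT x|circle. G' x) = 0"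
  proof -
    have "set_integrable lebesgue {0..1} G'" unfolding set_integrable_circle G' using i1 i2 by simp
    then show ?thesis using z set_lebesgue_integral_eq_integral(2) by (metis LINT_circle)
  qed
  ultimately have "fourier (deriv \<phi>) k = - (\<i> * c) * fourier \<phi> k" by (simp add: add_eq_0_iff2)
  then show ?thesis by (simp add: c_def mult_ac)
qed

lemma smooth_per_deriv_n: "smooth_per \<phi> \<Longrightarrow> smooth_per ((deriv ^^ n) \<phi>)"
  by (induction n) (auto intro: smooth_per_deriv)

lemma fourier_deriv_n_smooth:
  assumes "smooth_per \<phi>"
  shows "fourier ((deriv ^^ n) \<phi>) k = (2 * pi * \<i> * of_int k) ^ n * fourier \<phi> k"
proof (induction n)
  case (Suc n)
  then show ?case using fourier_deriv_smooth[OF smooth_per_deriv_n[OF assms, of n], of k] by simp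
qed simp

text \<open>Both sides of the defining identity are evaluated by Parseval's identity and agree term by term.\<close>
theorem has_weak_deriv_of_fourier:
  assumes g: "g \<in> L2_per" and w: "w \<in> L2_per"
    and fourier: "\<And>k. fourier w k = (2 * pi * \<i> * of_int k) ^ m * fourier g k"
  shows "has_weak_deriv m g w"
  unfolding has_weak_deriv_def
proof (intro conjI allI impI g w)
  fix \<phi> assume p: "smooth_per \<phi>"
  have "complex_of_real (LINT x|circle. g x * (deriv ^^ m) \<phi> x) = (\<Sum>\<^sub>\<infinity>j. fourier g j * fourier ((deriv ^^ m) \<phi>) (- j))"
    by (rule parseval_pairing[OF g smooth_per_L2[OF smooth_per_deriv_n[OF p]]])
  also have "\<dots> = (\<Sum>\<^sub>\<infinity>j. (-1) ^ m * (fourier w j * fourier \<phi> (- j)))"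
  proof (rule infsum_cong)
    fix j
    have "(2 * pi * \<i> * of_int (- j) :: complex) = (-1) * (2 * pi * \<i> * of_int j)" by simp
    then have "(2 * pi * \<i> * of_int (- j) :: complex) ^ m = (-1) ^ m * (2 * pi * \<i> * of_int j) ^ m"
      by (simp only: power_mult_distrib)
    then show "fourier g j * fourier ((deriv ^^ m) \<phi>) (- j) = (-1) ^ m * (fourier w j * fourier \<phi> (- j))"
      unfolding fourier_deriv_n_smooth[OF p] fourier by (simp only: mult_ac)
  qed
  also have "\<dots> = (-1) ^ m * (\<Sum>\<^sub>\<infinity>j. fourier w j * fourier \<phi> (- j))" by (rule infsum_cmult_right')
  also have "\<dots> = (-1) ^ m * of_real (LINT x|circle. w x * \<phi> x)"
    by (simp only: parseval_pairing[OF w smooth_per_L2[OF p]])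
  also have "\<dots> = of_real ((-1) ^ m * (LINT x|circle. w x * \<phi> x))" by simp
  finally show "(LINT x:{0..1}|lebesgue. g x * (deriv ^^ m) \<phi> x) = (-1) ^ m * (LINT x:{0..1}|lebesgue. w x * \<phi> x)"
    unfolding LINT_circle of_real_eq_iff .
qed

section \<open>Square summable real sequences\<close>

definition square_summable :: "(int \<Rightarrow> real) \<Rightarrow> bool" where "square_summable f \<longleftrightarrow> (\<exists>R. finsum_le (\<lambda>k. (f k)\<^sup>2) R)"

lemma square_summable_mono: assumes "square_summable g" "\<And>k. \<bar>f k\<bar> \<le> g k" shows "square_summable f"
proof -
  obtain R where "finsum_le (\<lambda>k. (g k)\<^sup>2) R" using assms(1) by (auto simp: square_summable_def)
  then have "finsum_le (\<lambda>k. (f k)\<^sup>2) R"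
  proof (rule finsum_le_mono)
    fix k show "(f k)\<^sup>2 \<le> (g k)\<^sup>2" using power_mono[OF assms(2)[of k], of 2] by simp
  qed simp
  then show ?thesis by (auto simp: square_summable_def)
qed

lemma square_summable_add: assumes "square_summable f" "square_summable g" shows "square_summable (\<lambda>k. f k + g k)"
proof -
  obtain R S where "finsum_le (\<lambda>k. (f k)\<^sup>2) R" "finsum_le (\<lambda>k. (g k)\<^sup>2) S" using assms by (auto simp: square_summable_def)
  then have "finsum_le (\<lambda>k. 2 * ((f k)\<^sup>2 + (g k)\<^sup>2)) (2 * (R + S))" by (intro finsum_le_cmult finsum_le_add) auto
  then have "finsum_le (\<lambda>k. (f k + g k)\<^sup>2) (2 * (R + S))"
  proof (rule finsum_le_mono)
    fix k show "(f k + g k)\<^sup>2 \<le> 2 * ((f k)\<^sup>2 + (g k)\<^sup>2)"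
      using sum_squares_bound[of "f k" "g k"] by (simp add: power2_sum)
  qed simp
  then show ?thesis by (auto simp: square_summable_def)
qed

lemma square_summable_cmult: assumes "square_summable f" shows "square_summable (\<lambda>k. c * f k)"
proof -
  obtain R where "finsum_le (\<lambda>k. (f k)\<^sup>2) R" using assms by (auto simp: square_summable_def)
  then have "finsum_le (\<lambda>k. c\<^sup>2 * (f k)\<^sup>2) (c\<^sup>2 * R)" by (intro finsum_le_cmult) auto
  then show ?thesis unfolding square_summable_def power_mult_distrib by blast
qed

lemma square_summable_inv_abs: "square_summable inv_abs" using finsum_le_inverse_squares by (auto simp: square_summable_def)

lemma square_summable_delta: "square_summable (\<lambda>k. if k = i then c else 0)"
proof -
  have "finsum_le (\<lambda>k. (if k = i then c else 0)\<^sup>2) (c\<^sup>2)"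
    unfolding finsum_le_def by (auto simp: if_distrib[of "\<lambda>x. x\<^sup>2"] sum.delta cong: if_cong)
  then show ?thesis by (auto simp: square_summable_def)
qed

lemma square_summable_fourier: "g \<in> L2_per \<Longrightarrow> square_summable (\<lambda>k. cmod (fourier g k))"
  using bessel[OF L2_per_sq_integrable] by (auto simp: square_summable_def)

section \<open>The equation in Fourier coefficients\<close>

lemma has_sum_delta: "((\<lambda>j. if j = i then x else 0) has_sum (x::complex)) (UNIV :: int set)"
proof -
  have "((\<lambda>j. x) has_sum x) {i}" using has_sum_finite[of "{i}" "\<lambda>_. x"] by simp
  moreover have "((\<lambda>j. if j = i then x else 0) has_sum x) UNIV \<longleftrightarrow> ((\<lambda>j. x) has_sum x) {i}"
    by (rule has_sum_cong_neutral) auto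
  ultimately show ?thesis by simp
qed

text \<open>In the convolution the mean pairs with frequency \<open>k\<close> twice, at \<open>j = 0\<close> and at \<open>j = k\<close>; the result is the transport
  term in the symbol.\<close>
lemma kawahara_rhs_mean_shift:
  assumes l2: "l2_le a R" and a0: "a 0 = 0" and b: "\<And>k. b k = (if k = 0 then of_real m else a k)" and k: "k \<noteq> 0"
  shows "kawahara_rhs 0 b k = kawahara_rhs m a k"
proof -
  have s: "((\<lambda>j. a j * a (k - j)) has_sum (\<Sum>\<^sub>\<infinity>j. a j * a (k - j))) UNIV"
    using finsum_le_summable[OF finsum_le_rotated_rhs[OF l2, of k 0]] by simp
  have "((\<lambda>j. a j * a (k - j) + ((if j = 0 then of_real m * a k else 0) + (if j = k then of_real m * a k else 0)))
      has_sum ((\<Sum>\<^sub>\<infinity>j. a j * a (k - j)) + (of_real m * a k + of_real m * a k))) UNIV"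
    by (intro has_sum_add s has_sum_delta)
  also have "(\<lambda>j. a j * a (k - j) + ((if j = 0 then of_real m * a k else 0) + (if j = k then of_real m * a k else 0))) = (\<lambda>j. b j * b (k - j))"
    using k a0 by (auto simp: fun_eq_iff b)
  finally have "(\<Sum>\<^sub>\<infinity>j. b j * b (k - j)) = (\<Sum>\<^sub>\<infinity>j. a j * a (k - j)) + (of_real m * a k + of_real m * a k)"
    by (rule infsumI)
  then show ?thesis using k by (simp add: kawahara_rhs_def dispersion_def b algebra_simps)
qed

lemma kawahara_rhs_0: "kawahara_rhs m a 0 = 0" by (simp add: kawahara_rhs_def dispersion_def)

lemma derivative_symbol:
  "- ((2 * pi * \<i> * of_int k) ^ 3 * z) + (2 * pi * \<i> * of_int k) ^ 5 * z = \<i> * of_real (dispersion 0 k) * z"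
proof -
  have e: "complex_of_real (2 * pi) * \<i> * of_int k = \<i> * of_real (2 * pi * k)" by simp
  have "\<i> ^ 3 = - \<i>" "\<i> ^ 5 = \<i>" by (simp_all add: eval_nat_numeral)
  then show ?thesis unfolding e power_mult_distrib by (simp add: dispersion_def algebra_simps)
qed

text \<open>The identity \<open>2 u u\<^sub>x = (u\<^sup>2)\<^sub>x\<close> for coefficients, by the symmetry \<open>j \<mapsto> k - j\<close>.\<close>
lemma convolution_derivative:
  assumes "(\<lambda>j. a j * (of_int (k - j) * a (k - j))) summable_on UNIV"
  shows "2 * (\<Sum>\<^sub>\<infinity>j. a j * (of_int (k - j) * a (k - j))) = of_int k * (\<Sum>\<^sub>\<infinity>j. a j * a (k - j :: int) :: complex)"
proof -
  define q where "q j = a j * (of_int (k - j) * a (k - j))" for j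
  have e: "(\<Sum>\<^sub>\<infinity>j. q j) = (\<Sum>\<^sub>\<infinity>j. q (k - j))"
    by (rule infsum_reindex_bij_witness[where i = "\<lambda>j. k - j" and j = "\<lambda>j. k - j"]) auto
  have s: "q summable_on UNIV" using assms unfolding q_def[abs_def] .
  have s2: "(\<lambda>j. q (k - j)) summable_on UNIV"
    using s by (subst summable_on_reindex_bij_witness[where i = "\<lambda>j. k - j" and j = "\<lambda>j. k - j" and h = q and T = UNIV]) auto
  have "2 * (\<Sum>\<^sub>\<infinity>j. q j) = (\<Sum>\<^sub>\<infinity>j. q j) + (\<Sum>\<^sub>\<infinity>j. q (k - j))" using e by simp
  also have "\<dots> = (\<Sum>\<^sub>\<infinity>j. q j + q (k - j))" by (rule infsum_add[OF s s2, symmetric])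
  also have "\<dots> = (\<Sum>\<^sub>\<infinity>j. of_int k * (a j * a (k - j)))" by (simp add: q_def algebra_simps)
  also have "\<dots> = of_int k * (\<Sum>\<^sub>\<infinity>j. a j * a (k - j))" by (rule infsum_cmult_right')
  finally show ?thesis by (simp add: q_def)
qed

lemma fourier_rhs:
  assumes w1: "has_weak_deriv 1 u ux" and w3: "has_weak_deriv 3 u uxxx" and w5: "has_weak_deriv 5 u uxxxxx"
  shows "integrable circle (\<lambda>x. - u x * ux x - uxxx x + uxxxxx x)"
    and "fourier (\<lambda>x. - u x * ux x - uxxx x + uxxxxx x) k = kawahara_rhs 0 (fourier u) k"
proof -
  have L: "u \<in> L2_per" "ux \<in> L2_per" "uxxx \<in> L2_per" "uxxxxx \<in> L2_per"
    using assms by (auto simp: has_weak_deriv_def)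
  note s = L[THEN L2_per_sq_integrable]
  have i0: "integrable circle (\<lambda>x. u x * ux x)" by (rule integrable_mult_sq_integrable[OF s(1,2)])
  have i3: "integrable circle uxxx" and i5: "integrable circle uxxxxx" by (intro sq_integrable_integrable s)+
  have i: "integrable circle (\<lambda>x. uxxxxx x - uxxx x)" using i3 i5 by simp
  have eq: "(\<lambda>x. - u x * ux x - uxxx x + uxxxxx x) = (\<lambda>x. (uxxxxx x - uxxx x) - u x * ux x)" by (simp add: fun_eq_iff)
  show "integrable circle (\<lambda>x. - u x * ux x - uxxx x + uxxxxx x)" unfolding eq using i i0 by simp
  have hs: "((\<lambda>j. fourier u j * fourier ux (k - j)) has_sum fourier (\<lambda>x. u x * ux x) k) UNIV" by (rule fourier_product[OF L(1,2)])
  have q: "fourier u j * fourier ux (k - j) = (2 * pi * \<i>) * (fourier u j * (of_int (k - j) * fourier u (k - j)))" for j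
    using fourier_weak_deriv[OF w1, of "k - j"] by (simp add: mult_ac)
  have "(\<lambda>j. (2 * pi * \<i>) * (fourier u j * (of_int (k - j) * fourier u (k - j)))) summable_on UNIV"
    using hs unfolding q summable_on_def by blast
  then have sm: "(\<lambda>j. fourier u j * (of_int (k - j) * fourier u (k - j))) summable_on UNIV"
    by (subst (asm) summable_on_cmult_right') auto
  have "fourier (\<lambda>x. u x * ux x) k = (\<Sum>\<^sub>\<infinity>j. (2 * pi * \<i>) * (fourier u j * (of_int (k - j) * fourier u (k - j))))"
    using infsumI[OF hs] unfolding q by simp
  also have "\<dots> = (2 * pi * \<i>) * (\<Sum>\<^sub>\<infinity>j. fourier u j * (of_int (k - j) * fourier u (k - j)))" by (rule infsum_cmult_right')
  also have "\<dots> = (pi * \<i>) * (2 * (\<Sum>\<^sub>\<infinity>j. fourier u j * (of_int (k - j) * fourier u (k - j))))" by simp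
  also have "\<dots> = (pi * \<i>) * (of_int k * (\<Sum>\<^sub>\<infinity>j. fourier u j * fourier u (k - j)))" by (simp only: convolution_derivative[OF sm])
  finally have n: "fourier (\<lambda>x. u x * ux x) k = \<i> * (pi * k) * (\<Sum>\<^sub>\<infinity>j. fourier u j * fourier u (k - j))" by (simp add: mult_ac)
  have "fourier (\<lambda>x. - u x * ux x - uxxx x + uxxxxx x) k = (fourier uxxxxx k - fourier uxxx k) - fourier (\<lambda>x. u x * ux x) k"
    unfolding eq fourier_diff[OF i i0] fourier_diff[OF i5 i3] ..
  also have "fourier uxxxxx k - fourier uxxx k = \<i> * of_real (dispersion 0 k) * fourier u k"
    using derivative_symbol[of k "fourier u k"] fourier_weak_deriv[OF w3, of k] fourier_weak_deriv[OF w5, of k] by simp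
  finally show "fourier (\<lambda>x. - u x * ux x - uxxx x + uxxxxx x) k = kawahara_rhs 0 (fourier u) k"
    unfolding n kawahara_rhs_def .
qed

section \<open>Time derivatives and regularity read off the coefficients\<close>

lemma has_L2_derivative_fourier:
  assumes "has_L2_derivative U v t"
  shows "((\<lambda>s. fourier (U s) k) has_vector_derivative fourier v k) (at t)"
proof -
  have U: "\<And>s. U s \<in> L2_per" "v \<in> L2_per" and
    lim: "((\<lambda>h. L2_norm (\<lambda>x. (U (t + h) x - U t x) / h - v x)) \<longlongrightarrow> 0) (at 0)"
    using assms by (auto simp: has_L2_derivative_def)
  have bd: "cmod (fourier (U (t + h)) k - fourier (U t) k - h *\<^sub>R fourier v k) / norm h \<le> L2_norm (\<lambda>x. (U (t + h) x - U t x) / h - v x)"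
    if h: "h \<noteq> 0" for h
  proof -
    have L: "(\<lambda>x. (1 / h) * (U (t + h) x - U t x) - v x) \<in> L2_per"
      by (intro L2_per_diff L2_per_cmult U)
    have ii: "integrable circle (U s)" "integrable circle v" for s by (intro sq_integrable_integrable L2_per_sq_integrable U)+
    have "fourier (\<lambda>x. (1 / h) * (U (t + h) x - U t x) - v x) k = of_real (1 / h) * (fourier (U (t + h)) k - fourier (U t) k) - fourier v k"
      using ii by (subst fourier_diff, simp, simp) (subst fourier_cmult, simp, simp add: fourier_diff)
    also have "\<dots> = (fourier (U (t + h)) k - fourier (U t) k - h *\<^sub>R fourier v k) / of_real h"
      using h by (simp add: field_simps scaleR_conv_of_real)
    finally have "cmod (fourier (U (t + h)) k - fourier (U t) k - h *\<^sub>R fourier v k) / norm h = cmod (fourier (\<lambda>x. (1 / h) * (U (t + h) x - U t x) - v x) k)"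
      by (simp add: norm_divide)
    also have "\<dots> \<le> L2_norm (\<lambda>x. (1 / h) * (U (t + h) x - U t x) - v x)"
      unfolding L2_norm_circle by (rule fourier_bound[OF L2_per_sq_integrable[OF L]])
    finally show ?thesis by simp
  qed
  have "((\<lambda>h. cmod (fourier (U (t + h)) k - fourier (U t) k - h *\<^sub>R fourier v k) / norm h) \<longlongrightarrow> 0) (at 0)"
  proof (rule tendsto_sandwich[OF _ _ tendsto_const lim])
    show "\<forall>\<^sub>F h in at 0. cmod (fourier (U (t + h)) k - fourier (U t) k - h *\<^sub>R fourier v k) / norm h \<le> L2_norm (\<lambda>x. (U (t + h) x - U t x) / h - v x)"
      using bd by (auto simp: eventually_at intro: exI[of _ 1])
  qed simp
  then show ?thesis
    unfolding has_vector_derivative_def has_derivative_at by (simp add: bounded_linear_scaleR_left)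
qed

text \<open>The difference quotients are bounded in \<open>L\<^sup>2\<close> near the derivative, so the function itself is bounded near \<open>t\<close>.
  Together with the differentiability of the coefficients, this bound is the regularity in time on which
  the uniqueness proof rests.\<close>
lemma has_L2_derivative_locally_bounded:
  assumes "has_L2_derivative U v t"
  obtains \<delta> R where "0 < \<delta>" "\<And>s. \<bar>s - t\<bar> \<le> \<delta> \<Longrightarrow> l2_le (fourier (U s)) R"
proof -
  have U: "\<And>s. U s \<in> L2_per" "v \<in> L2_per" and
    lim: "((\<lambda>h. L2_norm (\<lambda>x. (U (t + h) x - U t x) / h - v x)) \<longlongrightarrow> 0) (at 0)"
    using assms by (auto simp: has_L2_derivative_def)
  define q where "q h x = (1 / h) * (U (t + h) x - U t x) - v x" for h x
  have Lq: "q h \<in> L2_per" for h unfolding q_def by (intro L2_per_diff L2_per_cmult U)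
  have "\<forall>\<^sub>F h in at 0. L2_norm (q h) < 1"
  proof -
    have "(\<lambda>x. (U (t + h) x - U t x) / h - v x) = q h" for h by (simp add: q_def fun_eq_iff)
    then show ?thesis using order_tendstoD(2)[OF lim, of 1] by simp
  qed
  then obtain d where d: "0 < d" "\<And>h. h \<noteq> 0 \<Longrightarrow> \<bar>h\<bar> < d \<Longrightarrow> L2_norm (q h) < 1"
    by (auto simp: eventually_at dist_real_def)
  define A B where "A = (LINT x|circle. (U t x)\<^sup>2)" and "B = (LINT x|circle. (v x)\<^sup>2)"
  have lA: "l2_le (fourier (U t)) A" and lB: "l2_le (fourier v) B" unfolding A_def B_def by (intro bessel L2_per_sq_integrable U)+
  show ?thesis
  proof (rule that[of "min (d / 2) 1" "3 * (A + B + 1)"])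
    show "0 < min (d / 2) 1" using d(1) by simp
    fix s assume s: "\<bar>s - t\<bar> \<le> min (d / 2) 1"
    define h where "h = s - t"
    have h1: "\<bar>h\<bar> \<le> 1" and hd: "\<bar>h\<bar> < d" using s d(1) by (auto simp: h_def)
    have sth: "s = t + h" by (simp add: h_def)
    have "l2_le (fourier (q h)) 1 \<or> h = 0"
    proof (cases "h = 0")
      case False
      have "L2_norm (q h) < 1" by (rule d(2)[OF False hd])
      then have "(LINT x|circle. (q h x)\<^sup>2) \<le> 1" by (simp add: L2_norm_circle)
      then show ?thesis using finsum_le_mono[OF bessel[OF L2_per_sq_integrable[OF Lq[of h]]] order_refl] by blast
    qed simp
    then obtain z where z: "l2_le z 1" "\<And>k. fourier (U s) k = fourier (U t) k + of_real h * fourier v k + of_real h * z k"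
    proof
      assume a: "l2_le (fourier (q h)) 1"
      show thesis
      proof (cases "h = 0")
        case False
        have ii: "integrable circle (U s)" "integrable circle v" for s by (intro sq_integrable_integrable L2_per_sq_integrable U)+
        have "fourier (q h) k = of_real (1 / h) * (fourier (U (t + h)) k - fourier (U t) k) - fourier v k" for k
          unfolding q_def using ii by (subst fourier_diff, simp, simp) (subst fourier_cmult, simp, simp add: fourier_diff)
        then have "fourier (U s) k = fourier (U t) k + of_real h * fourier v k + of_real h * fourier (q h) k" for k
          using False by (simp add: sth field_simps)
        then show thesis using that a by blast
      next
        case True then show thesis using that[of "\<lambda>_. 0"] by (simp add: sth finsum_le_def)
      qed
    next
      assume "h = 0" then show thesis using that[of "\<lambda>_. 0"] by (simp add: sth finsum_le_def)
    qed
    have "finsum_le (\<lambda>k. 3 * ((cmod (fourier (U t) k))\<^sup>2 + (cmod (fourier v k))\<^sup>2 + (cmod (z k))\<^sup>2)) (3 * (A + B + 1))"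
      by (intro finsum_le_cmult finsum_le_add lA lB z(1)) simp
    then show "l2_le (fourier (U s)) (3 * (A + B + 1))"
    proof (rule finsum_le_mono)
      fix k
      have hx: "\<bar>h\<bar> * x \<le> x" if "0 \<le> x" for x using mult_right_mono[OF h1 that] by simp
      have "cmod (fourier (U s) k) \<le> cmod (fourier (U t) k) + \<bar>h\<bar> * cmod (fourier v k) + \<bar>h\<bar> * cmod (z k)"
        unfolding z(2) by (intro order_trans[OF norm_triangle_ineq] add_mono order_refl) (simp_all add: norm_mult)
      also have "\<dots> \<le> cmod (fourier (U t) k) + cmod (fourier v k) + cmod (z k)" by (intro add_mono hx) auto
      finally have "(cmod (fourier (U s) k))\<^sup>2 \<le> (cmod (fourier (U t) k) + cmod (fourier v k) + cmod (z k))\<^sup>2" by (intro power_mono) auto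
      also have "\<dots> \<le> 3 * ((cmod (fourier (U t) k))\<^sup>2 + (cmod (fourier v k))\<^sup>2 + (cmod (z k))\<^sup>2)"
        using sum_squares_bound[of "cmod (fourier (U t) k)" "cmod (fourier v k)"] sum_squares_bound[of "cmod (fourier (U t) k)" "cmod (z k)"]
          sum_squares_bound[of "cmod (z k)" "cmod (fourier v k)"]
        by (simp add: power2_eq_square algebra_simps)
      finally show "(cmod (fourier (U s) k))\<^sup>2 \<le> 3 * ((cmod (fourier (U t) k))\<^sup>2 + (cmod (fourier v k))\<^sup>2 + (cmod (z k))\<^sup>2)" .
    qed simp
  qed
qed

lemma fourier_decay_of_weak_deriv:
  assumes "has_weak_deriv 5 g w" shows "\<bar>real_of_int k\<bar> ^ 5 * cmod (fourier g k) \<le> cmod (fourier w k)"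
proof -
  have "1 \<le> (2 * pi) ^ 5" using pi_ge_two by (intro one_le_power) auto
  have "cmod (fourier w k) = (2 * pi) ^ 5 * (\<bar>real_of_int k\<bar> ^ 5 * cmod (fourier g k))"
    unfolding fourier_weak_deriv[OF assms] by (simp add: norm_mult norm_power power_mult_distrib)
  moreover have "1 * (\<bar>real_of_int k\<bar> ^ 5 * cmod (fourier g k)) \<le> (2 * pi) ^ 5 * (\<bar>real_of_int k\<bar> ^ 5 * cmod (fourier g k))"
    using \<open>1 \<le> (2 * pi) ^ 5\<close> by (intro mult_right_mono) auto
  ultimately show ?thesis by simp
qed

text \<open>The coefficients of the fifth weak derivative are bounded by its \<open>L\<^sup>2\<close> norm.\<close>
lemma fourier_decay_H5:
  assumes "g \<in> H_per 5" obtains A where "\<And>k. k \<noteq> 0 \<Longrightarrow> cmod (fourier g k) \<le> A * inv_abs k ^ 5"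
proof -
  obtain w where w: "has_weak_deriv 5 g w" using assms by (auto simp: H_per_def)
  then have "w \<in> L2_per" by (simp add: has_weak_deriv_def)
  then have b: "cmod (fourier w k) \<le> L2_norm w" for k unfolding L2_norm_circle by (intro fourier_bound L2_per_sq_integrable)
  have "cmod (fourier g k) \<le> L2_norm w * inv_abs k ^ 5" if k: "k \<noteq> 0" for k
  proof -
    have "\<bar>real_of_int k\<bar> ^ 5 * cmod (fourier g k) * inv_abs k ^ 5 \<le> L2_norm w * inv_abs k ^ 5"
      using fourier_decay_of_weak_deriv[OF w, of k] b[of k] by (intro mult_right_mono) auto
    moreover have "\<bar>real_of_int k\<bar> ^ 5 * cmod (fourier g k) * inv_abs k ^ 5 = (\<bar>real_of_int k\<bar> * inv_abs k) ^ 5 * cmod (fourier g k)"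
      by (simp add: power_mult_distrib)
    ultimately show ?thesis using abs_mult_inv_abs[OF k] by simp
  qed
  then show ?thesis by (rule that)
qed

section \<open>The coefficients of an arbitrary solution\<close>

lemma is_solution_fourier:
  assumes sol: "is_solution f v"
  defines "a \<equiv> (\<lambda>t. fourier (\<lambda>x. v x t))"
  shows "((\<lambda>t. a t k) has_vector_derivative kawahara_rhs 0 (a t) k) (at t)"
    and "\<exists>\<delta>>0. \<exists>R. \<forall>s. \<bar>s - t\<bar> \<le> \<delta> \<longrightarrow> l2_le (a s) R"
    and "\<exists>A. \<forall>k. k \<noteq> 0 \<longrightarrow> cmod (a t k) \<le> A * inv_abs k ^ 5"
    and "(\<lambda>x. v x t) \<in> L2_per" and "a 0 = fourier f"
proof -
  obtain ut ux uxxx uxxxxx where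
    H: "(\<lambda>x. v x t) \<in> H_per 5" and d: "has_L2_derivative (\<lambda>s x. v x s) ut t" and
    w: "has_weak_deriv 1 (\<lambda>x. v x t) ux" "has_weak_deriv 3 (\<lambda>x. v x t) uxxx" "has_weak_deriv 5 (\<lambda>x. v x t) uxxxxx" and
    ae: "AE x in lebesgue. ut x = - v x t * ux x - uxxx x + uxxxxx x"
    using sol unfolding is_solution_def by blast
  have ut: "ut \<in> L2_per" using d by (simp add: has_L2_derivative_def)
  have "fourier ut k = fourier (\<lambda>x. - v x t * ux x - uxxx x + uxxxxx x) k"
    unfolding fourier_def
  proof (rule integral_cong_AE)
    show "(\<lambda>x. of_real (ut x) * expk (- k) x) \<in> borel_measurable circle"
      using integrable_mult_expk[OF sq_integrable_integrable[OF L2_per_sq_integrable[OF ut]], of "- k"] by (rule borel_measurable_integrable)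
    show "(\<lambda>x. of_real (- v x t * ux x - uxxx x + uxxxxx x) * expk (- k) x) \<in> borel_measurable circle"
      using integrable_mult_expk[OF fourier_rhs(1)[OF w], of "- k"] by (rule borel_measurable_integrable)
    show "AE x in circle. of_real (ut x) * expk (- k) x = of_real (- v x t * ux x - uxxx x + uxxxxx x) * expk (- k) x"
      using AE_circle[OF ae] by eventually_elim (simp only:)
  qed
  also have "\<dots> = kawahara_rhs 0 (a t) k" unfolding a_def by (rule fourier_rhs(2)[OF w])
  finally have e: "fourier ut k = kawahara_rhs 0 (a t) k" .
  show "((\<lambda>t. a t k) has_vector_derivative kawahara_rhs 0 (a t) k) (at t)"
    using has_L2_derivative_fourier[OF d, of k] unfolding e[symmetric] by (simp add: a_def)
  show "\<exists>\<delta>>0. \<exists>R. \<forall>s. \<bar>s - t\<bar> \<le> \<delta> \<longrightarrow> l2_le (a s) R"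
    using has_L2_derivative_locally_bounded[OF d] unfolding a_def by metis
  show "\<exists>A. \<forall>k. k \<noteq> 0 \<longrightarrow> cmod (a t k) \<le> A * inv_abs k ^ 5"
    using fourier_decay_H5[OF H] unfolding a_def by metis
  show "(\<lambda>x. v x t) \<in> L2_per" using H by (simp add: H_per_def)
  show "a 0 = fourier f"
    using sol unfolding a_def is_solution_def by simp
qed

text \<open>Removing the mean of a solution gives a solution of the system on the nonzero frequencies. The mean is conserved
  because the right hand side vanishes at frequency 0.\<close>
lemma is_solution_meanfree:
  assumes sol: "is_solution f v"
  defines "z \<equiv> (\<lambda>t k. if k = 0 then 0 else fourier (\<lambda>x. v x t) k)"
  shows "fourier_system (Re (fourier f 0)) (UNIV - {0}) z UNIV" and "fourier (\<lambda>x. v x t) 0 = fourier f 0"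
    and "\<exists>\<delta>>0. \<exists>R. \<forall>s. \<bar>s - t\<bar> \<le> \<delta> \<longrightarrow> l2_le (z s) R"
    and "\<exists>A. \<forall>k. cmod (z t k) \<le> A * inv_abs k ^ 5"
proof -
  define a where "a = (\<lambda>t. fourier (\<lambda>x. v x t))"
  have at: "fourier (\<lambda>x. v x t) = a t" for t by (simp add: a_def)
  note sf = is_solution_fourier[OF sol, unfolded at]
  have "\<exists>c. \<forall>t. a t 0 = c"
  proof -
    have "((\<lambda>t. a t 0) has_vector_derivative 0) (at t within UNIV)" for t
      using sf(1)[of 0 t] by (simp add: kawahara_rhs_0)
    then obtain c where "\<And>t. a t 0 = c"
      using has_vector_derivative_zero_constant[of UNIV "\<lambda>t. a t 0"] by auto
    then show ?thesis by blast
  qed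
  then have m: "a t 0 = fourier f 0" for t using sf(5) by metis
  then show "fourier (\<lambda>x. v x t) 0 = fourier f 0" by (simp add: a_def)
  have real: "fourier f 0 = of_real (Re (fourier f 0))"
    using fourier_uminus[of f 0] by (simp add: complex_eq_iff)
  have za: "z t k = (if k = 0 then 0 else a t k)" for t k by (simp add: z_def a_def)
  have zl: "l2_le (z t) R" if "l2_le (a t) R" for t R
    by (rule finsum_le_mono[OF that]) (auto simp: za)
  show "fourier_system (Re (fourier f 0)) (UNIV - {0}) z UNIV"
    unfolding fourier_system_def
  proof (intro conjI ballI allI impI)
    fix t :: real and k :: int
    show "z t k = 0" if "k \<notin> UNIV - {0}" using that by (simp add: za)
    assume "k \<in> UNIV - {0}"
    then have k: "k \<noteq> 0" by simp
    have l: "l2_le (z t) (LINT x|circle. (v x t)\<^sup>2)" by (rule zl) (unfold a_def, rule bessel[OF L2_per_sq_integrable[OF sf(4)]])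
    have "kawahara_rhs 0 (a t) k = kawahara_rhs (Re (fourier f 0)) (z t) k"
      by (rule kawahara_rhs_mean_shift[OF l _ _ k]) (simp_all add: za m real[symmetric])
    then show "((\<lambda>s. z s k) has_vector_derivative kawahara_rhs (Re (fourier f 0)) (z t) k) (at t)"
      using sf(1)[of k t] k by (simp add: za)
  qed simp
  show "\<exists>\<delta>>0. \<exists>R. \<forall>s. \<bar>s - t\<bar> \<le> \<delta> \<longrightarrow> l2_le (z s) R"
    using sf(2)[of t] zl by meson
  obtain A where A: "\<And>k. k \<noteq> 0 \<Longrightarrow> cmod (a t k) \<le> A * inv_abs k ^ 5" using sf(3)[of t] by blast
  have "cmod (z t k) \<le> A * inv_abs k ^ 5" for k using A[of k] by (cases "k = 0") (simp_all add: za)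
  then show "\<exists>A. \<forall>k. cmod (z t k) \<le> A * inv_abs k ^ 5" by blast
qed

theorem solution_unique:
  assumes u: "is_solution f u" and v: "is_solution f v"
  shows "AE x in lebesgue. v x t = u x t"
proof -
  define z :: "(real \<Rightarrow> real \<Rightarrow> real) \<Rightarrow> real \<Rightarrow> int \<Rightarrow> complex"
    where "z = (\<lambda>w t k. if k = 0 then 0 else fourier (\<lambda>x. w x t) k)"
  note U = is_solution_meanfree[OF u] and V = is_solution_meanfree[OF v]
  have "z u t = z v t"
  proof (rule meanfree_uniqueness[where m = "Re (fourier f 0)" and K = "UNIV - {0}" and u = "z u" and w = "z v"])
    show "fourier_system (Re (fourier f 0)) (UNIV - {0}) (z u) UNIV" "fourier_system (Re (fourier f 0)) (UNIV - {0}) (z v) UNIV"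
      unfolding z_def by (rule U(1), rule V(1))
    have e: "(\<lambda>x. u x 0) = (\<lambda>x. v x 0)" using u v by (simp add: is_solution_def fun_eq_iff)
    show "z u 0 = z v 0" unfolding z_def e ..
    fix t
    obtain d R where d: "0 < d" "\<And>s. \<bar>s - t\<bar> \<le> d \<Longrightarrow> l2_le (z u s) R" using U(3)[of t] unfolding z_def by blast
    obtain d' R' where d': "0 < d'" "\<And>s. \<bar>s - t\<bar> \<le> d' \<Longrightarrow> l2_le (z v s) R'" using V(3)[of t] unfolding z_def by blast
    show "\<exists>\<delta>>0. \<exists>R. \<forall>s. \<bar>s - t\<bar> \<le> \<delta> \<longrightarrow> l2_le (z u s) R \<and> l2_le (z v s) R"
    proof -
      have "l2_le (z u s) (max R R') \<and> l2_le (z v s) (max R R')" if "\<bar>s - t\<bar> \<le> min d d'" for s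
        using finsum_le_mono[OF d(2)[of s] order_refl, of "max R R'"] finsum_le_mono[OF d'(2)[of s] order_refl, of "max R R'"] that by auto
      moreover have "0 < min d d'" using d d' by simp
      ultimately show ?thesis by blast
    qed
    show "\<exists>A. \<forall>k. cmod (z u t k) \<le> A * inv_abs k ^ 5" unfolding z_def by (rule U(4))
  qed
  then have e: "fourier (\<lambda>x. v x t) k = fourier (\<lambda>x. u x t) k" for k
    using U(2)[of t] V(2)[of t] unfolding z_def fun_eq_iff by (cases "k = 0") (simp_all, metis)
  show ?thesis
  proof (rule fourier_determines[OF _ _ _ _ e])
    show "integrable circle (\<lambda>x. v x t)" "integrable circle (\<lambda>x. u x t)"
      by (intro sq_integrable_integrable L2_per_sq_integrable is_solution_fourier(4)[OF u] is_solution_fourier(4)[OF v])+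
  qed (use is_solution_fourier(4)[OF u] is_solution_fourier(4)[OF v] in \<open>auto simp: L2_per_iff\<close>)
qed

section \<open>Realizing a coefficient solution by functions\<close>

text \<open>By Parseval's identity the norm of the error of the difference quotient is a sum over the frequencies. Each term tends
  to 0, and by the mean value theorem the terms are dominated by a summable sequence.\<close>
lemma L2_derivative_of_coefficients:
  assumes G: "\<And>t. G t \<in> L2_per" and w: "w \<in> L2_per"
    and der: "\<And>s k. ((\<lambda>t. fourier (G t) k) has_vector_derivative d s k) (at s)"
    and dom: "\<And>s k. \<bar>s - t\<bar> \<le> 1 \<Longrightarrow> cmod (d s k) \<le> E k" and E: "square_summable E"
    and wd: "\<And>k. fourier w k = d t k"
  shows "has_L2_derivative G w t"
  unfolding has_L2_derivative_def
proof (intro conjI allI G w)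
  define q where "q h x = (1 / h) * (G (t + h) x - G t x) - w x" for h x
  have q: "(\<lambda>x. (G (t + h) x - G t x) / h - w x) = q h" for h by (simp add: q_def fun_eq_iff)
  have Lq: "q h \<in> L2_per" for h unfolding q_def by (intro L2_per_diff L2_per_cmult G w)
  have fq: "fourier (q h) k = of_real (1 / h) * (fourier (G (t + h)) k - fourier (G t) k) - d t k" for h k
  proof -
    have ii: "integrable circle (G s)" "integrable circle w" for s by (intro sq_integrable_integrable L2_per_sq_integrable G w)+
    show ?thesis unfolding q_def wd[symmetric] using ii by (subst fourier_diff, simp, simp) (subst fourier_cmult, simp, simp add: fourier_diff)
  qed
  have lim: "((\<lambda>h. fourier (q h) k) \<longlongrightarrow> 0) (at 0)" for k
  proof -
    have "((\<lambda>h. cmod (fourier (G (t + h)) k - fourier (G t) k - h *\<^sub>R d t k) / norm h) \<longlongrightarrow> 0) (at 0)"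
      using der[of k t] unfolding has_vector_derivative_def has_derivative_at by blast
    moreover have "\<forall>\<^sub>F h in at 0. cmod (fourier (G (t + h)) k - fourier (G t) k - h *\<^sub>R d t k) / norm h = cmod (fourier (q h) k)"
    proof -
      have "cmod (fourier (G (t + h)) k - fourier (G t) k - h *\<^sub>R d t k) / norm h = cmod (fourier (q h) k)" if "h \<noteq> 0" for h
      proof -
        have "fourier (q h) k = (fourier (G (t + h)) k - fourier (G t) k - h *\<^sub>R d t k) / of_real h"
          using that by (simp add: fq field_simps scaleR_conv_of_real)
        then show ?thesis by (simp add: norm_divide)
      qed
      then show ?thesis by (auto simp: eventually_at intro: exI[of _ 1])
    qed
    ultimately have "((\<lambda>h. cmod (fourier (q h) k)) \<longlongrightarrow> 0) (at 0)" by (rule Lim_transform_eventually)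
    then show ?thesis by (rule tendsto_norm_zero_cancel)
  qed
  have bd: "cmod (fourier (q h) k) \<le> 2 * E k" if h: "\<bar>h\<bar> < 1" "h \<noteq> 0" for h k
  proof -
    have "cmod (fourier (G (t + h)) k - fourier (G t) k) \<le> E k * \<bar>(t + h) - t\<bar>"
    proof (rule vector_mean_value_bound[where S = "cball t 1"])
      fix x assume "x \<in> cball t 1"
      then have "\<bar>x - t\<bar> \<le> 1" by (simp add: dist_real_def abs_minus_commute)
      then show "cmod (d x k) \<le> E k" by (rule dom)
      show "((\<lambda>t. fourier (G t) k) has_vector_derivative d x k) (at x within cball t 1)"
        by (rule has_vector_derivative_at_within[OF der])
    qed (use h in \<open>auto simp: dist_real_def\<close>)
    then have "cmod (fourier (G (t + h)) k - fourier (G t) k) / \<bar>h\<bar> \<le> E k" using h(2) by (simp add: divide_le_eq)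
    moreover have "cmod (of_real (1 / h) * (fourier (G (t + h)) k - fourier (G t) k)) = cmod (fourier (G (t + h)) k - fourier (G t) k) / \<bar>h\<bar>"
      by (simp add: norm_mult norm_divide)
    ultimately have "cmod (of_real (1 / h) * (fourier (G (t + h)) k - fourier (G t) k)) \<le> E k" by simp
    moreover have "cmod (d t k) \<le> E k" by (rule dom) simp
    ultimately show ?thesis unfolding fq using norm_triangle_ineq4[of "of_real (1 / h) * (fourier (G (t + h)) k - fourier (G t) k)" "d t k"] by linarith
  qed
  obtain R where R: "finsum_le (\<lambda>k. (E k)\<^sup>2) R" using E by (auto simp: square_summable_def)
  then have R4: "finsum_le (\<lambda>k. 4 * (E k)\<^sup>2) (4 * R)" by (rule finsum_le_cmult) simp
  have "((\<lambda>h. \<Sum>\<^sub>\<infinity>k. (cmod (fourier (q h) k))\<^sup>2) \<longlongrightarrow> (\<Sum>\<^sub>\<infinity>k::int. 0)) (at 0)"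
  proof (rule infsum_tendsto_dominated[OF _ _ _ R4])
    show "((\<lambda>h. (cmod (fourier (q h) k))\<^sup>2) \<longlongrightarrow> 0) (at 0)" for k
      using tendsto_power[OF tendsto_norm_zero[OF lim[of k]], of 2] by simp
    show "\<forall>\<^sub>F h in at 0. \<forall>k. norm ((cmod (fourier (q h) k))\<^sup>2) \<le> 4 * (E k)\<^sup>2"
    proof -
      have "norm ((cmod (fourier (q h) k))\<^sup>2) \<le> 4 * (E k)\<^sup>2" if "\<bar>h\<bar> < 1" "h \<noteq> 0" for h k
        using power_mono[OF bd[OF that, of k], of 2] by (simp add: power_mult_distrib)
      then show ?thesis by (auto simp: eventually_at dist_real_def intro!: exI[of _ 1])
    qed
  qed simp
  moreover have "(\<Sum>\<^sub>\<infinity>k. (cmod (fourier (q h) k))\<^sup>2) = (L2_norm (q h))\<^sup>2" for h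
    by (rule infsumI[OF parseval[OF Lq]])
  ultimately have "((\<lambda>h. (L2_norm (q h))\<^sup>2) \<longlongrightarrow> 0) (at 0)" by simp
  from tendsto_real_sqrt[OF this] have "((\<lambda>h. \<bar>L2_norm (q h)\<bar>) \<longlongrightarrow> 0) (at 0)" by simp
  then have "((\<lambda>h. L2_norm (q h)) \<longlongrightarrow> 0) (at 0)" by (rule tendsto_rabs_zero_cancel)
  then show "((\<lambda>h. L2_norm (\<lambda>x. (G (t + h) x - G t x) / h - w x)) \<longlongrightarrow> 0) (at 0)" unfolding q .
qed

lemma square_summable_realization:
  assumes "\<And>k. c (- k) = cnj (c k)" "square_summable (\<lambda>k. cmod (c k))"
  obtains g where "g \<in> L2_per" "\<And>k. fourier g k = c k"
proof -
  obtain R where "l2_le c R" using assms(2) by (auto simp: square_summable_def)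
  from riesz_fischer[OF assms(1) this] show ?thesis using that by blast
qed

text \<open>The dominating sequence \<open>M\<close> controls both the \<open>H\<^sup>5\<close> norm and the time derivative. It consists of the
  coefficients of the fifth derivative of the data, which are square summable, and of the correction from
  \<open>meanfree_existence\<close>, of order \<open>\<bar>k\<bar>^5 \<bar>k\<bar>^(-6)\<close>.\<close>
lemma coefficient_solution:
  assumes f: "f \<in> H_per 5"
  obtains U where "U 0 = fourier f" "\<And>t k. U t (- k) = cnj (U t k)"
    "\<And>t k. ((\<lambda>t. U t k) has_vector_derivative kawahara_rhs 0 (U t) k) (at t)"
    "\<And>\<tau>. \<exists>M. square_summable M \<and> (\<forall>t k. \<bar>t\<bar> \<le> \<tau> \<longrightarrow> (1 + \<bar>real_of_int k\<bar> ^ 5) * cmod (U t k) \<le> M k \<and> cmod (kawahara_rhs 0 (U t) k) \<le> M k)"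
proof -
  define m where "m = Re (fourier f 0)"
  have m: "fourier f 0 = of_real m" using fourier_uminus[of f 0] by (simp add: m_def complex_eq_iff)
  define c where "c k = (if k = 0 then 0 else fourier f k)" for k
  have fL: "f \<in> L2_per" using f by (simp add: H_per_def)
  obtain w where w: "has_weak_deriv 5 f w" using f by (auto simp: H_per_def)
  then have wL: "w \<in> L2_per" by (simp add: has_weak_deriv_def)
  obtain A where A: "\<And>k. k \<noteq> 0 \<Longrightarrow> cmod (fourier f k) \<le> A * inv_abs k ^ 5" using fourier_decay_H5[OF f] by blast
  have c_cnj: "c (- k) = cnj (c k)" for k by (simp add: c_def fourier_uminus)
  have c0: "c 0 = 0" by (simp add: c_def)
  have cA: "cmod (c k) \<le> A * inv_abs k ^ 5" for k using A by (simp add: c_def)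
  have cR: "l2_le c (LINT x|circle. (f x)\<^sup>2)"
    by (rule finsum_le_mono[OF bessel[OF L2_per_sq_integrable[OF fL]]]) (auto simp: c_def)
  obtain u where u: "fourier_system m (UNIV - {0}) u UNIV" "u 0 = c" "\<And>t k. u t (- k) = cnj (u t k)"
    "\<And>\<tau>. \<exists>D\<ge>0. \<forall>t k. \<bar>t\<bar> \<le> \<tau> \<longrightarrow> cmod (u t k) \<le> cmod (c k) + D * inv_abs k ^ 6"
    using meanfree_existence[OF c_cnj c0 cR cA, of m] by blast
  have u0: "u t 0 = 0" for t using u(1) by (simp add: fourier_system_def)
  define U where "U t k = (if k = 0 then of_real m else u t k)" for t k
  have uB: "\<exists>B. \<forall>k. cmod (u t k) \<le> B * inv_abs k ^ 5" for t
  proof -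
    obtain D where D: "0 \<le> D" "\<And>k. cmod (u t k) \<le> cmod (c k) + D * inv_abs k ^ 6" using u(4)[of "\<bar>t\<bar>"] by auto
    have "cmod (u t k) \<le> (A + D) * inv_abs k ^ 5" for k
      using D(2)[of k] cA[of k] mult_left_mono[OF power_decreasing[of 5 6 "inv_abs k"] D(1)] by (simp add: distrib_right)
    then show ?thesis by blast
  qed
  have ul2: "\<exists>R. l2_le (u t) R" for t
  proof -
    obtain B where B: "\<And>k. cmod (u t k) \<le> B * inv_abs k ^ 5" using uB by blast
    have B0: "0 \<le> B" using B[of 1] order_trans[OF norm_ge_zero] by (auto simp: inv_abs_def)
    have "cmod (u t k) \<le> B * inv_abs k ^ 2" for k
      using B[of k] mult_left_mono[OF inv_abs_power_le_2[of 5 k] B0] by linarith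
    from l2_le_of_decay[OF this] show ?thesis by blast
  qed
  have shift: "kawahara_rhs 0 (U t) k = kawahara_rhs m (u t) k" if k: "k \<noteq> 0" for t k
    using ul2[of t] kawahara_rhs_mean_shift[of "u t" _ "U t" m k] u0 k by (auto simp: U_def)
  have der: "((\<lambda>t. U t k) has_vector_derivative kawahara_rhs 0 (U t) k) (at t)" for t k
  proof (cases "k = 0")
    case True then show ?thesis by (simp add: U_def kawahara_rhs_0)
  next
    case False
    then have "((\<lambda>t. u t k) has_vector_derivative kawahara_rhs m (u t) k) (at t)" using u(1) by (simp add: fourier_system_def)
    then show ?thesis using False by (simp add: U_def[abs_def] shift[unfolded U_def[abs_def]])
  qed
  have bound: "\<exists>M. square_summable M \<and> (\<forall>t k. \<bar>t\<bar> \<le> \<tau> \<longrightarrow> (1 + \<bar>real_of_int k\<bar> ^ 5) * cmod (U t k) \<le> M k \<and> cmod (kawahara_rhs 0 (U t) k) \<le> M k)" for \<tau>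
  proof -
    obtain D where D: "0 \<le> D" "\<And>t k. \<bar>t\<bar> \<le> \<tau> \<Longrightarrow> cmod (u t k) \<le> cmod (c k) + D * inv_abs k ^ 6" using u(4)[of \<tau>] by blast
    have A0: "0 \<le> A" using cA[of 1] order_trans[OF norm_ge_zero] by (auto simp: inv_abs_def)
    define B where "B = A + D"
    have B: "cmod (u t k) \<le> B * inv_abs k ^ 5" if "\<bar>t\<bar> \<le> \<tau>" for t k
      using D(2)[OF that, of k] cA[of k] mult_left_mono[OF power_decreasing[of 5 6 "inv_abs k"] D(1)] by (simp add: distrib_right B_def)
    \<comment> \<open>\<open>W\<close> bounds \<open>\<bar>k\<bar>^5\<close> times the coefficient: the data contribute their fifth derivative, the correction gains one power.\<close>
    define W where "W k = cmod (fourier w k) + D * inv_abs k" for k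
    have W0: "0 \<le> W k" for k using D(1) by (simp add: W_def)
    have W: "\<bar>real_of_int k\<bar> ^ 5 * cmod (u t k) \<le> W k" if "\<bar>t\<bar> \<le> \<tau>" "k \<noteq> 0" for t k
    proof -
      have "\<bar>real_of_int k\<bar> ^ 5 * cmod (u t k) \<le> \<bar>real_of_int k\<bar> ^ 5 * (cmod (c k) + D * inv_abs k ^ 6)"
        by (intro mult_left_mono D that) auto
      also have "\<dots> = \<bar>real_of_int k\<bar> ^ 5 * cmod (fourier f k) + D * ((\<bar>real_of_int k\<bar> * inv_abs k) ^ 5 * inv_abs k)"
        using that(2) by (simp add: c_def algebra_simps power_mult_distrib eval_nat_numeral)
      also have "\<dots> \<le> cmod (fourier w k) + D * (1 ^ 5 * inv_abs k)"
        unfolding abs_mult_inv_abs[OF that(2)] by (intro add_mono fourier_decay_of_weak_deriv[OF w]) auto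
      finally show ?thesis by (simp add: W_def)
    qed
    define C where "C = (2 * pi) ^ 5 + (2 * pi) ^ 3 + \<bar>m\<bar> * (2 * pi)"
    have C0: "0 \<le> C" by (simp add: C_def)
    define M where "M k = (2 + C) * W k + pi * B\<^sup>2 * 256 * inv_abs k + (if k = 0 then \<bar>m\<bar> else 0)" for k
    have Mge: "(2 + C) * W k \<le> M k" "2 * W k \<le> M k" "C * W k + pi * B\<^sup>2 * 256 * inv_abs k \<le> M k" "0 \<le> M k" for k
      using W0[of k] mult_nonneg_nonneg[OF C0 W0[of k]] mult_nonneg_nonneg[of "pi * B\<^sup>2 * 256" "inv_abs k"]
      by (auto simp: M_def distrib_right)
    have "square_summable M" unfolding M_def W_def
      by (intro square_summable_add square_summable_cmult square_summable_fourier wL square_summable_inv_abs square_summable_delta)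
    moreover have "(1 + \<bar>real_of_int k\<bar> ^ 5) * cmod (U t k) \<le> M k \<and> cmod (kawahara_rhs 0 (U t) k) \<le> M k" if t: "\<bar>t\<bar> \<le> \<tau>" for t k
    proof (cases "k = 0")
      case True
      then show ?thesis using W0[of 0] mult_nonneg_nonneg[OF C0 W0[of 0]] by (simp add: U_def M_def kawahara_rhs_0 distrib_right)
    next
      case False
      have "1 \<le> \<bar>real_of_int k\<bar> ^ 5" using False by (intro one_le_power) linarith
      then have "(1 + \<bar>real_of_int k\<bar> ^ 5) * cmod (u t k) \<le> (2 * \<bar>real_of_int k\<bar> ^ 5) * cmod (u t k)" by (intro mult_right_mono) auto
      also have "\<dots> \<le> 2 * W k" using W[OF t False] by simp
      also have "\<dots> \<le> M k" by (rule Mge)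
      finally have 1: "(1 + \<bar>real_of_int k\<bar> ^ 5) * cmod (U t k) \<le> M k" using False by (simp add: U_def)
      have om: "\<bar>dispersion m k\<bar> \<le> C * \<bar>real_of_int k\<bar> ^ 5"
      proof -
        have "\<bar>dispersion m k\<bar> * inv_abs k ^ 5 * \<bar>real_of_int k\<bar> ^ 5 \<le> C * \<bar>real_of_int k\<bar> ^ 5"
          unfolding C_def by (intro mult_right_mono dispersion_bound) auto
        moreover have "\<bar>dispersion m k\<bar> * inv_abs k ^ 5 * \<bar>real_of_int k\<bar> ^ 5 = \<bar>dispersion m k\<bar> * (\<bar>real_of_int k\<bar> * inv_abs k) ^ 5"
          by (simp only: power_mult_distrib mult_ac)
        ultimately show ?thesis using abs_mult_inv_abs[OF False] by simp
      qed
      have "cmod (kawahara_rhs m (u t) k) \<le> cmod (\<i> * dispersion m k * u t k) + cmod (\<i> * (pi * k) * (\<Sum>\<^sub>\<infinity>j. u t j * u t (k - j)))"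
        unfolding kawahara_rhs_def by (rule norm_triangle_ineq4)
      also have "\<dots> \<le> C * W k + pi * B\<^sup>2 * 256 * inv_abs k"
      proof (rule add_mono)
        have "cmod (\<i> * dispersion m k * u t k) \<le> (C * \<bar>real_of_int k\<bar> ^ 5) * cmod (u t k)"
          using om by (simp add: norm_mult mult_right_mono)
        also have "\<dots> \<le> C * W k" using mult_left_mono[OF W[OF t False] C0] by (simp add: mult.assoc)
        finally show "cmod (\<i> * dispersion m k * u t k) \<le> C * W k" .
        have "cmod (\<i> * (pi * k) * (\<Sum>\<^sub>\<infinity>j. u t j * u t (k - j))) \<le> pi * B\<^sup>2 * (2 ^ 5 * 8) * inv_abs k ^ (5 - 1)"
          by (rule kawahara_rhs_nonlinear_bound[OF _ B[OF t]]) simp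
        also have "\<dots> \<le> pi * B\<^sup>2 * (2 ^ 5 * 8) * inv_abs k ^ 1" by (intro mult_left_mono power_decreasing) auto
        finally show "cmod (\<i> * (pi * k) * (\<Sum>\<^sub>\<infinity>j. u t j * u t (k - j))) \<le> pi * B\<^sup>2 * 256 * inv_abs k" by simp
      qed
      also have "\<dots> \<le> M k" by (rule Mge)
      finally show ?thesis using 1 shift[OF False] by simp
    qed
    ultimately show ?thesis by blast
  qed
  show ?thesis
  proof (rule that[OF _ _ der bound])
    show "U 0 = fourier f" by (auto simp: fun_eq_iff U_def u(2) c_def m)
    show "U t (- k) = cnj (U t k)" for t k by (simp add: U_def u(3))
  qed
qed

section \<open>Existence and uniqueness\<close>

text \<open>The weight \<open>1 + \<bar>k\<bar>^5\<close> dominates all powers up to the fifth, also at \<open>k = 0\<close>.\<close>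
lemma power_le_one_plus: "0 \<le> x \<Longrightarrow> n \<le> 5 \<Longrightarrow> x ^ n \<le> 1 + x ^ 5" for x :: real
  by (cases "x \<le> 1") (auto intro: power_le_one add_increasing2 add_increasing power_increasing)

text \<open>At time 0 the representative is \<open>f\<close> itself, since the initial condition is required at every point. At all
  other times any function with the right coefficients will do.\<close>
theorem solution_exists:
  assumes f: "f \<in> H_per 5"
  shows "\<exists>u. is_solution f u"
proof -
  obtain U where U: "U 0 = fourier f" "\<And>t k. U t (- k) = cnj (U t k)"
    "\<And>t k. ((\<lambda>t. U t k) has_vector_derivative kawahara_rhs 0 (U t) k) (at t)"
    "\<And>\<tau>. \<exists>M. square_summable M \<and> (\<forall>t k. \<bar>t\<bar> \<le> \<tau> \<longrightarrow> (1 + \<bar>real_of_int k\<bar> ^ 5) * cmod (U t k) \<le> M k \<and> cmod (kawahara_rhs 0 (U t) k) \<le> M k)"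
    using coefficient_solution[OF f] by blast
  have wd: "\<exists>g\<in>L2_per. \<forall>k. fourier g k = (2 * pi * \<i> * of_int k) ^ n * U t k" if n: "n \<le> 5" for n t
  proof -
    obtain M where M: "square_summable M" "\<And>k. (1 + \<bar>real_of_int k\<bar> ^ 5) * cmod (U t k) \<le> M k" using U(4)[of "\<bar>t\<bar>"] by auto
    have "square_summable (\<lambda>k. cmod ((2 * pi * \<i> * of_int k) ^ n * U t k))"
    proof (rule square_summable_mono[OF square_summable_cmult[OF M(1), of "(2 * pi) ^ n"]])
      fix k
      have "cmod ((2 * pi * \<i> * of_int k) ^ n * U t k) = (2 * pi) ^ n * (\<bar>real_of_int k\<bar> ^ n * cmod (U t k))"
        by (simp add: norm_mult norm_power power_mult_distrib)
      also have "\<dots> \<le> (2 * pi) ^ n * ((1 + \<bar>real_of_int k\<bar> ^ 5) * cmod (U t k))"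
        by (intro mult_left_mono mult_right_mono power_le_one_plus n) auto
      also have "\<dots> \<le> (2 * pi) ^ n * M k" by (intro mult_left_mono M) auto
      finally show "\<bar>cmod ((2 * pi * \<i> * of_int k) ^ n * U t k)\<bar> \<le> (2 * pi) ^ n * M k" by simp
    qed
    moreover have "(2 * pi * \<i> * of_int (- k)) ^ n * U t (- k) = cnj ((2 * pi * \<i> * of_int k) ^ n * U t k)" for k
      by (simp add: U(2))
    ultimately show ?thesis using square_summable_realization[of "\<lambda>k. (2 * pi * \<i> * of_int k) ^ n * U t k"] by metis
  qed
  have fL: "f \<in> L2_per" using f by (simp add: H_per_def)
  have "\<exists>g. g \<in> L2_per \<and> (t = 0 \<longrightarrow> g = f) \<and> (\<forall>k. fourier g k = U t k)" for t
  proof (cases "t = 0")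
    case True then show ?thesis using fL U(1) by auto
  next
    case False then show ?thesis using wd[of 0 t] by auto
  qed
  then obtain G where G: "\<And>t. G t \<in> L2_per" "G 0 = f" "\<And>t k. fourier (G t) k = U t k" by metis
  have weak: "\<exists>w. has_weak_deriv n (G t) w" if n: "n \<le> 5" for n t
  proof -
    obtain w where w: "w \<in> L2_per" "\<And>k. fourier w k = (2 * pi * \<i> * of_int k) ^ n * U t k" using wd[OF n, of t] by blast
    have "has_weak_deriv n (G t) w" by (rule has_weak_deriv_of_fourier[OF G(1) w(1)]) (simp add: w(2) G(3))
    then show ?thesis by blast
  qed
  have H5: "G t \<in> H_per 5" for t using G(1) weak by (simp add: H_per_def)
  have eq: "\<exists>ut ux uxxx uxxxxx. has_L2_derivative G ut t \<and> has_weak_deriv 1 (G t) ux \<and>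
     has_weak_deriv 3 (G t) uxxx \<and> has_weak_deriv 5 (G t) uxxxxx \<and>
     (AE x in lebesgue. ut x = - G t x * ux x - uxxx x + uxxxxx x)" for t
  proof -
    obtain ux uxxx uxxxxx where w: "has_weak_deriv 1 (G t) ux" "has_weak_deriv 3 (G t) uxxx" "has_weak_deriv 5 (G t) uxxxxx"
      using weak[of 1 t] weak[of 3 t] weak[of 5 t] by auto
    obtain M where M: "square_summable M" "\<And>s k. \<bar>s\<bar> \<le> \<bar>t\<bar> + 1 \<Longrightarrow> cmod (kawahara_rhs 0 (U s) k) \<le> M k" using U(4)[of "\<bar>t\<bar> + 1"] by blast
    have d_cnj: "kawahara_rhs 0 (U t) (- k) = cnj (kawahara_rhs 0 (U t) k)" for k
    proof (rule vector_derivative_unique_at[OF U(3)[of "- k" t]])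
      have "((\<lambda>t. cnj (U t k)) has_vector_derivative cnj (kawahara_rhs 0 (U t) k)) (at t)"
        by (rule bounded_linear.has_vector_derivative[OF bounded_linear_cnj U(3)])
      then show "((\<lambda>t. U t (- k)) has_vector_derivative cnj (kawahara_rhs 0 (U t) k)) (at t)" by (simp add: U(2))
    qed
    have "square_summable (\<lambda>k. cmod (kawahara_rhs 0 (U t) k))"
      by (rule square_summable_mono[OF M(1)]) (use M(2)[of t] in auto)
    then obtain ut where ut: "ut \<in> L2_per" "\<And>k. fourier ut k = kawahara_rhs 0 (U t) k"
      using square_summable_realization[of "kawahara_rhs 0 (U t)"] d_cnj by blast
    have "has_L2_derivative G ut t"
    proof (rule L2_derivative_of_coefficients[where G = G and w = ut and d = "\<lambda>s. kawahara_rhs 0 (U s)" and E = M, OF G(1) ut(1) _ _ M(1) ut(2)])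
      show "((\<lambda>t. fourier (G t) k) has_vector_derivative kawahara_rhs 0 (U s) k) (at s)" for s k unfolding G(3) by (rule U(3))
      show "cmod (kawahara_rhs 0 (U s) k) \<le> M k" if "\<bar>s - t\<bar> \<le> 1" for s k by (rule M(2)) (use that in linarith)
    qed
    moreover have "AE x in lebesgue. ut x = - G t x * ux x - uxxx x + uxxxxx x"
    proof (rule fourier_determines)
      show "integrable circle ut" by (rule sq_integrable_integrable[OF L2_per_sq_integrable[OF ut(1)]])
      show "integrable circle (\<lambda>x. - G t x * ux x - uxxx x + uxxxxx x)" by (rule fourier_rhs(1)[OF w])
      have "fourier (G t) = U t" by (simp add: fun_eq_iff G(3))
      then show "fourier ut k = fourier (\<lambda>x. - G t x * ux x - uxxx x + uxxxxx x) k" for k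
        by (simp only: fourier_rhs(2)[OF w] ut(2))
      have p: "\<And>x. G t (x + 1) = G t x" "\<And>x. ux (x + 1) = ux x" "\<And>x. uxxx (x + 1) = uxxx x" "\<And>x. uxxxxx (x + 1) = uxxxxx x"
        using w G(1)[of t] by (auto simp: has_weak_deriv_def L2_per_iff)
      show "- G t (x + 1) * ux (x + 1) - uxxx (x + 1) + uxxxxx (x + 1) = - G t x * ux x - uxxx x + uxxxxx x" for x
        by (simp only: p)
      show "ut (x + 1) = ut x" for x using ut(1) by (simp add: L2_per_iff)
    qed
    ultimately show ?thesis using w by blast
  qed
  have "is_solution f (\<lambda>x t. G t x)"
    unfolding is_solution_def using H5 eq G(1,2) by (auto simp: L2_per_iff)
  then show ?thesis by blast
qed

theorem theorem1p1:
  fixes f :: "real \<Rightarrow> real"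
  assumes "f \<in> H_per 5"
  shows "\<exists>u :: real \<Rightarrow> real \<Rightarrow> real. is_solution f u \<and>
           (\<forall>v. is_solution f v \<longrightarrow> (\<forall>t. AE x in lebesgue. v x t = u x t))"
  using solution_exists[OF assms] solution_unique by blast

end
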